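(* Let $\eta\in(0,1)$, $N_B>0$, $N_T=(1-\eta)N_B$, and let $\varepsilon,\delta\in(0,1)$. Consider one-way covert communication from Alice to Bob over the $(\eta,N_T)$-bosonic channel, in which the adversary Eve observes the lost mode. There exists a sequence (in $n$) of $\varepsilon$-reliable and $\delta$-covert codes operating on $n$ phase-modulated two-mode squeezed vacuum (TMSV) states, without secret keys (i.e. key set of size $L=1$), with $M=M_n$ messages such that $$\lim_{n\to\infty}\frac{\log M}{\sqrt n\,\log n}\ \ge\ \frac{\eta}{1-\eta}\cdot\frac{\sqrt{\frac{\eta}{1-\eta}N_T\left(\frac{\eta}{1-\eta}N_T+1\right)}}{N_T+1}\;\delta .$$
   Context: All logarithms are natural. Channel: with transmissivity $\eta$ and noise mean photon number $N_B$, the input mode $\hat a$ is mixed with an environment mode $\hat c$ in the thermal state $\rho_{N_B}=\sum_{n\ge0}\frac{N_B^n}{(N_B+1)^{n+1}}|n\rangle\langle n|$; Bob receives $\hat b=\sqrt\eta\,\hat a+\sqrt{1-\eta}\,\hat c$ (the $(\eta,N_T)$-bosonic channel, $N_T=(1-\eta)N_B$) and Eve receives $\hat e=-\sqrt{1-\eta}\,\hat a+\sqrt\eta\,\hat c$; write $\mathcal E_{A\to E}$ for the resulting channel from Alice to Eve. Resource: $n$ copies of a TMSV state $\rho_{SI}=|\psi\rangle\langle\psi|_{SI}$, $|\psi\rangle_{SI}=\sum_{k\ge0}\sqrt{\frac{N_S^k}{(N_S+1)^{k+1}}}\,|k\rangle_S|k\rangle_I$, whose mean photon number $N_S>0$ may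 depend on $n$; Alice holds the signal modes $S^n$ and Bob the idler modes $I^n$. Code: Alice encodes a message $w\in\{1,\dots,M\}$ and a secret key $k\in\{1,\dots,L\}$ (message $W$ and key $K$ uniform and independent) into a phase sequence $\theta^n=(\theta_1,\dots,\theta_n)$ and applies the phase shift $\theta_i$ (unitary $e^{i\theta_i\hat a^\dagger\hat a}$) to the $i$-th signal mode; this defines a publicly known channel $\mathcal E^{(w,k)}_{S^n\to A^n}$. The modes $A^n$ are sent through $n$ uses of the channel. Bob, knowing $k$, produces an estimate $\widehat W$ by applying a POVM $\{\Pi^{(w,k)}_{B^nI^n}\}_w$ jointly to the received modes $B^n$ and the idlers $I^n$. The code is $\varepsilon$-reliable if $\mathbb E_K[\mathbb P(\widehat W\neq W\mid K)]\le\varepsilon$. Let $\rho_{A^n}^{(w,k)}=\mathrm{tr}_{I^n}\big((\mathcal E^{(w,k)}_{S^n\to A^n}\otimes \mathrm{id}_{I^n})\rho_{SI}^{\otimes n}\big)$, $\hat\rho_E^n=\frac1{ML}\sum_{w=1}^M\sum_{k=1}^L\mathcal E_{A\to E}^{\otimes n}\big(\rho_{A^n}^{(w,k)}\big)$ (Eve's state with communication) and $\rho_{0,E}^{\otimes n}=\mathcal E_{A\to E}^{\otimes n}\big(|0\rangle\langle0|^{\otimes n}\big)$ (Eve's state without communication). The code is $\delta$-covert if $\frac12\|\hat\rho_E^n-\rho_{0,E}^{\otimes n}\|_1\le\delta$. *)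

theory Defs
  imports "HOL-Analysis.Analysis" "HOL-Computational_Algebra.Polynomial"
begin

section \<open>Operators in the number basis\<close>

text \<open>An operator on the Hilbert space with orthonormal basis indexed by a set \<open>S\<close> is given by
  its matrix elements; only the entries with both indices in \<open>S\<close> matter.\<close>

type_synonym 'i op = "'i \<Rightarrow> 'i \<Rightarrow> complex"

definition op_mult :: "'i set \<Rightarrow> 'i op \<Rightarrow> 'i op \<Rightarrow> 'i op" where
  "op_mult S A B = (\<lambda>x y. \<Sum>\<^sub>\<infinity>z\<in>S. A x z * B z y)"

definition op_adj :: "'i op \<Rightarrow> 'i op" where
  "op_adj A = (\<lambda>x y. cnj (A y x))"

definition op_id :: "'i op" where
  "op_id = (\<lambda>x y. if x = y then 1 else 0)"

definition op_conj :: "'i set \<Rightarrow> 'i op \<Rightarrow> 'i op \<Rightarrow> 'i op" where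
  "op_conj S U A = op_mult S (op_mult S U A) (op_adj U)"

definition op_trace :: "'i set \<Rightarrow> 'i op \<Rightarrow> complex" where
  "op_trace S A = (\<Sum>\<^sub>\<infinity>x\<in>S. A x x)"

definition op_tensor :: "'i op \<Rightarrow> 'j op \<Rightarrow> ('i \<times> 'j) op" where
  "op_tensor A B = (\<lambda>(x, y) (x', y'). A x x' * B y y')"

definition ptrace_fst :: "'i set \<Rightarrow> ('i \<times> 'j) op \<Rightarrow> 'j op" where
  "ptrace_fst S A = (\<lambda>y y'. \<Sum>\<^sub>\<infinity>x\<in>S. A (x, y) (x, y'))"

definition ptrace_snd :: "'j set \<Rightarrow> ('i \<times> 'j) op \<Rightarrow> 'i op" where
  "ptrace_snd S A = (\<lambda>x x'. \<Sum>\<^sub>\<infinity>y\<in>S. A (x, y) (x', y))"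

text \<open>\<open>\<Phi> \<otimes> id\<close>: the map \<open>\<Phi>\<close> acts on each block of the second system.\<close>

definition map_tensor_id :: "('i op \<Rightarrow> 'k op) \<Rightarrow> ('i \<times> 'j) op \<Rightarrow> ('k \<times> 'j) op" where
  "map_tensor_id \<Phi> A = (\<lambda>(x, y) (x', y'). \<Phi> (\<lambda>u u'. A (u, y) (u', y')) x x')"

definition op_form :: "'i set \<Rightarrow> 'i op \<Rightarrow> ('i \<Rightarrow> complex) \<Rightarrow> ('i \<Rightarrow> complex) \<Rightarrow> complex" where
  "op_form F A u v = (\<Sum>x\<in>F. \<Sum>y\<in>F. cnj (u x) * A x y * v y)"

definition op_pos :: "'i set \<Rightarrow> 'i op \<Rightarrow> bool" where
  "op_pos S A \<longleftrightarrow> (\<forall>F v. finite F \<and> F \<subseteq> S \<longrightarrow> Im (op_form F A v v) = 0 \<and> 0 \<le> Re (op_form F A v v))"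

definition op_bounded :: "'i set \<Rightarrow> 'i op \<Rightarrow> bool" where
  "op_bounded S A \<longleftrightarrow> (\<exists>c. \<forall>F u v. finite F \<and> F \<subseteq> S \<longrightarrow>
     cmod (op_form F A u v) \<le> c * sqrt (\<Sum>x\<in>F. (cmod (u x))\<^sup>2) * sqrt (\<Sum>x\<in>F. (cmod (v x))\<^sup>2))"

text \<open>\<open>|A|\<close> is the unique positive bounded square root of \<open>A\<^sup>\<dagger>A\<close>, for bounded \<open>A\<close>. Entries outside
  \<open>S\<close> are fixed to 0 so that it is unique as a function as well.\<close>

definition op_abs :: "'i set \<Rightarrow> 'i op \<Rightarrow> 'i op" where
  "op_abs S A = (THE R. op_pos S R \<and> op_bounded S R
     \<and> (\<forall>x\<in>S. \<forall>y\<in>S. op_mult S R R x y = op_mult S (op_adj A) A x y)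
     \<and> (\<forall>x y. \<not> (x \<in> S \<and> y \<in> S) \<longrightarrow> R x y = 0))"

text \<open>Meaningful for trace-class \<open>A\<close>: for other operators \<open>op_trace\<close> returns a default value.\<close>

definition trace_norm :: "'i set \<Rightarrow> 'i op \<Rightarrow> real" where
  "trace_norm S A = Re (op_trace S (op_abs S A))"

definition povm :: "'i set \<Rightarrow> 'w set \<Rightarrow> ('w \<Rightarrow> 'i op) \<Rightarrow> bool" where
  "povm S W P \<longleftrightarrow> (\<forall>w\<in>W. op_pos S (P w))
     \<and> (\<forall>x\<in>S. \<forall>y\<in>S. (\<Sum>w\<in>W. P w x y) = op_id x y)"


section \<open>Bosonic modes\<close>

text \<open>The \<open>n\<close>-mode number states are indexed by lists of \<open>n\<close> photon numbers. A system consisting of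
  two groups of \<open>n\<close> modes is indexed by pairs of such lists.\<close>

definition fock :: "nat \<Rightarrow> nat list set" where
  "fock n = {x. length x = n}"

definition tensor_modes :: "nat \<Rightarrow> (nat \<Rightarrow> nat op) \<Rightarrow> nat list op" where
  "tensor_modes n A = (\<lambda>x y. \<Prod>j<n. A j (x ! j) (y ! j))"

definition tensor_power :: "nat \<Rightarrow> nat op \<Rightarrow> nat list op" where
  "tensor_power n A = tensor_modes n (\<lambda>_. A)"

definition tensor_power2 :: "nat \<Rightarrow> (nat \<times> nat) op \<Rightarrow> (nat list \<times> nat list) op" where
  "tensor_power2 n A = (\<lambda>(x, y) (x', y'). \<Prod>j<n. A (x ! j, y ! j) (x' ! j, y' ! j))"

definition vacuum :: "nat op" where
  "vacuum = (\<lambda>m n. if m = 0 \<and> n = 0 then 1 else 0)"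

definition thermal :: "real \<Rightarrow> nat op" where
  "thermal N = (\<lambda>m n. if m = n then of_real (N ^ n / (N + 1) ^ (n + 1)) else 0)"

definition tmsv_ket :: "real \<Rightarrow> nat \<times> nat \<Rightarrow> complex" where
  "tmsv_ket N = (\<lambda>(s, i). if s = i then of_real (sqrt (N ^ s / (N + 1) ^ (s + 1))) else 0)"

definition tmsv :: "real \<Rightarrow> (nat \<times> nat) op" where
  "tmsv N = (\<lambda>x y. tmsv_ket N x * cnj (tmsv_ket N y))"

definition phase_shift :: "real \<Rightarrow> nat op" where
  "phase_shift t = (\<lambda>m n. if m = n then exp (\<i> * of_real (t * real n)) else 0)"


section \<open>The bosonic channel\<close>

text \<open>The beam splitter is the unitary \<open>U\<close> with \<open>U\<^sup>\<dagger> a U = \<surd>\<eta> a + \<surd>(1 - \<eta>) c\<close> and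
  \<open>U\<^sup>\<dagger> c U = - \<surd>(1 - \<eta>) a + \<surd>\<eta> c\<close> that fixes the vacuum. Equivalently
  \<open>U |m, n\<rangle> = (\<surd>\<eta> b\<^sup>\<dagger> - \<surd>(1 - \<eta>) e\<^sup>\<dagger>)^m (\<surd>(1 - \<eta>) b\<^sup>\<dagger> + \<surd>\<eta> e\<^sup>\<dagger>)^n |0, 0\<rangle> / \<surd>(m! n!)\<close>, which gives
  the matrix element \<open>\<langle>p, q| U |m, n\<rangle>\<close> below, with \<open>b\<^sup>\<dagger>\<close> and \<open>e\<^sup>\<dagger>\<close> replaced by \<open>X\<close> and \<open>1\<close> in the
  homogeneous polynomial of degree \<open>m + n\<close>.\<close>

definition beam_poly :: "real \<Rightarrow> nat \<Rightarrow> nat \<Rightarrow> real poly" where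
  "beam_poly \<eta> m n = [:- sqrt (1 - \<eta>), sqrt \<eta>:] ^ m * [:sqrt \<eta>, sqrt (1 - \<eta>):] ^ n"

definition beam_amp :: "real \<Rightarrow> nat \<Rightarrow> nat \<Rightarrow> nat \<Rightarrow> nat \<Rightarrow> real" where
  "beam_amp \<eta> p q m n =
     (if p + q = m + n
      then sqrt (fact p * fact q / (fact m * fact n)) * coeff (beam_poly \<eta> m n) p
      else 0)"

definition beam_splitter :: "real \<Rightarrow> (nat \<times> nat) op" where
  "beam_splitter \<eta> = (\<lambda>(p, q) (m, n). of_real (beam_amp \<eta> p q m n))"

lemma beam_amp_vacuum: "beam_amp \<eta> p q 0 0 = (if p = 0 \<and> q = 0 then 1 else 0)"
  by (auto simp: beam_amp_def beam_poly_def)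

lemma pderiv_beam_poly:
  "pderiv (beam_poly \<eta> m n) =
     smult (real m * sqrt \<eta>) (beam_poly \<eta> (m - 1) n)
     + smult (real n * sqrt (1 - \<eta>)) (beam_poly \<eta> m (n - 1))"
  by (cases m; cases n)
    (simp_all add: beam_poly_def pderiv_mult pderiv_power_Suc pderiv_pCons algebra_simps
       del: power_Suc)

lemma beam_poly_euler:
  "smult (real (m + n)) (beam_poly \<eta> m n) - pCons 0 (pderiv (beam_poly \<eta> m n)) =
     smult (- (real m * sqrt (1 - \<eta>))) (beam_poly \<eta> (m - 1) n)
     + smult (real n * sqrt \<eta>) (beam_poly \<eta> m (n - 1))"
proof (rule poly_ext)
  fix x :: real
  show "poly (smult (real (m + n)) (beam_poly \<eta> m n) - pCons 0 (pderiv (beam_poly \<eta> m n))) x =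
    poly (smult (- (real m * sqrt (1 - \<eta>))) (beam_poly \<eta> (m - 1) n)
     + smult (real n * sqrt \<eta>) (beam_poly \<eta> m (n - 1))) x"
    unfolding pderiv_beam_poly
    by (cases m; cases n) (simp_all add: beam_poly_def algebra_simps del: real_sqrt_mult_self)
qed

lemma sqrt_fact_step:
  assumes "0 < m"
  shows "sqrt (real m) * sqrt (x / (fact (m - 1) * y)) = real m * sqrt (x / (fact m * y))"
proof -
  have "real m * (x / (fact (m - 1) * y)) = (real m)\<^sup>2 * (x / (fact m * y))"
    using assms by (cases m) (simp_all add: power2_eq_square)
  then show ?thesis
    by (metis real_sqrt_mult real_sqrt_abs abs_of_nat)
qed

lemma beam_amp_lower_m:
  assumes "Suc (p + q) = m + n"
  shows "sqrt (real m) * beam_amp \<eta> p q (m - 1) n =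
    sqrt (fact p * fact q / (fact m * fact n)) * (real m * coeff (beam_poly \<eta> (m - 1) n) p)"
proof (cases "m = 0")
  case False
  then show ?thesis
    using assms sqrt_fact_step[of m "fact p * fact q" "fact n"]
    by (auto simp: beam_amp_def algebra_simps)
qed simp

lemma beam_amp_lower_n:
  assumes "Suc (p + q) = m + n"
  shows "sqrt (real n) * beam_amp \<eta> p q m (n - 1) =
    sqrt (fact p * fact q / (fact m * fact n)) * (real n * coeff (beam_poly \<eta> m (n - 1)) p)"
proof (cases "n = 0")
  case False
  then show ?thesis
    using assms sqrt_fact_step[of n "fact p * fact q" "fact m"]
    by (auto simp: beam_amp_def algebra_simps)
qed simp

text \<open>Matrix elements of \<open>a U = U (\<surd>\<eta> a + \<surd>(1 - \<eta>) c)\<close> and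
  \<open>c U = U (- \<surd>(1 - \<eta>) a + \<surd>\<eta> c)\<close>. Together with
  \<open>beam_amp_vacuum\<close> they determine \<open>U\<close>.\<close>

lemma beam_amp_bob:
  "sqrt (real (Suc p)) * beam_amp \<eta> (Suc p) q m n =
     sqrt \<eta> * sqrt (real m) * beam_amp \<eta> p q (m - 1) n
     + sqrt (1 - \<eta>) * sqrt (real n) * beam_amp \<eta> p q m (n - 1)"
proof (cases "Suc (p + q) = m + n")
  case True
  let ?s = "sqrt (fact p * fact q / (fact m * fact n))"
  have 1: "sqrt (real (Suc p)) * beam_amp \<eta> (Suc p) q m n
      = ?s * (real (Suc p) * coeff (beam_poly \<eta> m n) (Suc p))"
    using True by (simp add: beam_amp_def real_sqrt_mult real_sqrt_divide)
  have 2: "real (Suc p) * coeff (beam_poly \<eta> m n) (Suc p)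
      = coeff (pderiv (beam_poly \<eta> m n)) p"
    by (simp add: coeff_pderiv)
  show ?thesis
    unfolding 1 2 pderiv_beam_poly mult.assoc beam_amp_lower_m[OF True] beam_amp_lower_n[OF True]
    by (simp add: algebra_simps)
next
  case False
  then show ?thesis
    by (cases m; cases n) (auto simp: beam_amp_def)
qed

lemma beam_amp_eve:
  "sqrt (real (Suc q)) * beam_amp \<eta> p (Suc q) m n =
     - sqrt (1 - \<eta>) * sqrt (real m) * beam_amp \<eta> p q (m - 1) n
     + sqrt \<eta> * sqrt (real n) * beam_amp \<eta> p q m (n - 1)"
proof (cases "Suc (p + q) = m + n")
  case True
  let ?s = "sqrt (fact p * fact q / (fact m * fact n))"
  have 1: "sqrt (real (Suc q)) * beam_amp \<eta> p (Suc q) m n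
      = ?s * (real (Suc q) * coeff (beam_poly \<eta> m n) p)"
    using True by (simp add: beam_amp_def real_sqrt_mult real_sqrt_divide)
  have "real (m + n) = real (Suc q) + real p"
    using True by linarith
  then have 2: "real (Suc q) * coeff (beam_poly \<eta> m n) p
      = coeff (smult (real (m + n)) (beam_poly \<eta> m n) - pCons 0 (pderiv (beam_poly \<eta> m n))) p"
    by (cases p) (simp_all add: coeff_pderiv algebra_simps del: of_nat_add)
  show ?thesis
    unfolding 1 2 beam_poly_euler mult.assoc beam_amp_lower_m[OF True] beam_amp_lower_n[OF True]
    by (simp add: algebra_simps beam_amp_lower_m[OF True] beam_amp_lower_n[OF True])
next
  case False
  then show ?thesis
    by (cases m; cases n) (auto simp: beam_amp_def)
qed

text \<open>Joint state of Bob's (first) and Eve's (second) modes after \<open>n\<close> channel uses.\<close>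

definition channel_joint :: "real \<Rightarrow> real \<Rightarrow> nat \<Rightarrow> nat list op \<Rightarrow> (nat list \<times> nat list) op" where
  "channel_joint \<eta> N\<^sub>B n \<rho> =
     op_conj (fock n \<times> fock n) (tensor_power2 n (beam_splitter \<eta>))
       (op_tensor \<rho> (tensor_power n (thermal N\<^sub>B)))"

definition bob_channel :: "real \<Rightarrow> real \<Rightarrow> nat \<Rightarrow> nat list op \<Rightarrow> nat list op" where
  "bob_channel \<eta> N\<^sub>B n \<rho> = ptrace_snd (fock n) (channel_joint \<eta> N\<^sub>B n \<rho>)"

definition eve_channel :: "real \<Rightarrow> real \<Rightarrow> nat \<Rightarrow> nat list op \<Rightarrow> nat list op" where
  "eve_channel \<eta> N\<^sub>B n \<rho> = ptrace_fst (fock n) (channel_joint \<eta> N\<^sub>B n \<rho>)"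


section \<open>Codes on phase-modulated TMSV states\<close>

text \<open>\<open>phases w k j\<close> is the phase applied to mode \<open>j < n\<close> for message \<open>w\<close> and key \<open>k\<close>;
  \<open>decoder k w\<close> is the POVM element on \<open>B\<^sup>n I\<^sup>n\<close> for the estimate \<open>w\<close> under key \<open>k\<close>.\<close>

record tmsv_code =
  photons :: real
  num_msgs :: nat
  num_keys :: nat
  phases :: "nat \<Rightarrow> nat \<Rightarrow> nat \<Rightarrow> real"
  decoder :: "nat \<Rightarrow> nat \<Rightarrow> (nat list \<times> nat list) op"

definition is_code :: "nat \<Rightarrow> tmsv_code \<Rightarrow> bool" where
  "is_code n C \<longleftrightarrow> 0 < photons C \<and> 1 \<le> num_msgs C \<and> 1 \<le> num_keys C
     \<and> (\<forall>k\<in>{1..num_keys C}. povm (fock n \<times> fock n) {1..num_msgs C} (decoder C k))"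

definition encode :: "nat \<Rightarrow> tmsv_code \<Rightarrow> nat \<Rightarrow> nat \<Rightarrow> nat list op \<Rightarrow> nat list op" where
  "encode n C w k = op_conj (fock n) (tensor_modes n (\<lambda>j. phase_shift (phases C w k j)))"

definition encoded_state :: "nat \<Rightarrow> tmsv_code \<Rightarrow> nat \<Rightarrow> nat \<Rightarrow> (nat list \<times> nat list) op" where
  "encoded_state n C w k = map_tensor_id (encode n C w k) (tensor_power2 n (tmsv (photons C)))"

definition alice_state :: "nat \<Rightarrow> tmsv_code \<Rightarrow> nat \<Rightarrow> nat \<Rightarrow> nat list op" where
  "alice_state n C w k = ptrace_snd (fock n) (encoded_state n C w k)"

definition bob_state ::
  "real \<Rightarrow> real \<Rightarrow> nat \<Rightarrow> tmsv_code \<Rightarrow> nat \<Rightarrow> nat \<Rightarrow> (nat list \<times> nat list) op" where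
  "bob_state \<eta> N\<^sub>B n C w k = map_tensor_id (bob_channel \<eta> N\<^sub>B n) (encoded_state n C w k)"

definition prob_estimate ::
  "real \<Rightarrow> real \<Rightarrow> nat \<Rightarrow> tmsv_code \<Rightarrow> nat \<Rightarrow> nat \<Rightarrow> nat \<Rightarrow> real" where
  "prob_estimate \<eta> N\<^sub>B n C k w w' =
     Re (op_trace (fock n \<times> fock n)
           (op_mult (fock n \<times> fock n) (decoder C k w') (bob_state \<eta> N\<^sub>B n C w k)))"

definition error_prob :: "real \<Rightarrow> real \<Rightarrow> nat \<Rightarrow> tmsv_code \<Rightarrow> nat \<Rightarrow> real" where
  "error_prob \<eta> N\<^sub>B n C k =
     (\<Sum>w\<in>{1..num_msgs C}. \<Sum>w'\<in>{1..num_msgs C} - {w}. prob_estimate \<eta> N\<^sub>B n C k w w')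
     / real (num_msgs C)"

definition reliable :: "real \<Rightarrow> real \<Rightarrow> nat \<Rightarrow> real \<Rightarrow> tmsv_code \<Rightarrow> bool" where
  "reliable \<eta> N\<^sub>B n \<epsilon> C \<longleftrightarrow>
     (\<Sum>k\<in>{1..num_keys C}. error_prob \<eta> N\<^sub>B n C k) / real (num_keys C) \<le> \<epsilon>"

definition eve_state :: "real \<Rightarrow> real \<Rightarrow> nat \<Rightarrow> tmsv_code \<Rightarrow> nat list op" where
  "eve_state \<eta> N\<^sub>B n C = (\<lambda>x y.
     (\<Sum>w\<in>{1..num_msgs C}. \<Sum>k\<in>{1..num_keys C}. eve_channel \<eta> N\<^sub>B n (alice_state n C w k) x y)
     / of_nat (num_msgs C * num_keys C))"

definition eve_idle_state :: "real \<Rightarrow> real \<Rightarrow> nat \<Rightarrow> nat list op" where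
  "eve_idle_state \<eta> N\<^sub>B n = eve_channel \<eta> N\<^sub>B n (tensor_power n vacuum)"

definition covert :: "real \<Rightarrow> real \<Rightarrow> nat \<Rightarrow> real \<Rightarrow> tmsv_code \<Rightarrow> bool" where
  "covert \<eta> N\<^sub>B n \<delta> C \<longleftrightarrow>
     trace_norm (fock n) (\<lambda>x y. eve_state \<eta> N\<^sub>B n C x y - eve_idle_state \<eta> N\<^sub>B n x y) / 2 \<le> \<delta>"

end

(*
Phase shifts do not affect the reduced signal state, so Eve sees a product of thermal states whatever
the code is, and covertness only limits the brightness: with mu = eta N_B the total variation distance
to the idle state is at most sqrt n (1 - eta) N_S / (2 sqrt (mu (mu + 1))) by a Hellinger estimate,
which allows N_S of order delta / sqrt n.

Bob's joint state of a mode is block diagonal in d, his photon number minus that of the idler. For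
d >= 0 it is, up to an incoherent positive term and to first order in N_S, the pure superposition
|d, 0> + e^(i theta) c sqrt (d + 1) |d + 1, 1> with c^2 = N_S eta / (N_T + 1)^2. Group the modes in
blocks of A R modes and signal a symbol m < A by the phases 2 pi m l / A on the l-th group of R modes
of the block. Given d, projecting the one-idler-photon space on the Fourier vectors recovers m with
probability about A R N_S eta / (N_T + 1): averaging over R modes removes the fluctuation of the
weights d + 1. Every block is thus an erasure channel with alphabet of size A of order sqrt n, each
success is worth log A ~ (log n) / 2, and there are about n N_S eta / (N_T + 1) successes. False
agreements cost only a factor 2^(number of blocks), which is exp (O (sqrt n)), so a greedily chosen
codebook achieves the rate.
*)

theory Submission
  imports Defs "HOL-Real_Asymp.Real_Asymp"
begin

text \<open>The alphabet size is squeezed from two sides. A success is worth \<open>ln A\<close>, so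
  \<open>A\<close> must grow like sqrt n; but the \<open>A * R\<close> idlers of a block must rarely
  hold a second photon, so \<open>A * R * N\<^sub>S\<close> must stay small while
  \<open>N\<^sub>S\<close> is itself of order 1 / sqrt n. Hence \<open>A\<close> is a small constant
  times sqrt n. Origin of the constant: \<open>N\<^sub>S\<close> saturates the Hellinger bound, so
  it carries a factor 2, which cancels against the 1/2 in \<open>ln A ~ (ln n) / 2\<close>. The
  factor \<open>\<eta> / (N\<^sub>T + 1)\<close> is c^2 / \<open>N\<^sub>S\<close> times the thermal
  mean \<open>N\<^sub>T + 1\<close> of d + 1. Infinite dimension causes three complications:
  \<open>op_abs\<close> is a \<open>THE\<close>, so uniqueness of the positive root has to be
  proved; infinite sums have a default value, so traces are carried together with their convergence;
  and the measurement resolves only a finite set of patterns d, which keeps the symbol outcomes of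
  finite rank. Codes are wanted at every n and the limit must exist, so the number of messages is
  the largest achievable one below a cap at the target rate.\<close>

no_notation Infinite_Set_Sum.abs_summable_on (infix "abs'_summable'_on" 50)

section \<open>Unconditional sums over lists of photon numbers\<close>

section \<open>Sums over products\<close>

lemma abs_summable_times:
  fixes f :: "'a \<Rightarrow> 'c :: {real_normed_field, banach}" and g :: "'b \<Rightarrow> 'c"
  assumes "f abs_summable_on A" and "g abs_summable_on B"
  shows "(\<lambda>(x, y). f x * g y) abs_summable_on A \<times> B"
proof -
  have "(\<lambda>z. norm (f (fst z)) * norm (g (snd z))) summable_on Sigma A (\<lambda>_. B)"
  proof (rule summable_on_SigmaI)
    show "((\<lambda>y. norm (f (fst (x, y))) * norm (g (snd (x, y)))) has_sum
      norm (f x) * (\<Sum>\<^sub>\<infinity>y\<in>B. norm (g y))) B" for x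
      using assms(2) by (simp add: has_sum_cmult_right)
    show "(\<lambda>x. norm (f x) * (\<Sum>\<^sub>\<infinity>y\<in>B. norm (g y))) summable_on A"
      using assms(1) by (rule summable_on_cmult_left)
  qed auto
  then show ?thesis
    by (simp add: case_prod_beta norm_mult)
qed

lemma has_sum_times:
  fixes f :: "'a \<Rightarrow> 'c :: {real_normed_field, banach}" and g :: "'b \<Rightarrow> 'c"
  assumes "f abs_summable_on A" and "g abs_summable_on B"
  shows "((\<lambda>(x, y). f x * g y) has_sum (infsum f A * infsum g B)) (A \<times> B)"
proof (rule has_sum_SigmaI)
  show "(case_prod (\<lambda>x y. f x * g y)) summable_on A \<times> B"
    using abs_summable_times[OF assms] by (rule abs_summable_summable)
  show "((\<lambda>y. case (x, y) of (x, y) \<Rightarrow> f x * g y) has_sum f x * infsum g B) B" for x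
    using assms(2) by (simp add: has_sum_cmult_right abs_summable_summable)
  show "((\<lambda>x. f x * infsum g B) has_sum infsum f A * infsum g B) A"
    using assms(1) by (simp add: has_sum_cmult_left abs_summable_summable)
qed

lemma nlists_Suc:
  "bij_betw (\<lambda>(a, x). a # x) (UNIV \<times> {x. length x = n}) {x. length x = Suc n}"
  by (rule bij_betwI[where g = "\<lambda>x. (hd x, tl x)"]) (auto simp: length_Suc_conv)

text \<open>Absolute convergence and the value share one induction: splitting off the head of a list
  needs the tail product to be absolutely summable.\<close>

lemma prod_nlists:
  fixes f :: "nat \<Rightarrow> 'a \<Rightarrow> 'c :: {real_normed_field, banach}"
  assumes "\<And>j. j < n \<Longrightarrow> f j abs_summable_on UNIV"
  shows "(\<lambda>x. \<Prod>j<n. f j (x ! j)) abs_summable_on {x. length x = n} \<and>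
    ((\<lambda>x. \<Prod>j<n. f j (x ! j)) has_sum (\<Prod>j<n. infsum (f j) UNIV)) {x. length x = n}"
  using assms
proof (induction n arbitrary: f)
  case 0
  then show ?case by (auto intro: has_sum_finiteI)
next
  case (Suc n)
  let ?g = "\<lambda>x. \<Prod>j<n. f (Suc j) (x ! j)"
  have IH: "?g abs_summable_on {x. length x = n}"
    "(?g has_sum (\<Prod>j<n. infsum (f (Suc j)) UNIV)) {x. length x = n}"
    using Suc.IH[of "\<lambda>j. f (Suc j)"] Suc.prems by auto
  have f0: "f 0 abs_summable_on UNIV"
    using Suc.prems by auto
  have eq: "(\<Prod>j<Suc n. f j ((case z of (a, x) \<Rightarrow> a # x) ! j)) = (case z of (a, x) \<Rightarrow> f 0 a * ?g x)"
    for z by (cases z) (simp only: prod.lessThan_Suc_shift case_prod_conv nth_Cons_0 nth_Cons_Suc)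
  have A: "(\<lambda>x. \<Prod>j<Suc n. f j (x ! j)) abs_summable_on {x. length x = Suc n}"
    using abs_summable_times[OF f0 IH(1)]
    unfolding summable_on_reindex_bij_betw[OF nlists_Suc, symmetric] eq .
  have "infsum ?g {x. length x = n} = (\<Prod>j<n. infsum (f (Suc j)) UNIV)"
    using IH(2) by (rule infsumI)
  then have "(\<Prod>j<Suc n. infsum (f j) UNIV) = infsum (f 0) UNIV * infsum ?g {x. length x = n}"
    by (simp only: prod.lessThan_Suc_shift)
  then have "((\<lambda>x. \<Prod>j<Suc n. f j (x ! j)) has_sum (\<Prod>j<Suc n. infsum (f j) UNIV)) {x. length x = Suc n}"
    using has_sum_times[OF f0 IH(1)]
    unfolding has_sum_reindex_bij_betw[OF nlists_Suc, symmetric] eq by simp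
  with A show ?case by blast
qed

lemma has_sum_prod_fock:
  fixes f :: "nat \<Rightarrow> nat \<Rightarrow> 'c :: {real_normed_field, banach}"
  assumes "\<And>j. j < n \<Longrightarrow> f j abs_summable_on UNIV"
  shows "((\<lambda>x. \<Prod>j<n. f j (x ! j)) has_sum (\<Prod>j<n. infsum (f j) UNIV)) (fock n)"
  using prod_nlists[OF assms] by (simp add: fock_def)

lemma infsum_prod_fock:
  fixes f :: "nat \<Rightarrow> nat \<Rightarrow> 'c :: {real_normed_field, banach}"
  assumes "\<And>j. j < n \<Longrightarrow> f j abs_summable_on UNIV"
  shows "(\<Sum>\<^sub>\<infinity>x\<in>fock n. \<Prod>j<n. f j (x ! j)) = (\<Prod>j<n. \<Sum>\<^sub>\<infinity>a. f j a)"
  using has_sum_prod_fock[OF assms] by (rule infsumI)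

lemma fock_pairs:
  "bij_betw (\<lambda>z. (map fst z, map snd z)) {z :: (nat \<times> nat) list. length z = n} (fock n \<times> fock n)"
  by (rule bij_betwI[where g = "\<lambda>(x, y). zip x y"]) (auto simp: fock_def zip_map_fst_snd)

text \<open>A pair of lists of length \<open>n\<close> is a list of \<open>n\<close> pairs, so this
  is the one-group rule with pairs as letters.\<close>

lemma prod_fock2:
  fixes f :: "nat \<Rightarrow> nat \<Rightarrow> nat \<Rightarrow> 'c :: {real_normed_field, banach}"
  assumes "\<And>j. j < n \<Longrightarrow> (\<lambda>(a, b). f j a b) abs_summable_on UNIV"
  shows "(\<lambda>(x, y). \<Prod>j<n. f j (x ! j) (y ! j)) abs_summable_on fock n \<times> fock n"
    and "((\<lambda>(x, y). \<Prod>j<n. f j (x ! j) (y ! j)) has_sum (\<Prod>j<n. \<Sum>\<^sub>\<infinity>(a, b). f j a b)) (fock n \<times> fock n)"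
proof -
  have eq: "(\<Prod>j<n. f j (map fst z ! j) (map snd z ! j)) = (\<Prod>j<n. f j (fst (z ! j)) (snd (z ! j)))"
    if "z \<in> {z. length z = n}" for z
    using that by (intro prod.cong) auto
  note P = prod_nlists[of n "\<lambda>j. (\<lambda>(a, b). f j a b)", OF assms, unfolded case_prod_unfold]
  show "(\<lambda>(x, y). \<Prod>j<n. f j (x ! j) (y ! j)) abs_summable_on fock n \<times> fock n"
    unfolding summable_on_reindex_bij_betw[OF fock_pairs, symmetric] prod.case
    using conjunct1[OF P] by (subst summable_on_cong) (auto simp: eq case_prod_beta)
  show "((\<lambda>(x, y). \<Prod>j<n. f j (x ! j) (y ! j)) has_sum (\<Prod>j<n. \<Sum>\<^sub>\<infinity>(a, b). f j a b)) (fock n \<times> fock n)"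
    unfolding has_sum_reindex_bij_betw[OF fock_pairs, symmetric] prod.case
    using conjunct2[OF P] by (subst has_sum_cong) (auto simp: eq case_prod_unfold)
qed

lemma infsum_prod_fock2:
  fixes f :: "nat \<Rightarrow> nat \<Rightarrow> nat \<Rightarrow> 'c :: {real_normed_field, banach}"
  assumes "\<And>j. j < n \<Longrightarrow> (\<lambda>(a, b). f j a b) abs_summable_on UNIV"
  shows "(\<Sum>\<^sub>\<infinity>(x, y)\<in>fock n \<times> fock n. \<Prod>j<n. f j (x ! j) (y ! j)) = (\<Prod>j<n. \<Sum>\<^sub>\<infinity>(a, b). f j a b)"
  using prod_fock2(2)[OF assms] by (rule infsumI)

section \<open>The beam splitter\<close>

lemma beam_amp_eq_0: "p + q \<noteq> m + n \<Longrightarrow> beam_amp \<eta> p q m n = 0"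
  by (simp add: beam_amp_def)

lemma degree_beam_poly: "degree (beam_poly \<eta> m n) \<le> m + n"
proof -
  have "degree ([:- sqrt (1 - \<eta>), sqrt \<eta>:] ^ m) \<le> m"
    using degree_power_le[of "[:- sqrt (1 - \<eta>), sqrt \<eta>:]" m]
    by (rule order_trans) (simp add: mult_le_cancel2)
  moreover have "degree ([:sqrt \<eta>, sqrt (1 - \<eta>):] ^ n) \<le> n"
    using degree_power_le[of "[:sqrt \<eta>, sqrt (1 - \<eta>):]" n]
    by (rule order_trans) (simp add: mult_le_cancel2)
  ultimately show ?thesis
    unfolding beam_poly_def by (rule order_trans[OF degree_mult_le add_mono])
qed

lemma sqrt_fact_raise: "0 < p \<Longrightarrow> sqrt (real p) * sqrt (fact (p - 1) * x) = sqrt (fact p * x)"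
  by (cases p) (simp_all add: real_sqrt_mult mult_ac del: of_nat_Suc)

text \<open>Adding an input photon multiplies \<open>beam_poly\<close> by a linear factor
  \<open>[:a, b:]\<close>; the coefficient \<open>b\<close> of the variable feeds Bob's photon
  number and the constant \<open>a\<close> feeds Eve's.\<close>

lemma beam_amp_raise_aux:
  assumes "p + q = Suc (m + n)" and "B = [:a, b:] * beam_poly \<eta> m n"
  shows "sqrt (fact p * fact q / (fact m * fact n)) * coeff B p =
     b * sqrt (real p) * beam_amp \<eta> (p - 1) q m n + a * sqrt (real q) * beam_amp \<eta> p (q - 1) m n"
proof -
  let ?P = "beam_poly \<eta> m n" and ?f = "fact m * fact n :: real"
  have 1: "sqrt (real p) * beam_amp \<eta> (p - 1) q m n =
      sqrt (fact p * fact q / ?f) * (if p = 0 then 0 else coeff ?P (p - 1))"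
    using assms(1) sqrt_fact_raise[of p "fact q / ?f"] by (auto simp: beam_amp_def)
  have 2: "sqrt (real q) * beam_amp \<eta> p (q - 1) m n = sqrt (fact p * fact q / ?f) * coeff ?P p"
  proof (cases "q = 0")
    case True
    \<comment> \<open>Here \<open>p = Suc (m + n)\<close> exceeds the degree, so the right side
      vanishes together with \<open>sqrt (real q)\<close>.\<close>
    then have "coeff ?P p = 0"
      using assms(1) degree_beam_poly[of \<eta> m n] by (intro coeff_eq_0) auto
    with True show ?thesis by simp
  next
    case False
    then show ?thesis
      using assms(1) sqrt_fact_raise[of q "fact p / ?f"] by (auto simp: beam_amp_def mult.commute)
  qed
  have "coeff B p = a * coeff ?P p + b * (if p = 0 then 0 else coeff ?P (p - 1))"
    unfolding assms(2) by (cases p) simp_all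
  then show ?thesis
    unfolding mult.assoc 1 2 by (simp add: algebra_simps)
qed

text \<open>Creating an input photon before \<open>U\<close> amounts to creating it in the rotated
  output modes after \<open>U\<close>. At \<open>p = 0\<close> or \<open>q = 0\<close> the square
  root cancels the term with the truncated index.\<close>

lemma beam_amp_raise_m:
  "sqrt (real (Suc m)) * beam_amp \<eta> p q (Suc m) n =
     sqrt \<eta> * sqrt (real p) * beam_amp \<eta> (p - 1) q m n
     - sqrt (1 - \<eta>) * sqrt (real q) * beam_amp \<eta> p (q - 1) m n"
proof (cases "p + q = Suc (m + n)")
  case True
  have "sqrt (real (Suc m)) * beam_amp \<eta> p q (Suc m) n =
      sqrt (fact p * fact q / (fact m * fact n)) * coeff (beam_poly \<eta> (Suc m) n) p"
    using True by (simp add: beam_amp_def real_sqrt_mult real_sqrt_divide)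
  also have "\<dots> = sqrt \<eta> * sqrt (real p) * beam_amp \<eta> (p - 1) q m n
      + - sqrt (1 - \<eta>) * sqrt (real q) * beam_amp \<eta> p (q - 1) m n"
    by (rule beam_amp_raise_aux[OF True]) (simp add: beam_poly_def algebra_simps)
  finally show ?thesis by simp
next
  case False
  then show ?thesis by (cases p; cases q) (auto simp: beam_amp_def)
qed

lemma beam_amp_raise_n:
  "sqrt (real (Suc n)) * beam_amp \<eta> p q m (Suc n) =
     sqrt (1 - \<eta>) * sqrt (real p) * beam_amp \<eta> (p - 1) q m n
     + sqrt \<eta> * sqrt (real q) * beam_amp \<eta> p (q - 1) m n"
proof (cases "p + q = Suc (m + n)")
  case True
  have "sqrt (real (Suc n)) * beam_amp \<eta> p q m (Suc n) =
      sqrt (fact p * fact q / (fact m * fact n)) * coeff (beam_poly \<eta> m (Suc n)) p"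
    using True by (simp add: beam_amp_def real_sqrt_mult real_sqrt_divide)
  also have "\<dots> = sqrt (1 - \<eta>) * sqrt (real p) * beam_amp \<eta> (p - 1) q m n
      + sqrt \<eta> * sqrt (real q) * beam_amp \<eta> p (q - 1) m n"
    by (rule beam_amp_raise_aux[OF True]) (simp add: beam_poly_def algebra_simps)
  finally show ?thesis by simp
next
  case False
  then show ?thesis by (cases p; cases q) (auto simp: beam_amp_def)
qed

lemma sum_raise:
  fixes f :: "nat \<Rightarrow> real"
  shows "(\<Sum>p\<le>Suc L. sqrt (real p) * f p) = (\<Sum>p\<le>L. sqrt (real (Suc p)) * f (Suc p))"
    and "(\<Sum>p\<le>Suc L. sqrt (real (Suc L - p)) * f p) = (\<Sum>p\<le>L. sqrt (real (Suc L - p)) * f p)"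
  by (simp only: sum.atMost_Suc_shift, simp) simp

context
  fixes \<eta> :: real
  assumes \<eta>: "0 \<le> \<eta>" "\<eta> \<le> 1"
begin

text \<open>Unitarity: raising on one side of the inner product is lowering on the other.\<close>

lemma beam_norm_step_m:
  "(\<Sum>p\<le>Suc (m + n). (beam_amp \<eta> p (Suc (m + n) - p) (Suc m) n)\<^sup>2) =
     (\<Sum>p\<le>m + n. (beam_amp \<eta> p (m + n - p) m n)\<^sup>2)"
proof -
  define L where "L = m + n"
  let ?U = "\<lambda>p. beam_amp \<eta> p (Suc L - p) (Suc m) n"
  let ?V = "\<lambda>p. beam_amp \<eta> p (L - p) m n"
  let ?W = "\<lambda>p. beam_amp \<eta> p (L - p) (Suc m) (n - 1)"
  let ?u = "sqrt \<eta>" and ?v = "sqrt (1 - \<eta>)"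
  have "sqrt (real (Suc m)) * (\<Sum>p\<le>Suc L. (?U p)\<^sup>2) =
      (\<Sum>p\<le>Suc L. (sqrt (real (Suc m)) * ?U p) * ?U p)"
    by (simp only: sum_distrib_left power2_eq_square mult.assoc)
  also have "\<dots> = (\<Sum>p\<le>Suc L. sqrt (real p) * (?u * beam_amp \<eta> (p - 1) (Suc L - p) m n * ?U p))
      - (\<Sum>p\<le>Suc L. sqrt (real (Suc L - p)) * (?v * beam_amp \<eta> p (Suc L - p - 1) m n * ?U p))"
    unfolding beam_amp_raise_m sum_subtractf[symmetric] by (intro sum.cong) (auto simp: algebra_simps)
  also have "\<dots> = (\<Sum>p\<le>L. ?u * ?V p * (sqrt (real (Suc p)) * ?U (Suc p)))
      - (\<Sum>p\<le>L. ?v * ?V p * (sqrt (real (Suc (L - p))) * ?U p))"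
    unfolding sum_raise by (intro arg_cong2[of _ _ _ _ minus] sum.cong) (auto simp: Suc_diff_le algebra_simps)
  also have "\<dots> = (\<Sum>p\<le>L. ?u * ?V p * (?u * sqrt (real (Suc m)) * ?V p + ?v * sqrt (real n) * ?W p)
      - ?v * ?V p * (- ?v * sqrt (real (Suc m)) * ?V p + ?u * sqrt (real n) * ?W p))"
    unfolding sum_subtractf[symmetric]
  proof (intro sum.cong refl)
    fix p assume "p \<in> {..L}"
    then have "Suc L - p = Suc (L - p)" by auto
    then show "?u * ?V p * (sqrt (real (Suc p)) * ?U (Suc p)) - ?v * ?V p * (sqrt (real (Suc (L - p))) * ?U p) =
      ?u * ?V p * (?u * sqrt (real (Suc m)) * ?V p + ?v * sqrt (real n) * ?W p)
      - ?v * ?V p * (- ?v * sqrt (real (Suc m)) * ?V p + ?u * sqrt (real n) * ?W p)"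
      using beam_amp_bob[of p \<eta> "L - p" "Suc m" n] beam_amp_eve[of "L - p" \<eta> p "Suc m" n]
      by (simp only: diff_Suc_1 diff_Suc_Suc)
  qed
  \<comment> \<open>The terms with \<open>?W\<close> from the two outputs cancel.\<close>
  also have "\<dots> = (\<Sum>p\<le>L. (?u\<^sup>2 + ?v\<^sup>2) * (sqrt (real (Suc m)) * (?V p)\<^sup>2))"
    by (intro sum.cong) (auto simp: power2_eq_square algebra_simps simp del: real_sqrt_mult_self)
  also have "?u\<^sup>2 + ?v\<^sup>2 = 1"
    using \<eta> by simp
  finally show ?thesis
    unfolding L_def mult_1 sum_distrib_left[symmetric] by simp
qed

text \<open>Base column of the unitarity induction: with the first input empty, only the second
  input is raised and lowered.\<close>

lemma beam_norm_step_n: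
  "(\<Sum>p\<le>Suc n. (beam_amp \<eta> p (Suc n - p) 0 (Suc n))\<^sup>2) = (\<Sum>p\<le>n. (beam_amp \<eta> p (n - p) 0 n)\<^sup>2)"
proof -
  let ?U = "\<lambda>p. beam_amp \<eta> p (Suc n - p) 0 (Suc n)"
  let ?V = "\<lambda>p. beam_amp \<eta> p (n - p) 0 n"
  let ?u = "sqrt \<eta>" and ?v = "sqrt (1 - \<eta>)"
  have "sqrt (real (Suc n)) * (\<Sum>p\<le>Suc n. (?U p)\<^sup>2) =
      (\<Sum>p\<le>Suc n. (sqrt (real (Suc n)) * ?U p) * ?U p)"
    by (simp only: sum_distrib_left power2_eq_square mult.assoc)
  also have "\<dots> = (\<Sum>p\<le>Suc n. sqrt (real p) * (?v * beam_amp \<eta> (p - 1) (Suc n - p) 0 n * ?U p))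
      + (\<Sum>p\<le>Suc n. sqrt (real (Suc n - p)) * (?u * beam_amp \<eta> p (Suc n - p - 1) 0 n * ?U p))"
    unfolding beam_amp_raise_n sum.distrib[symmetric] by (intro sum.cong) (auto simp: algebra_simps)
  also have "\<dots> = (\<Sum>p\<le>n. ?v * ?V p * (sqrt (real (Suc p)) * ?U (Suc p)))
      + (\<Sum>p\<le>n. ?u * ?V p * (sqrt (real (Suc (n - p))) * ?U p))"
    unfolding sum_raise by (intro arg_cong2[of _ _ _ _ plus] sum.cong) (auto simp: Suc_diff_le algebra_simps)
  also have "\<dots> = (\<Sum>p\<le>n. ?v * ?V p * (?v * sqrt (real (Suc n)) * ?V p)
      + ?u * ?V p * (?u * sqrt (real (Suc n)) * ?V p))"
    unfolding sum.distrib[symmetric]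
  proof (intro sum.cong refl)
    fix p assume "p \<in> {..n}"
    then have "Suc n - p = Suc (n - p)" by auto
    then show "?v * ?V p * (sqrt (real (Suc p)) * ?U (Suc p)) + ?u * ?V p * (sqrt (real (Suc (n - p))) * ?U p) =
      ?v * ?V p * (?v * sqrt (real (Suc n)) * ?V p) + ?u * ?V p * (?u * sqrt (real (Suc n)) * ?V p)"
      using beam_amp_bob[of p \<eta> "n - p" 0 "Suc n"] beam_amp_eve[of "n - p" \<eta> p 0 "Suc n"]
      by (simp only: diff_Suc_1 diff_Suc_Suc of_nat_0 real_sqrt_zero mult_zero_right mult_zero_left add_0_left)
  qed
  also have "\<dots> = (\<Sum>p\<le>n. (?u\<^sup>2 + ?v\<^sup>2) * (sqrt (real (Suc n)) * (?V p)\<^sup>2))"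
    by (intro sum.cong) (auto simp: power2_eq_square algebra_simps simp del: real_sqrt_mult_self)
  also have "?u\<^sup>2 + ?v\<^sup>2 = 1"
    using \<eta> by simp
  finally show ?thesis
    unfolding mult_1 sum_distrib_left[symmetric] by simp
qed

lemma beam_norm: "(\<Sum>p\<le>m + n. (beam_amp \<eta> p (m + n - p) m n)\<^sup>2) = 1"
proof (induction m)
  case 0
  show ?case
  proof (induction n)
    case 0
    then show ?case by (simp add: beam_amp_vacuum)
  next
    case (Suc n)
    then show ?case using beam_norm_step_n[of n] by simp
  qed
next
  case (Suc m)
  then show ?case using beam_norm_step_m[of m n] by simp
qed

lemma beam_amp_le_1: "\<bar>beam_amp \<eta> p q m n\<bar> \<le> 1"
proof (cases "p + q = m + n")
  case True
  then have "q = m + n - p" "p \<le> m + n" by auto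
  then have "(beam_amp \<eta> p q m n)\<^sup>2 \<le> (\<Sum>p\<le>m + n. (beam_amp \<eta> p (m + n - p) m n)\<^sup>2)"
    using member_le_sum[of p "{..m + n}" "\<lambda>p. (beam_amp \<eta> p (m + n - p) m n)\<^sup>2"] by auto
  then show ?thesis
    unfolding beam_norm by (simp add: abs_square_le_1)
qed (simp add: beam_amp_def)

end

section \<open>Partial traces of Gaussian operators\<close>

text \<open>\<open>gram \<alpha> \<nu>\<close> is \<open>U (\<alpha>^(a\<^sup>\<dagger>a) \<otimes> \<nu>^(c\<^sup>\<dagger>c)) U\<^sup>\<dagger>\<close>, the unnormalised output for two thermal inputs.\<close>

definition gram :: "real \<Rightarrow> real \<Rightarrow> real \<Rightarrow> nat \<Rightarrow> nat \<Rightarrow> nat \<Rightarrow> nat \<Rightarrow> real" where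
  "gram \<eta> \<alpha> \<nu> p q p' q' = (\<Sum>m\<le>p + q. \<alpha> ^ m * \<nu> ^ (p + q - m)
      * beam_amp \<eta> p q m (p + q - m) * beam_amp \<eta> p' q' m (p + q - m))"

lemma gram_0: "gram \<eta> \<alpha> \<nu> 0 0 0 0 = 1"
  by (simp add: gram_def beam_amp_vacuum)

lemma gram_nonneg: "0 \<le> \<alpha> \<Longrightarrow> 0 \<le> \<nu> \<Longrightarrow> 0 \<le> gram \<eta> \<alpha> \<nu> p q p q"
  unfolding gram_def by (intro sum_nonneg) (simp add: mult.assoc)

text \<open>Moving a creation operator past the weights costs a factor \<alpha> or \<nu>. Lowering
  on the primed side, with coefficients \<open>a\<close> and \<open>b\<close> over the two inputs,
  thus becomes raising on the unprimed side, and what remains is again a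
  \<open>gram\<close>.\<close>

lemma gram_raise_sum:
  assumes "p + q = Suc L"
  shows "(\<Sum>m\<le>Suc L. \<alpha> ^ m * \<nu> ^ (Suc L - m) * beam_amp \<eta> p q m (Suc L - m)
      * (a * sqrt (real m) * beam_amp \<eta> p' q' (m - 1) (Suc L - m)
        + b * sqrt (real (Suc L - m)) * beam_amp \<eta> p' q' m (Suc L - m - 1))) =
    (a * \<alpha> * sqrt \<eta> + b * \<nu> * sqrt (1 - \<eta>)) * sqrt (real p) * gram \<eta> \<alpha> \<nu> (p - 1) q p' q'
    + (b * \<nu> * sqrt \<eta> - a * \<alpha> * sqrt (1 - \<eta>)) * sqrt (real q) * gram \<eta> \<alpha> \<nu> p (q - 1) p' q'"
proof -
  let ?u = "sqrt \<eta>" and ?v = "sqrt (1 - \<eta>)"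
  let ?B = "\<lambda>m. beam_amp \<eta> p' q' m (L - m)"
  let ?P = "\<lambda>m. beam_amp \<eta> (p - 1) q m (L - m)" and ?Q = "\<lambda>m. beam_amp \<eta> p (q - 1) m (L - m)"
  have "(\<Sum>m\<le>Suc L. \<alpha> ^ m * \<nu> ^ (Suc L - m) * beam_amp \<eta> p q m (Suc L - m)
      * (a * sqrt (real m) * beam_amp \<eta> p' q' (m - 1) (Suc L - m)
        + b * sqrt (real (Suc L - m)) * beam_amp \<eta> p' q' m (Suc L - m - 1)))
    = (\<Sum>m\<le>Suc L. sqrt (real m) * (a * \<alpha> ^ m * \<nu> ^ (Suc L - m) * beam_amp \<eta> p q m (Suc L - m)
          * beam_amp \<eta> p' q' (m - 1) (Suc L - m)))
      + (\<Sum>m\<le>Suc L. sqrt (real (Suc L - m)) * (b * \<alpha> ^ m * \<nu> ^ (Suc L - m) * beam_amp \<eta> p q m (Suc L - m)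
          * beam_amp \<eta> p' q' m (Suc L - m - 1)))"
    unfolding sum.distrib[symmetric] by (intro sum.cong) (auto simp: algebra_simps)
  also have "\<dots> = (\<Sum>m\<le>L. a * \<alpha> * \<alpha> ^ m * \<nu> ^ (L - m) * ?B m * (sqrt (real (Suc m)) * beam_amp \<eta> p q (Suc m) (L - m)))
      + (\<Sum>m\<le>L. b * \<nu> * \<alpha> ^ m * \<nu> ^ (L - m) * ?B m * (sqrt (real (Suc (L - m))) * beam_amp \<eta> p q m (Suc (L - m))))"
    unfolding sum_raise by (intro arg_cong2[of _ _ _ _ plus] sum.cong) (auto simp: Suc_diff_le algebra_simps)
  also have "\<dots> = (\<Sum>m\<le>L. (a * \<alpha> * ?u + b * \<nu> * ?v) * sqrt (real p) * (\<alpha> ^ m * \<nu> ^ (L - m) * ?P m * ?B m)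
      + (b * \<nu> * ?u - a * \<alpha> * ?v) * sqrt (real q) * (\<alpha> ^ m * \<nu> ^ (L - m) * ?Q m * ?B m))"
    unfolding sum.distrib[symmetric] beam_amp_raise_m beam_amp_raise_n
    by (intro sum.cong) (auto simp: algebra_simps)
  also have "\<dots> = (a * \<alpha> * ?u + b * \<nu> * ?v) * (sqrt (real p) * (\<Sum>m\<le>L. \<alpha> ^ m * \<nu> ^ (L - m) * ?P m * ?B m))
      + (b * \<nu> * ?u - a * \<alpha> * ?v) * (sqrt (real q) * (\<Sum>m\<le>L. \<alpha> ^ m * \<nu> ^ (L - m) * ?Q m * ?B m))"
    by (simp add: sum.distrib sum_distrib_left mult.assoc)
  also have "sqrt (real p) * (\<Sum>m\<le>L. \<alpha> ^ m * \<nu> ^ (L - m) * ?P m * ?B m)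
      = sqrt (real p) * gram \<eta> \<alpha> \<nu> (p - 1) q p' q'"
    using assms by (cases p) (auto simp: gram_def)
  also have "sqrt (real q) * (\<Sum>m\<le>L. \<alpha> ^ m * \<nu> ^ (L - m) * ?Q m * ?B m)
      = sqrt (real q) * gram \<eta> \<alpha> \<nu> p (q - 1) p' q'"
    using assms by (cases q) (auto simp: gram_def)
  finally show ?thesis by (simp add: mult.assoc)
qed

text \<open>The coefficients here and in \<open>gram_raise_q\<close> form the matrix diag(\<alpha>,
  \<nu>) rotated by the beam splitter; both relations share its off-diagonal entry.\<close>

lemma gram_raise_p:
  assumes "0 \<le> \<eta>" "\<eta> \<le> 1" and "p + q = Suc (p' + q')"
  shows "sqrt (real (Suc p')) * gram \<eta> \<alpha> \<nu> p q (Suc p') q' =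
    (\<eta> * \<alpha> + (1 - \<eta>) * \<nu>) * sqrt (real p) * gram \<eta> \<alpha> \<nu> (p - 1) q p' q'
    + sqrt \<eta> * sqrt (1 - \<eta>) * (\<nu> - \<alpha>) * sqrt (real q) * gram \<eta> \<alpha> \<nu> p (q - 1) p' q'"
proof -
  have "sqrt (real (Suc p')) * gram \<eta> \<alpha> \<nu> p q (Suc p') q' =
    (\<Sum>m\<le>Suc (p' + q'). \<alpha> ^ m * \<nu> ^ (Suc (p' + q') - m) * beam_amp \<eta> p q m (Suc (p' + q') - m)
      * (sqrt (real (Suc p')) * beam_amp \<eta> (Suc p') q' m (Suc (p' + q') - m)))"
    unfolding gram_def assms(3) sum_distrib_left by (intro sum.cong) (auto simp: algebra_simps)
  also have "\<dots> = (sqrt \<eta> * \<alpha> * sqrt \<eta> + sqrt (1 - \<eta>) * \<nu> * sqrt (1 - \<eta>)) * sqrt (real p) * gram \<eta> \<alpha> \<nu> (p - 1) q p' q'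
    + (sqrt (1 - \<eta>) * \<nu> * sqrt \<eta> - sqrt \<eta> * \<alpha> * sqrt (1 - \<eta>)) * sqrt (real q) * gram \<eta> \<alpha> \<nu> p (q - 1) p' q'"
    unfolding beam_amp_bob by (rule gram_raise_sum[OF assms(3)])
  also have "sqrt \<eta> * \<alpha> * sqrt \<eta> + sqrt (1 - \<eta>) * \<nu> * sqrt (1 - \<eta>) = \<eta> * \<alpha> + (1 - \<eta>) * \<nu>"
    using assms by (simp add: algebra_simps flip: real_sqrt_mult)
  finally show ?thesis by (simp add: algebra_simps)
qed

lemma gram_raise_q:
  assumes "0 \<le> \<eta>" "\<eta> \<le> 1" and "p + q = Suc (p' + q')"
  shows "sqrt (real (Suc q')) * gram \<eta> \<alpha> \<nu> p q p' (Suc q') =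
    sqrt \<eta> * sqrt (1 - \<eta>) * (\<nu> - \<alpha>) * sqrt (real p) * gram \<eta> \<alpha> \<nu> (p - 1) q p' q'
    + ((1 - \<eta>) * \<alpha> + \<eta> * \<nu>) * sqrt (real q) * gram \<eta> \<alpha> \<nu> p (q - 1) p' q'"
proof -
  have "sqrt (real (Suc q')) * gram \<eta> \<alpha> \<nu> p q p' (Suc q') =
    (\<Sum>m\<le>Suc (p' + q'). \<alpha> ^ m * \<nu> ^ (Suc (p' + q') - m) * beam_amp \<eta> p q m (Suc (p' + q') - m)
      * (sqrt (real (Suc q')) * beam_amp \<eta> p' (Suc q') m (Suc (p' + q') - m)))"
    unfolding gram_def assms(3) sum_distrib_left by (intro sum.cong) (auto simp: algebra_simps)
  also have "\<dots> = (- sqrt (1 - \<eta>) * \<alpha> * sqrt \<eta> + sqrt \<eta> * \<nu> * sqrt (1 - \<eta>)) * sqrt (real p) * gram \<eta> \<alpha> \<nu> (p - 1) q p' q'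
    + (sqrt \<eta> * \<nu> * sqrt \<eta> - - sqrt (1 - \<eta>) * \<alpha> * sqrt (1 - \<eta>)) * sqrt (real q) * gram \<eta> \<alpha> \<nu> p (q - 1) p' q'"
    unfolding beam_amp_eve by (rule gram_raise_sum[OF assms(3)])
  also have "sqrt \<eta> * \<nu> * sqrt \<eta> - - sqrt (1 - \<eta>) * \<alpha> * sqrt (1 - \<eta>) = (1 - \<eta>) * \<alpha> + \<eta> * \<nu>"
    using assms by (simp add: algebra_simps flip: real_sqrt_mult)
  finally show ?thesis by (simp add: algebra_simps)
qed

text \<open>Unrolled, \<open>a\<close> is the Cauchy product of \<open>k ^ i\<close> with
  \<open>b\<close>, and absolute summability lets the two series be multiplied.\<close>

lemma sums_geometric_recursion:
  fixes a b :: "nat \<Rightarrow> real"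
  assumes "a 0 = b 0" and "\<And>p. a (Suc p) = k * a p + b (Suc p)"
    and "\<bar>k\<bar> < 1" and "summable (\<lambda>p. \<bar>b p\<bar>)" and "b sums B"
  shows "a sums (B / (1 - k))"
proof -
  have "a = (\<lambda>p. \<Sum>i\<le>p. k ^ i * b (p - i))"
  proof
    show "a p = (\<Sum>i\<le>p. k ^ i * b (p - i))" for p
    proof (induction p)
    case (Suc p)
    show ?case
      unfolding assms(2) Suc sum.atMost_Suc_shift by (simp add: sum_distrib_left mult.assoc)
    qed (simp add: assms(1))
  qed
  moreover have "(\<lambda>p. \<Sum>i\<le>p. k ^ i * b (p - i)) sums ((\<Sum>i. k ^ i) * (\<Sum>i. b i))"
    using assms by (intro Cauchy_product_sums) (simp_all add: summable_geometric power_abs)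
  ultimately show ?thesis
    using assms(3,5) by (simp add: suminf_geometric sums_iff)
qed

text \<open>Formulated for any operator whose ladder relations have a symmetric coefficient matrix
  \<open>k\<close>, so that either output can be traced out. Induction on \<open>q\<close>: by
  \<open>R1\<close> the shifted sum of the second claim obeys a geometric recursion in
  \<open>p\<close> with the diagonal at \<open>q\<close> as source, and by \<open>R2\<close> the
  diagonal at \<open>Suc q\<close> combines the two. The ratio is 1 minus the Schur complement of
  \<open>1 - k\<close>.\<close>

lemma gaussian_partial_trace:
  fixes G :: "nat \<Rightarrow> nat \<Rightarrow> nat \<Rightarrow> nat \<Rightarrow> real"
  assumes R1: "\<And>p q p' q'. p + q = Suc (p' + q') \<Longrightarrow> sqrt (real (Suc p')) * G p q (Suc p') q' =
      k11 * sqrt (real p) * G (p - 1) q p' q' + k12 * sqrt (real q) * G p (q - 1) p' q'"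
    and R2: "\<And>p q p' q'. p + q = Suc (p' + q') \<Longrightarrow> sqrt (real (Suc q')) * G p q p' (Suc q') =
      k12 * sqrt (real p) * G (p - 1) q p' q' + k22 * sqrt (real q) * G p (q - 1) p' q'"
    and pos: "\<And>p q. 0 \<le> G p q p q" and k: "0 \<le> k11" "k11 < 1" and G0: "G 0 0 0 0 = 1"
  shows "(\<lambda>p. G p q p q) sums ((k22 + k12\<^sup>2 / (1 - k11)) ^ q / (1 - k11))"
    and "(\<lambda>p. sqrt (real (Suc p)) * G p (Suc q) (Suc p) q) sums
      (k12 * sqrt (real (Suc q)) * ((k22 + k12\<^sup>2 / (1 - k11)) ^ q / (1 - k11)) / (1 - k11))"
proof -
  define r where "r = k22 + k12\<^sup>2 / (1 - k11)"
  define H where "H q p = sqrt (real (Suc p)) * G p (Suc q) (Suc p) q" for q p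
  have H0: "H q 0 = k12 * sqrt (real (Suc q)) * G 0 q 0 q" for q
    using R1[of 0 "Suc q" 0 q] by (simp add: H_def)
  have HS: "H q (Suc p) = k11 * H q p + k12 * sqrt (real (Suc q)) * G (Suc p) q (Suc p) q" for q p
    using R1[of "Suc p" "Suc q" "Suc p" q] by (simp add: H_def mult.assoc)
  have H_sums: "H q sums (k12 * sqrt (real (Suc q)) * E / (1 - k11))"
    if "(\<lambda>p. G p q p q) sums E" for q E
  proof (rule sums_geometric_recursion)
    show "summable (\<lambda>p. \<bar>k12 * sqrt (real (Suc q)) * G p q p q\<bar>)"
      using that pos by (simp add: abs_mult sums_iff summable_mult)
    show "(\<lambda>p. k12 * sqrt (real (Suc q)) * G p q p q) sums (k12 * sqrt (real (Suc q)) * E)"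
      using that by (rule sums_mult)
  qed (use H0 HS k in auto)
  have "(\<lambda>p. G p q p q) sums (r ^ q / (1 - k11))" for q
  proof (induction q)
    case 0
    have "G p 0 p 0 = k11 ^ p" for p
    proof (induction p)
      case (Suc p)
      have "sqrt (real (Suc p)) * G (Suc p) 0 (Suc p) 0 = sqrt (real (Suc p)) * (k11 * G p 0 p 0)"
        using R1[of "Suc p" 0 p 0] by simp
      then show ?case using Suc by (simp del: of_nat_Suc)
    qed (use G0 in simp)
    then show ?case using k by (simp add: geometric_sums)
  next
    case (Suc q)
    let ?E = "r ^ q / (1 - k11)" and ?s = "sqrt (real (Suc q))"
    have "(\<lambda>p. if p = 0 then 0 else H q (p - 1)) sums (k12 * ?s * ?E / (1 - k11))"
      using H_sums[OF Suc] sums_Suc[of "\<lambda>p. if p = 0 then 0 else H q (p - 1)"] by simp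
    then have "(\<lambda>p. k12 * (if p = 0 then 0 else H q (p - 1)) + k22 * ?s * G p q p q) sums
        (k12 * (k12 * ?s * ?E / (1 - k11)) + k22 * ?s * ?E)"
      using Suc by (intro sums_add sums_mult) auto
    also have "(\<lambda>p. k12 * (if p = 0 then 0 else H q (p - 1)) + k22 * ?s * G p q p q)
        = (\<lambda>p. ?s * G p (Suc q) p (Suc q))"
    proof
      fix p show "k12 * (if p = 0 then 0 else H q (p - 1)) + k22 * ?s * G p q p q = ?s * G p (Suc q) p (Suc q)"
        using R2[of p "Suc q" p q] by (cases p) (simp_all add: H_def)
    qed
    also have "k12 * (k12 * ?s * ?E / (1 - k11)) + k22 * ?s * ?E = ?s * (r ^ Suc q / (1 - k11))"
    proof -
      have "k12 * (k12 * ?s * ?E / (1 - k11)) + k22 * ?s * ?E = ?s * (?E * (k22 + k12\<^sup>2 / (1 - k11)))"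
        by (simp add: power2_eq_square distrib_left mult_ac)
      then show ?thesis by (simp add: r_def[symmetric] mult_ac)
    qed
    finally show ?case
      by (subst (asm) sums_mult_iff) (simp_all del: of_nat_Suc)
  qed
  from this[of q] H_sums[OF this[of q]] show "(\<lambda>p. G p q p q) sums ((k22 + k12\<^sup>2 / (1 - k11)) ^ q / (1 - k11))"
    and "(\<lambda>p. sqrt (real (Suc p)) * G p (Suc q) (Suc p) q) sums
      (k12 * sqrt (real (Suc q)) * ((k22 + k12\<^sup>2 / (1 - k11)) ^ q / (1 - k11)) / (1 - k11))"
    by (simp_all add: r_def H_def[abs_def])
qed

section \<open>Thermal statistics and the reduced outputs of one beam splitter\<close>

definition therm :: "real \<Rightarrow> nat \<Rightarrow> real" where
  "therm N n = N ^ n / (N + 1) ^ (n + 1)"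

lemma thermal_therm: "thermal N m n = (if m = n then of_real (therm N n) else 0)"
  by (simp add: thermal_def therm_def)

lemma therm_nonneg: "0 \<le> N \<Longrightarrow> 0 \<le> therm N n"
  by (simp add: therm_def)

lemma therm_pos: "0 < N \<Longrightarrow> 0 < therm N n"
  by (simp add: therm_def)

lemma therm_eq: "0 \<le> N \<Longrightarrow> therm N n = (N / (N + 1)) ^ n / (N + 1)"
  by (simp add: therm_def power_divide)

lemma therm_sums:
  assumes "0 \<le> N"
  shows "therm N sums 1"
proof -
  have "(\<lambda>n. (N / (N + 1)) ^ n / (N + 1)) sums (1 / (1 - N / (N + 1)) / (N + 1))"
    using assms by (intro sums_divide geometric_sums) simp
  moreover have "1 / (1 - N / (N + 1)) / (N + 1) = 1"
    using assms by (simp add: divide_simps)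
  moreover have "therm N = (\<lambda>n. (N / (N + 1)) ^ n / (N + 1))"
    using assms by (simp add: fun_eq_iff therm_eq)
  ultimately show ?thesis by simp
qed

lemma therm_0: "therm 0 n = (if n = 0 then 1 else 0)"
  by (simp add: therm_def)

text \<open>Makes Eve's idle state an instance of the thermal-input computation.\<close>

lemma vacuum_thermal: "vacuum = thermal 0"
  by (auto simp: fun_eq_iff vacuum_def thermal_therm therm_0)

context
  fixes \<eta> N\<^sub>B N\<^sub>S :: real
  assumes \<eta>: "0 < \<eta>" "\<eta> < 1" and N: "0 < N\<^sub>B" "0 \<le> N\<^sub>S"
begin

text \<open>\<open>M\<close> and \<open>L\<close> are the mean photon numbers of Eve's and Bob's
  outputs. The identities with \<open>k12\<close> turn the ratio of the partial trace into
  \<open>M / (M + 1)\<close> or \<open>L / (L + 1)\<close>, so that the outputs are again thermal;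
  both are polynomial identities over a common denominator.\<close>

lemma gaussian_consts:
  assumes \<alpha>_def: "\<alpha> = N\<^sub>S / (N\<^sub>S + 1)" and \<nu>_def: "\<nu> = N\<^sub>B / (N\<^sub>B + 1)"
    and M_def: "M = \<eta> * N\<^sub>B + (1 - \<eta>) * N\<^sub>S" and L_def: "L = (1 - \<eta>) * N\<^sub>B + \<eta> * N\<^sub>S"
    and k12_def: "k12 = sqrt \<eta> * sqrt (1 - \<eta>) * (\<nu> - \<alpha>)"
  shows "0 \<le> \<eta> * \<alpha> + (1 - \<eta>) * \<nu>" "0 \<le> (1 - \<eta>) * \<alpha> + \<eta> * \<nu>"
    "1 - (\<eta> * \<alpha> + (1 - \<eta>) * \<nu>) = (M + 1) / ((N\<^sub>S + 1) * (N\<^sub>B + 1))"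
    "1 - ((1 - \<eta>) * \<alpha> + \<eta> * \<nu>) = (L + 1) / ((N\<^sub>S + 1) * (N\<^sub>B + 1))"
    "(1 - \<eta>) * \<alpha> + \<eta> * \<nu> + k12\<^sup>2 / ((M + 1) / ((N\<^sub>S + 1) * (N\<^sub>B + 1))) = M / (M + 1)"
    "\<eta> * \<alpha> + (1 - \<eta>) * \<nu> + k12\<^sup>2 / ((L + 1) / ((N\<^sub>S + 1) * (N\<^sub>B + 1))) = L / (L + 1)"
    "0 < M" "0 < L"
proof -
  show MLpos: "0 < M" "0 < L"
    using \<eta> N by (auto simp: M_def L_def intro!: add_pos_nonneg mult_pos_pos mult_nonneg_nonneg)
  show "0 \<le> \<eta> * \<alpha> + (1 - \<eta>) * \<nu>" "0 \<le> (1 - \<eta>) * \<alpha> + \<eta> * \<nu>"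
    using \<eta> N by (auto simp: \<alpha>_def \<nu>_def intro!: add_nonneg_nonneg)
  show 1: "1 - (\<eta> * \<alpha> + (1 - \<eta>) * \<nu>) = (M + 1) / ((N\<^sub>S + 1) * (N\<^sub>B + 1))"
    "1 - ((1 - \<eta>) * \<alpha> + \<eta> * \<nu>) = (L + 1) / ((N\<^sub>S + 1) * (N\<^sub>B + 1))"
    using N by (simp_all add: \<alpha>_def \<nu>_def M_def L_def divide_simps) (simp_all add: algebra_simps)
  have k: "k12\<^sup>2 = \<eta> * (1 - \<eta>) * (\<nu> - \<alpha>)\<^sup>2"
    using \<eta> by (simp add: k12_def power_mult_distrib)
  have "\<nu> - \<alpha> = (N\<^sub>B - N\<^sub>S) / ((N\<^sub>S + 1) * (N\<^sub>B + 1))"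
    using N by (simp add: \<alpha>_def \<nu>_def divide_simps) (simp add: algebra_simps)
  then have kk: "k12\<^sup>2 = \<eta> * (1 - \<eta>) * (N\<^sub>B - N\<^sub>S)\<^sup>2 / ((N\<^sub>S + 1) * (N\<^sub>B + 1))\<^sup>2"
    by (simp add: k power_divide)
  have e: "k12\<^sup>2 / (X / ((N\<^sub>S + 1) * (N\<^sub>B + 1))) = \<eta> * (1 - \<eta>) * (N\<^sub>B - N\<^sub>S)\<^sup>2 / ((N\<^sub>S + 1) * (N\<^sub>B + 1) * X)" for X
    unfolding kk using N by (simp add: power2_eq_square divide_simps)
  have f1: "(1 - \<eta>) * \<alpha> + \<eta> * \<nu> = (M + N\<^sub>S * N\<^sub>B) / ((N\<^sub>S + 1) * (N\<^sub>B + 1))"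
    and f2: "\<eta> * \<alpha> + (1 - \<eta>) * \<nu> = (L + N\<^sub>S * N\<^sub>B) / ((N\<^sub>S + 1) * (N\<^sub>B + 1))"
    using N by (simp_all add: \<alpha>_def \<nu>_def M_def L_def divide_simps) (simp_all add: algebra_simps)
  have g: "(M + N\<^sub>S * N\<^sub>B) * (M + 1) + \<eta> * (1 - \<eta>) * (N\<^sub>B - N\<^sub>S)\<^sup>2 = M * ((N\<^sub>S + 1) * (N\<^sub>B + 1))"
    "(L + N\<^sub>S * N\<^sub>B) * (L + 1) + \<eta> * (1 - \<eta>) * (N\<^sub>B - N\<^sub>S)\<^sup>2 = L * ((N\<^sub>S + 1) * (N\<^sub>B + 1))"
    unfolding M_def L_def power2_eq_square by algebra+
  have h: "(x + y) / D + z / (D * w) = x / w" if "(x + y) * w + z = x * D" "D > 0" "w > 0" for x y z w D :: real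
  proof -
    have "(x + y) / D + z / (D * w) = ((x + y) * w + z) / (D * w)"
      using that(2,3) by (simp add: add_divide_distrib[of "(x + y) * w"])
    also have "\<dots> = x / w" unfolding that(1) using that(2,3) by simp
    finally show ?thesis .
  qed
  show "(1 - \<eta>) * \<alpha> + \<eta> * \<nu> + k12\<^sup>2 / ((M + 1) / ((N\<^sub>S + 1) * (N\<^sub>B + 1))) = M / (M + 1)"
    unfolding e f1 using N MLpos by (intro h g mult_pos_pos) auto
  show "\<eta> * \<alpha> + (1 - \<eta>) * \<nu> + k12\<^sup>2 / ((L + 1) / ((N\<^sub>S + 1) * (N\<^sub>B + 1))) = L / (L + 1)"
    unfolding e f2 using N MLpos by (intro h g mult_pos_pos) auto
qed

text \<open>The normalised \<open>gram\<close> is the joint output for two thermal inputs, and the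
  sum over \<open>p\<close> traces out Bob.\<close>

lemma eve_thermal_sums:
  "(\<lambda>p. \<Sum>m\<le>p + q. therm N\<^sub>S m * therm N\<^sub>B (p + q - m) * (beam_amp \<eta> p q m (p + q - m))\<^sup>2) sums
     therm (\<eta> * N\<^sub>B + (1 - \<eta>) * N\<^sub>S) q"
proof -
  define \<alpha> \<nu> M where "\<alpha> = N\<^sub>S / (N\<^sub>S + 1)" and "\<nu> = N\<^sub>B / (N\<^sub>B + 1)" and "M = \<eta> * N\<^sub>B + (1 - \<eta>) * N\<^sub>S"
  note c = gaussian_consts[OF \<alpha>_def \<nu>_def M_def refl refl]
  have nn: "0 \<le> \<alpha>" "0 \<le> \<nu>" using N by (auto simp: \<alpha>_def \<nu>_def)
  have lt: "\<eta> * \<alpha> + (1 - \<eta>) * \<nu> < 1"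
    using c(3,7) N by (smt (verit) divide_pos_pos mult_pos_pos)
  have "(\<lambda>p. gram \<eta> \<alpha> \<nu> p q p q) sums ((M / (M + 1)) ^ q / ((M + 1) / ((N\<^sub>S + 1) * (N\<^sub>B + 1))))"
    using gaussian_partial_trace(1)[of "gram \<eta> \<alpha> \<nu>", OF gram_raise_p gram_raise_q gram_nonneg c(1) lt gram_0, of q]
    unfolding c(3) c(5) using \<eta> nn by simp
  then have "(\<lambda>p. gram \<eta> \<alpha> \<nu> p q p q / ((N\<^sub>S + 1) * (N\<^sub>B + 1))) sums
      ((M / (M + 1)) ^ q / ((M + 1) / ((N\<^sub>S + 1) * (N\<^sub>B + 1))) / ((N\<^sub>S + 1) * (N\<^sub>B + 1)))"
    by (rule sums_divide)
  also have "(M / (M + 1)) ^ q / ((M + 1) / ((N\<^sub>S + 1) * (N\<^sub>B + 1))) / ((N\<^sub>S + 1) * (N\<^sub>B + 1)) = therm M q"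
    using N c(7) by (simp add: therm_eq)
  also have "(\<lambda>p. gram \<eta> \<alpha> \<nu> p q p q / ((N\<^sub>S + 1) * (N\<^sub>B + 1))) =
      (\<lambda>p. \<Sum>m\<le>p + q. therm N\<^sub>S m * therm N\<^sub>B (p + q - m) * (beam_amp \<eta> p q m (p + q - m))\<^sup>2)"
    unfolding gram_def sum_divide_distrib using N
    by (intro ext sum.cong refl) (simp add: therm_eq \<alpha>_def \<nu>_def power2_eq_square)
  finally show ?thesis unfolding M_def .
qed

end

context
  fixes \<eta> N\<^sub>B N\<^sub>T :: real
  assumes \<eta>: "0 < \<eta>" "\<eta> < 1" and N: "0 < N\<^sub>B" and NT: "N\<^sub>T = (1 - \<eta>) * N\<^sub>B"
begin

text \<open>The signal input is the vacuum. The second sum, in which one photon is exchanged between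
  the receivers, is what the one-photon coherence is later reduced to.\<close>

lemma bob_vacuum_aux:
  "(\<lambda>q. therm N\<^sub>B (p + q) * (beam_amp \<eta> p q 0 (p + q))\<^sup>2) sums therm N\<^sub>T p"
  "(\<lambda>q. sqrt (real (Suc q)) * (therm N\<^sub>B (Suc (p + q)) * beam_amp \<eta> (Suc p) q 0 (Suc (p + q)) * beam_amp \<eta> p (Suc q) 0 (Suc (p + q))))
     sums (sqrt \<eta> * sqrt (1 - \<eta>) * N\<^sub>B * sqrt (real (Suc p)) * therm N\<^sub>T p / (N\<^sub>T + 1))"
proof -
  define \<nu> where "\<nu> = N\<^sub>B / (N\<^sub>B + 1)"
  \<comment> \<open>Swapping the modes makes \<open>gaussian_partial_trace\<close> sum over Eve's
    photon number.\<close>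
  define G where "G p q p' q' = gram \<eta> 0 \<nu> q p q' p'" for p q p' q'
  have N\<^sub>T: "N\<^sub>T = (1 - \<eta>) * N\<^sub>B + \<eta> * 0" using NT by simp
  note c = gaussian_consts[OF \<eta> N order_refl refl \<nu>_def refl N\<^sub>T refl, simplified]
  have NTpos: "0 < N\<^sub>T" using NT \<eta> N by simp
  have nn: "0 \<le> \<nu>" using N by (auto simp: \<nu>_def)
  have lt: "\<eta> * \<nu> < 1"
    using c(4) NTpos N by (smt (verit) divide_pos_pos mult_pos_pos)
  have R1: "p + q = Suc (p' + q') \<Longrightarrow> sqrt (real (Suc p')) * G p q (Suc p') q' =
      \<eta> * \<nu> * sqrt (real p) * G (p - 1) q p' q' + sqrt \<eta> * sqrt (1 - \<eta>) * \<nu> * sqrt (real q) * G p (q - 1) p' q'" for p q p' q'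
    using gram_raise_q[of \<eta> q p q' p' 0 \<nu>] \<eta> by (simp add: G_def algebra_simps)
  have R2: "p + q = Suc (p' + q') \<Longrightarrow> sqrt (real (Suc q')) * G p q p' (Suc q') =
      sqrt \<eta> * sqrt (1 - \<eta>) * \<nu> * sqrt (real p) * G (p - 1) q p' q' + (1 - \<eta>) * \<nu> * sqrt (real q) * G p (q - 1) p' q'" for p q p' q'
    using gram_raise_p[of \<eta> q p q' p' 0 \<nu>] \<eta> by (simp add: G_def algebra_simps)
  have pos: "0 \<le> G p q p q" for p q using nn by (simp add: G_def gram_nonneg)
  have r: "1 - \<eta> * \<nu> = (N\<^sub>T + 1) / (N\<^sub>B + 1)"
    "(1 - \<eta>) * \<nu> + (sqrt \<eta> * sqrt (1 - \<eta>) * \<nu>)\<^sup>2 / ((N\<^sub>T + 1) / (N\<^sub>B + 1)) = N\<^sub>T / (N\<^sub>T + 1)"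
    using c(4,6) by auto
  have G: "G q p q' p' / (N\<^sub>B + 1) = therm N\<^sub>B (p + q) * beam_amp \<eta> p q 0 (p + q) * beam_amp \<eta> p' q' 0 (p + q)" for p q p' q'
  proof -
    \<comment> \<open>With \<alpha> = 0 only \<open>m = 0\<close> survives, by
      \<open>0 ^ 0 = 1\<close>.\<close>
    have "G q p q' p' = (\<Sum>m\<in>{0}. \<nu> ^ (p + q - m) * beam_amp \<eta> p q m (p + q - m) * beam_amp \<eta> p' q' m (p + q - m))"
      unfolding G_def gram_def by (rule sum.mono_neutral_cong_right) auto
    then show ?thesis using N by (simp add: therm_eq \<nu>_def)
  qed
  note tr = gaussian_partial_trace[of G, OF R1 R2 pos _ lt, unfolded r]
  have "(\<lambda>q. G q p q p) sums ((N\<^sub>T / (N\<^sub>T + 1)) ^ p / ((N\<^sub>T + 1) / (N\<^sub>B + 1)))"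
    using tr(1)[of p] \<eta> nn by (simp add: G_def gram_0)
  from sums_divide[OF this, of "N\<^sub>B + 1"]
  show "(\<lambda>q. therm N\<^sub>B (p + q) * (beam_amp \<eta> p q 0 (p + q))\<^sup>2) sums therm N\<^sub>T p"
    unfolding G using N NTpos by (simp add: therm_eq power2_eq_square mult.assoc)
  have "(\<lambda>q. sqrt (real (Suc q)) * G q (Suc p) (Suc q) p) sums (sqrt \<eta> * sqrt (1 - \<eta>) * \<nu> * sqrt (real (Suc p)) *
      ((N\<^sub>T / (N\<^sub>T + 1)) ^ p / ((N\<^sub>T + 1) / (N\<^sub>B + 1))) / ((N\<^sub>T + 1) / (N\<^sub>B + 1)))"
    using tr(2)[of p] \<eta> nn by (simp add: G_def gram_0)
  from sums_divide[OF this, of "N\<^sub>B + 1"]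
  have "(\<lambda>q. sqrt (real (Suc q)) * (G q (Suc p) (Suc q) p / (N\<^sub>B + 1))) sums (sqrt \<eta> * sqrt (1 - \<eta>) * \<nu> * sqrt (real (Suc p)) *
      ((N\<^sub>T / (N\<^sub>T + 1)) ^ p / ((N\<^sub>T + 1) / (N\<^sub>B + 1))) / ((N\<^sub>T + 1) / (N\<^sub>B + 1)) / (N\<^sub>B + 1))"
    by simp
  also have "(sqrt \<eta> * sqrt (1 - \<eta>) * \<nu> * sqrt (real (Suc p)) *
      ((N\<^sub>T / (N\<^sub>T + 1)) ^ p / ((N\<^sub>T + 1) / (N\<^sub>B + 1))) / ((N\<^sub>T + 1) / (N\<^sub>B + 1)) / (N\<^sub>B + 1)) =
      sqrt \<eta> * sqrt (1 - \<eta>) * N\<^sub>B * sqrt (real (Suc p)) * therm N\<^sub>T p / (N\<^sub>T + 1)"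
    using N NTpos by (simp add: therm_eq \<nu>_def)
  finally show "(\<lambda>q. sqrt (real (Suc q)) * (therm N\<^sub>B (Suc (p + q)) * beam_amp \<eta> (Suc p) q 0 (Suc (p + q)) * beam_amp \<eta> p (Suc q) 0 (Suc (p + q))))
     sums (sqrt \<eta> * sqrt (1 - \<eta>) * N\<^sub>B * sqrt (real (Suc p)) * therm N\<^sub>T p / (N\<^sub>T + 1))"
    unfolding G by simp
qed

lemmas bob_vacuum_sums = bob_vacuum_aux(1)

text \<open>The signal photon is created from the vacuum by \<open>beam_amp_raise_m\<close>, which
  expresses the sum through the two vacuum sums. The factor \<open>1 / (N\<^sub>T + 1)\<close>
  arises as \<open>1 - (1 - \<eta>) * N\<^sub>B / (N\<^sub>T + 1)\<close>.\<close>

lemma bob_coherence_sums: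
  "(\<lambda>q. therm N\<^sub>B (p + q) * beam_amp \<eta> (Suc p) q 1 (p + q) * beam_amp \<eta> p q 0 (p + q)) sums
     (sqrt \<eta> * sqrt (real (Suc p)) * therm N\<^sub>T p / (N\<^sub>T + 1))"
proof -
  have NTpos: "0 < N\<^sub>T" using NT \<eta> N by simp
  let ?f = "\<lambda>q. therm N\<^sub>B (p + q) * beam_amp \<eta> (Suc p) (q - 1) 0 (p + q) * beam_amp \<eta> p q 0 (p + q)"
  have "(\<lambda>q. sqrt (real q) * ?f q) sums (sqrt \<eta> * sqrt (1 - \<eta>) * N\<^sub>B * sqrt (real (Suc p)) * therm N\<^sub>T p / (N\<^sub>T + 1))"
    using bob_vacuum_aux(2)[of p] sums_Suc[of "\<lambda>q. sqrt (real q) * ?f q"] by simp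
  from sums_diff[OF sums_mult[OF bob_vacuum_aux(1)[of p], of "sqrt \<eta> * sqrt (real (Suc p))"]
      sums_mult[OF this, of "sqrt (1 - \<eta>)"]]
  have "(\<lambda>q. sqrt \<eta> * sqrt (real (Suc p)) * (therm N\<^sub>B (p + q) * (beam_amp \<eta> p q 0 (p + q))\<^sup>2)
      - sqrt (1 - \<eta>) * (sqrt (real q) * ?f q)) sums
    (sqrt \<eta> * sqrt (real (Suc p)) * therm N\<^sub>T p
      - sqrt (1 - \<eta>) * (sqrt \<eta> * sqrt (1 - \<eta>) * N\<^sub>B * sqrt (real (Suc p)) * therm N\<^sub>T p / (N\<^sub>T + 1)))"
    by simp
  also have "(\<lambda>q. sqrt \<eta> * sqrt (real (Suc p)) * (therm N\<^sub>B (p + q) * (beam_amp \<eta> p q 0 (p + q))\<^sup>2)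
      - sqrt (1 - \<eta>) * (sqrt (real q) * ?f q)) =
    (\<lambda>q. therm N\<^sub>B (p + q) * beam_amp \<eta> (Suc p) q 1 (p + q) * beam_amp \<eta> p q 0 (p + q))"
  proof
    fix q
    have "beam_amp \<eta> (Suc p) q 1 (p + q) = sqrt \<eta> * sqrt (real (Suc p)) * beam_amp \<eta> p q 0 (p + q)
        - sqrt (1 - \<eta>) * sqrt (real q) * beam_amp \<eta> (Suc p) (q - 1) 0 (p + q)"
      using beam_amp_raise_m[of 0 \<eta> "Suc p" q "p + q"] by simp
    then show "sqrt \<eta> * sqrt (real (Suc p)) * (therm N\<^sub>B (p + q) * (beam_amp \<eta> p q 0 (p + q))\<^sup>2)
      - sqrt (1 - \<eta>) * (sqrt (real q) * ?f q) =
      therm N\<^sub>B (p + q) * beam_amp \<eta> (Suc p) q 1 (p + q) * beam_amp \<eta> p q 0 (p + q)"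
      by (simp only:) (simp add: power2_eq_square algebra_simps)
  qed
  also have "sqrt \<eta> * sqrt (real (Suc p)) * therm N\<^sub>T p
      - sqrt (1 - \<eta>) * (sqrt \<eta> * sqrt (1 - \<eta>) * N\<^sub>B * sqrt (real (Suc p)) * therm N\<^sub>T p / (N\<^sub>T + 1))
      = sqrt \<eta> * sqrt (real (Suc p)) * therm N\<^sub>T p * (1 - (sqrt (1 - \<eta>))\<^sup>2 * N\<^sub>B / (N\<^sub>T + 1))"
    by (simp add: power2_eq_square right_diff_distrib)
  also have "1 - (sqrt (1 - \<eta>))\<^sup>2 * N\<^sub>B / (N\<^sub>T + 1) = 1 / (N\<^sub>T + 1)"
    using \<eta> NTpos by (simp add: NT[symmetric] diff_divide_eq_iff)
  finally show ?thesis by simp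
qed

end

section \<open>Product operators under phases and channel, mode by mode\<close>

section \<open>Product states\<close>

lemma infsum_eq_sum:
  assumes "finite F" "F \<subseteq> A" and "\<And>x. x \<in> A \<Longrightarrow> x \<notin> F \<Longrightarrow> f x = 0"
  shows "infsum f A = sum f F"
  by (rule infsumI, rule has_sum_finite_neutralI) (use assms in auto)

lemma abs_summable_finite_support:
  assumes "finite F" and "\<And>x. x \<in> A \<Longrightarrow> x \<notin> F \<Longrightarrow> f x = 0"
  shows "f abs_summable_on A"
proof (rule finite_nonzero_values_imp_summable_on)
  show "finite {x \<in> A. norm (f x) \<noteq> 0}"
    using assms by (intro finite_subset[OF _ assms(1)]) auto
qed

text \<open>Generalises \<open>tensor_power2\<close> to a different factor in each mode, as the
  phases vary from mode to mode.\<close>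

definition tensor_modes2 :: "nat \<Rightarrow> (nat \<Rightarrow> (nat \<times> nat) op) \<Rightarrow> (nat list \<times> nat list) op" where
  "tensor_modes2 n A = (\<lambda>(x, y) (x', y'). \<Prod>j<n. A j (x ! j, y ! j) (x' ! j, y' ! j))"

lemma op_mult_tensor_modes:
  assumes "\<And>j. j < n \<Longrightarrow> (\<lambda>c. A j (x ! j) c * B j c (y ! j)) abs_summable_on UNIV"
  shows "op_mult (fock n) (tensor_modes n A) (tensor_modes n B) x y =
    tensor_modes n (\<lambda>j. op_mult UNIV (A j) (B j)) x y"
  using infsum_prod_fock[OF assms] by (simp add: op_mult_def tensor_modes_def prod.distrib)

lemma op_mult_tensor_modes2:
  assumes "\<And>j. j < n \<Longrightarrow> (\<lambda>c. A j (x ! j, y ! j) c * B j c (x' ! j, y' ! j)) abs_summable_on UNIV"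
  shows "op_mult (fock n \<times> fock n) (tensor_modes2 n A) (tensor_modes2 n B) (x, y) (x', y') =
    tensor_modes2 n (\<lambda>j. op_mult UNIV (A j) (B j)) (x, y) (x', y')"
proof -
  have "(\<lambda>(a, b). A j (x ! j, y ! j) (a, b) * B j (a, b) (x' ! j, y' ! j)) abs_summable_on UNIV" if "j < n" for j
    using assms[OF that] by (simp add: case_prod_unfold)
  from infsum_prod_fock2[OF this]
  show ?thesis by (simp add: op_mult_def tensor_modes2_def prod.distrib case_prod_unfold)
qed

text \<open>With row-finite \<open>U\<close> every entry of the conjugation is a finite sum, so it
  factorises over the modes for arbitrary \<open>A\<close>.\<close>

lemma op_conj_tensor_modes:
  assumes "\<And>j a. finite {b. U j a b \<noteq> 0}"
  shows "op_conj (fock n) (tensor_modes n U) (tensor_modes n A) =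
    tensor_modes n (\<lambda>j. op_conj UNIV (U j) (A j))"
proof (intro ext)
  fix x y
  have "op_mult (fock n) (tensor_modes n U) (tensor_modes n A) = tensor_modes n (\<lambda>j. op_mult UNIV (U j) (A j))"
    by (intro ext op_mult_tensor_modes abs_summable_finite_support[OF assms]) auto
  moreover have "op_adj (tensor_modes n U) = tensor_modes n (\<lambda>j. op_adj (U j))"
    by (auto simp: fun_eq_iff op_adj_def tensor_modes_def)
  ultimately show "op_conj (fock n) (tensor_modes n U) (tensor_modes n A) x y =
      tensor_modes n (\<lambda>j. op_conj UNIV (U j) (A j)) x y"
    unfolding op_conj_def
    by (simp, intro op_mult_tensor_modes abs_summable_finite_support[OF assms]) (auto simp: op_adj_def)
qed

lemma op_conj_tensor_modes2:
  assumes "\<And>j a. finite {b. U j a b \<noteq> 0}"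
  shows "op_conj (fock n \<times> fock n) (tensor_modes2 n U) (tensor_modes2 n A) =
    tensor_modes2 n (\<lambda>j. op_conj UNIV (U j) (A j))"
proof -
  have "op_mult (fock n \<times> fock n) (tensor_modes2 n U) (tensor_modes2 n A) z z' = tensor_modes2 n (\<lambda>j. op_mult UNIV (U j) (A j)) z z'" for z z'
    by (cases z; cases z'; simp only:)
      (intro op_mult_tensor_modes2 abs_summable_finite_support[OF assms], auto)
  then have 1: "op_mult (fock n \<times> fock n) (tensor_modes2 n U) (tensor_modes2 n A) = tensor_modes2 n (\<lambda>j. op_mult UNIV (U j) (A j))"
    by blast
  have 2: "op_adj (tensor_modes2 n U) = tensor_modes2 n (\<lambda>j. op_adj (U j))"
    by (auto simp: fun_eq_iff op_adj_def tensor_modes2_def)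
  have "op_mult (fock n \<times> fock n) (tensor_modes2 n (\<lambda>j. op_mult UNIV (U j) (A j))) (tensor_modes2 n (\<lambda>j. op_adj (U j))) z z' =
      tensor_modes2 n (\<lambda>j. op_mult UNIV (op_mult UNIV (U j) (A j)) (op_adj (U j))) z z'" for z z'
    by (cases z; cases z'; simp only:)
      (intro op_mult_tensor_modes2 abs_summable_finite_support[OF assms], auto simp: op_adj_def)
  then show ?thesis unfolding op_conj_def 1 2 by blast
qed

lemma op_conj_phase_shift:
  "op_conj UNIV (phase_shift t) A a b = exp (\<i> * of_real (t * (real a - real b))) * A a b"
proof -
  have 1: "op_mult UNIV (phase_shift t) A a c = exp (\<i> * of_real (t * real a)) * A a c" for c
    unfolding op_mult_def by (subst infsum_eq_sum[where F = "{a}"]) (auto simp: phase_shift_def)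
  have "op_conj UNIV (phase_shift t) A a b = exp (\<i> * of_real (t * real a)) * A a b * cnj (exp (\<i> * of_real (t * real b)))"
  proof -
    have 2: "op_adj (phase_shift t) c b = (if c = b then cnj (exp (\<i> * of_real (t * real b))) else 0)" for c
      by (simp add: op_adj_def phase_shift_def)
    show ?thesis
      unfolding op_conj_def op_mult_def[of _ "op_mult UNIV (phase_shift t) A"] 1 2
      by (subst infsum_eq_sum[where F = "{b}"]) auto
  qed
  also have "cnj (exp (\<i> * of_real (t * real b))) = exp (- (\<i> * of_real (t * real b)))"
    by (simp add: exp_cnj)
  finally show ?thesis
    by (simp add: exp_diff exp_minus right_diff_distrib divide_inverse)
qed

definition tmsv_coeff :: "real \<Rightarrow> nat \<Rightarrow> real" where
  "tmsv_coeff N i = sqrt (therm N i)"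

lemma tmsv_eq: "tmsv N (s, i) (s', i') =
    (if s = i \<and> s' = i' then of_real (tmsv_coeff N i * tmsv_coeff N i') else 0)"
  by (auto simp: tmsv_def tmsv_ket_def tmsv_coeff_def therm_def)

text \<open>Stated for one block of idler indices, because \<open>map_tensor_id\<close> passes the
  channel one such block at a time and each block is a product over modes.\<close>

lemma encoded_state_eq:
  "(\<lambda>u u'. encoded_state n C w k (u, y) (u', y')) =
    tensor_modes n (\<lambda>j u u'. exp (\<i> * of_real (phases C w k j * (real u - real u')))
      * tmsv (photons C) (u, y ! j) (u', y' ! j))"
proof -
  have "finite {b. phase_shift t a b \<noteq> 0}" for t a
    by (rule finite_subset[of _ "{a}"]) (auto simp: phase_shift_def)
  moreover have "(\<lambda>u u'. tensor_power2 n (tmsv (photons C)) (u, y) (u', y')) =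
      tensor_modes n (\<lambda>j u u'. tmsv (photons C) (u, y ! j) (u', y' ! j))"
    by (simp add: tensor_power2_def tensor_modes_def fun_eq_iff)
  ultimately show ?thesis
    by (simp add: encoded_state_def map_tensor_id_def encode_def op_conj_tensor_modes op_conj_phase_shift[abs_def])
qed

text \<open>Tracing out the idler leaves only equal signal indices, where the phase factor is
  1.\<close>

lemma alice_state_eq: 
  assumes "0 < photons C"
  shows "alice_state n C w k = tensor_modes n (\<lambda>_. thermal (photons C))"
proof (intro ext)
  fix x x'
  let ?f = "\<lambda>j b. exp (\<i> * of_real (phases C w k j * (real (x ! j) - real (x' ! j)))) * tmsv (photons C) (x ! j, b) (x' ! j, b)"
  have "encoded_state n C w k (x, y) (x', y) = (\<Prod>j<n. ?f j (y ! j))" for y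
    using fun_cong[OF fun_cong[OF encoded_state_eq[of n C w k y y], of x], of x'] by (simp add: tensor_modes_def)
  then have "alice_state n C w k x x' = (\<Sum>\<^sub>\<infinity>y\<in>fock n. \<Prod>j<n. ?f j (y ! j))"
    by (simp add: alice_state_def ptrace_snd_def)
  also have "\<dots> = (\<Prod>j<n. \<Sum>\<^sub>\<infinity>b. ?f j b)"
    by (intro infsum_prod_fock abs_summable_finite_support[of "{x ! j}" for j]) (auto simp: tmsv_eq)
  also have "\<dots> = (\<Prod>j<n. thermal (photons C) (x ! j) (x' ! j))"
  proof (intro prod.cong refl)
    fix j
    have "(\<Sum>\<^sub>\<infinity>b. ?f j b) = (\<Sum>b\<in>{x ! j}. ?f j b)"
      by (rule infsum_eq_sum) (auto simp: tmsv_eq)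
    then show "(\<Sum>\<^sub>\<infinity>b. ?f j b) = thermal (photons C) (x ! j) (x' ! j)"
      using therm_nonneg[of "photons C" "x ! j"] assms
      by (auto simp: tmsv_eq thermal_therm tmsv_coeff_def simp flip: of_real_mult)
  qed
  finally show "alice_state n C w k x x' = tensor_modes n (\<lambda>_. thermal (photons C)) x x'"
    by (simp add: tensor_modes_def)
qed

section \<open>One channel use, and Bob's state of one mode with its idler\<close>

definition channel1 :: "real \<Rightarrow> real \<Rightarrow> nat op \<Rightarrow> (nat \<times> nat) op" where
  "channel1 \<eta> N R = op_conj UNIV (beam_splitter \<eta>) (op_tensor R (thermal N))"

text \<open>Conservation of the total photon number leaves finitely many inputs for each
  output.\<close>

lemma finite_beam_splitter_row: "finite {b. beam_splitter \<eta> a b \<noteq> 0}"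
proof (rule finite_subset)
  show "{b. beam_splitter \<eta> a b \<noteq> 0} \<subseteq> {..fst a + snd a} \<times> {..fst a + snd a}"
  proof
    fix b assume "b \<in> {b. beam_splitter \<eta> a b \<noteq> 0}"
    then have "beam_amp \<eta> (fst a) (snd a) (fst b) (snd b) \<noteq> 0"
      by (simp add: beam_splitter_def case_prod_beta)
    then have "fst a + snd a = fst b + snd b"
      using beam_amp_eq_0 by blast
    then show "b \<in> {..fst a + snd a} \<times> {..fst a + snd a}" by (auto simp: mem_Times_iff)
  qed
qed simp

lemma channel_joint_tensor:
  "channel_joint \<eta> N n (tensor_modes n R) = tensor_modes2 n (\<lambda>j. channel1 \<eta> N (R j))"
proof -
  have "op_tensor (tensor_modes n R) (tensor_power n (thermal N)) = tensor_modes2 n (\<lambda>j. op_tensor (R j) (thermal N))"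
    by (auto simp: fun_eq_iff op_tensor_def tensor_modes_def tensor_power_def tensor_modes2_def prod.distrib)
  moreover have "tensor_power2 n A = tensor_modes2 n (\<lambda>_. A)" for A
    by (auto simp: fun_eq_iff tensor_power2_def tensor_modes2_def)
  ultimately show ?thesis
    by (simp add: channel_joint_def op_conj_tensor_modes2 finite_beam_splitter_row channel1_def)
qed

lemma channel1_eq:
  "channel1 \<eta> N R (p, q) (p', q') = (\<Sum>m'\<le>p' + q'. (\<Sum>m\<le>p + q.
      of_real (beam_amp \<eta> p q m (p + q - m)) * (R m m' * thermal N (p + q - m) (p' + q' - m')))
      * of_real (beam_amp \<eta> p' q' m' (p' + q' - m')))"
proof -
  have sum: "infsum f UNIV = (\<Sum>m\<le>L. f (m, L - m))"
    if "\<And>m n. m + n \<noteq> L \<Longrightarrow> f (m, n) = 0" for L :: nat and f :: "nat \<times> nat \<Rightarrow> complex"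
  proof -
    have "infsum f UNIV = sum f ((\<lambda>m. (m, L - m)) ` {..L})"
    proof (rule infsum_eq_sum)
      fix z assume "z \<notin> (\<lambda>m. (m, L - m)) ` {..L}"
      then show "f z = 0" using that[of "fst z" "snd z"] by (cases z) (force simp: image_iff)
    qed auto
    then show ?thesis by (simp add: sum.reindex inj_on_def)
  qed
  have 1: "op_mult UNIV (beam_splitter \<eta>) A (p, q) z =
      (\<Sum>m\<le>p + q. of_real (beam_amp \<eta> p q m (p + q - m)) * A (m, p + q - m) z)" for A z
    unfolding op_mult_def by (subst sum[of "p + q"]) (auto simp: beam_splitter_def beam_amp_def)
  have 2: "op_adj (beam_splitter \<eta>) (m, n) (p', q') = of_real (beam_amp \<eta> p' q' m n)" for m n
    by (simp add: op_adj_def beam_splitter_def)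
  show ?thesis
    unfolding channel1_def op_conj_def op_mult_def[of _ "op_mult UNIV (beam_splitter \<eta>) (op_tensor R (thermal N))"]
    by (subst sum[of "p' + q'"]) (auto simp: beam_amp_eq_0 1 2 op_tensor_def)
qed

lemma channel1_thermal:
  "channel1 \<eta> N (thermal N') (p, q) (p', q') = (if p + q = p' + q' then
     of_real (\<Sum>m\<le>p + q. therm N' m * therm N (p + q - m) * beam_amp \<eta> p q m (p + q - m) * beam_amp \<eta> p' q' m (p + q - m)) else 0)"
proof -
  have "(\<Sum>m\<le>p + q. of_real (beam_amp \<eta> p q m (p + q - m)) * (thermal N' m m' * thermal N (p + q - m) (p' + q' - m')))
      = (if p + q = p' + q' then of_real (beam_amp \<eta> p q m' (p + q - m') * (therm N' m' * therm N (p + q - m'))) else 0)"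
    if "m' \<le> p' + q'" for m'
  proof (cases "p + q = p' + q'")
    case True
    then have "(\<Sum>m\<le>p + q. of_real (beam_amp \<eta> p q m (p + q - m)) * (thermal N' m m' * thermal N (p + q - m) (p' + q' - m'))) =
      (\<Sum>m\<in>{m'}. of_real (beam_amp \<eta> p q m (p + q - m)) * (thermal N' m m' * thermal N (p + q - m) (p' + q' - m')))"
      using that by (intro sum.mono_neutral_right) (auto simp: thermal_therm)
    with True show ?thesis by (simp add: thermal_therm)
  next
    case False
    with that show ?thesis by (auto intro!: sum.neutral simp: thermal_therm)
  qed
  then show ?thesis
    unfolding channel1_eq by (auto simp: mult_ac intro!: sum.cong)
qed

text \<open>Contribution of Eve's count \<open>q\<close> to the \<open>(p, p')\<close> entry of
  Bob's output when the signal input is the matrix unit \<open>|i><i'|\<close>. The last amplitude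
  vanishes unless \<open>p' + q = i' + (p + q - i)\<close>, that is \<open>p - i = p' - i'\<close>:
  Bob's excess over the idler is conserved.\<close>

definition bob_term :: "real \<Rightarrow> real \<Rightarrow> nat \<Rightarrow> nat \<Rightarrow> nat \<Rightarrow> nat \<Rightarrow> nat \<Rightarrow> real" where
  "bob_term \<eta> N p i p' i' q = (if i \<le> p + q then
     therm N (p + q - i) * beam_amp \<eta> p q i (p + q - i) * beam_amp \<eta> p' q i' (p + q - i) else 0)"

text \<open>For fixed idler indices a TMSV block is a multiple of a single matrix unit, so this case
  determines Bob's state.\<close>

lemma channel1_matrix_unit:
  "channel1 \<eta> N (\<lambda>u u'. if u = i \<and> u' = i' then c else 0) (p, q) (p', q) = c * of_real (bob_term \<eta> N p i p' i' q)"
proof -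
  have 1: "(\<Sum>m\<le>p + q. of_real (beam_amp \<eta> p q m (p + q - m)) * ((if m = i \<and> m' = i' then c else 0) * thermal N (p + q - m) (p' + q - m')))
      = (if m' = i' \<and> i \<le> p + q then of_real (beam_amp \<eta> p q i (p + q - i)) * (c * thermal N (p + q - i) (p' + q - i')) else 0)" for m'
  proof (cases "i \<le> p + q")
    case True
    then have "(\<Sum>m\<le>p + q. of_real (beam_amp \<eta> p q m (p + q - m)) * ((if m = i \<and> m' = i' then c else 0) * thermal N (p + q - m) (p' + q - m')))
      = (\<Sum>m\<in>{i}. of_real (beam_amp \<eta> p q m (p + q - m)) * ((if m = i \<and> m' = i' then c else 0) * thermal N (p + q - m) (p' + q - m')))"
      by (intro sum.mono_neutral_right) auto
    with True show ?thesis by simp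
  qed (auto intro!: sum.neutral)
  have "channel1 \<eta> N (\<lambda>u u'. if u = i \<and> u' = i' then c else 0) (p, q) (p', q) =
    (\<Sum>m'\<le>p' + q. if m' = i' then (if i \<le> p + q then of_real (beam_amp \<eta> p q i (p + q - i)) * (c * thermal N (p + q - i) (p' + q - i'))
      * of_real (beam_amp \<eta> p' q i' (p' + q - i')) else 0) else 0)"
    unfolding channel1_eq 1 by (intro sum.cong) auto
  also have "\<dots> = c * of_real (bob_term \<eta> N p i p' i' q)"
    by (auto simp: bob_term_def thermal_therm beam_amp_def)
  finally show ?thesis .
qed

definition bob_mode :: "real \<Rightarrow> real \<Rightarrow> real \<Rightarrow> real \<Rightarrow> (nat \<times> nat) op" where
  "bob_mode \<eta> N N\<^sub>S t = (\<lambda>(p, i) (p', i'). exp (\<i> * of_real (t * (real i - real i')))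
     * of_real (tmsv_coeff N\<^sub>S i * tmsv_coeff N\<^sub>S i') * (\<Sum>\<^sub>\<infinity>q. of_real (bob_term \<eta> N p i p' i' q)))"

context
  fixes \<eta> N :: real
  assumes \<eta>: "0 < \<eta>" "\<eta> < 1" and N: "0 < N"
begin

lemma bob_term_le: "\<bar>bob_term \<eta> N p i p' i' q\<bar> \<le> (if i \<le> p + q then therm N (p + q - i) else 0)"
proof -
  have "\<bar>beam_amp \<eta> p q i n * beam_amp \<eta> p' q i' n\<bar> \<le> 1" for n
    using beam_amp_le_1[of \<eta> p q i n] beam_amp_le_1[of \<eta> p' q i' n] \<eta> by (simp add: abs_mult mult_le_one)
  from mult_left_mono[OF this therm_nonneg[of N "p + q - i"], of "p + q - i"]
  show ?thesis using N therm_nonneg[of N] by (simp add: bob_term_def abs_mult mult.assoc)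
qed

lemma therm_summable_shift: "summable (\<lambda>q. if i \<le> p + q then therm N (p + q - i) else 0)"
proof -
  have "summable (\<lambda>q. therm N (q + i + p - i))"
    using therm_sums[of N] N by (simp add: sums_iff)
  then have "summable (\<lambda>q. if i \<le> p + (q + i) then therm N (p + (q + i) - i) else 0)"
    by (simp add: add_ac)
  then show ?thesis by (subst (asm) summable_iff_shift)
qed

lemma bob_term_summable: "(\<lambda>q. of_real (bob_term \<eta> N p i p' i' q) :: complex) abs_summable_on UNIV"
proof (rule Infinite_Sum.abs_summable_on_comparison_test')
  show "(\<lambda>q. if i \<le> p + q then therm N (p + q - i) else 0) summable_on UNIV"
    using therm_summable_shift N by (subst summable_on_UNIV_nonneg_real_iff) (auto simp: therm_nonneg)
  show "norm (of_real (bob_term \<eta> N p i p' i' q) :: complex) \<le> (if i \<le> p + q then therm N (p + q - i) else 0)" for q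
    using bob_term_le[of p i p' i' q] by simp
qed

lemma bob_term_has_sum:
  assumes "bob_term \<eta> N p i p' i' sums s"
  shows "(\<Sum>\<^sub>\<infinity>q. of_real (bob_term \<eta> N p i p' i' q) :: complex) = of_real s"
proof -
  have "((\<lambda>q. of_real (bob_term \<eta> N p i p' i' q) :: complex) has_sum of_real s) UNIV"
  proof (rule norm_summable_imp_has_sum)
    show "summable (\<lambda>q. norm (of_real (bob_term \<eta> N p i p' i' q) :: complex))"
      using bob_term_summable by (rule summable_on_imp_summable)
    show "(\<lambda>q. of_real (bob_term \<eta> N p i p' i' q) :: complex) sums of_real s"
      using assms by (rule sums_of_real)
  qed
  then show ?thesis by (rule infsumI)
qed

lemma bob_state_eq:
  "bob_state \<eta> N n C w k = tensor_modes2 n (\<lambda>j. bob_mode \<eta> N (photons C) (phases C w k j))"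
proof -
  let ?c = "\<lambda>j i i'. exp (\<i> * of_real (phases C w k j * (real i - real i'))) * of_real (tmsv_coeff (photons C) i * tmsv_coeff (photons C) i')"
  have "bob_state \<eta> N n C w k (x, y) (x', y') = tensor_modes2 n (\<lambda>j. bob_mode \<eta> N (photons C) (phases C w k j)) (x, y) (x', y')"
    for x y x' y'
  proof -
    have "(\<lambda>u u'. encoded_state n C w k (u, y) (u', y')) =
      tensor_modes n (\<lambda>j u u'. if u = y ! j \<and> u' = y' ! j then ?c j (y ! j) (y' ! j) else 0)"
      unfolding encoded_state_eq by (intro arg_cong[where f = "tensor_modes n"]) (auto simp: fun_eq_iff tmsv_eq)
    then have "bob_state \<eta> N n C w k (x, y) (x', y') =
      (\<Sum>\<^sub>\<infinity>q\<in>fock n. \<Prod>j<n. ?c j (y ! j) (y' ! j) * of_real (bob_term \<eta> N (x ! j) (y ! j) (x' ! j) (y' ! j) (q ! j)))"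
      unfolding bob_state_def map_tensor_id_def bob_channel_def ptrace_snd_def
      by (simp add: channel_joint_tensor tensor_modes2_def channel1_matrix_unit)
    also have "\<dots> = (\<Prod>j<n. \<Sum>\<^sub>\<infinity>q. ?c j (y ! j) (y' ! j) * of_real (bob_term \<eta> N (x ! j) (y ! j) (x' ! j) (y' ! j) q))"
    proof (rule infsum_prod_fock)
      show "(\<lambda>q. ?c j (y ! j) (y' ! j) * of_real (bob_term \<eta> N (x ! j) (y ! j) (x' ! j) (y' ! j) q)) abs_summable_on UNIV" for j
        unfolding norm_mult by (intro summable_on_cmult_right bob_term_summable)
    qed
    finally show ?thesis by (simp add: tensor_modes2_def bob_mode_def infsum_cmult_right')
  qed
  then show ?thesis by (auto simp: fun_eq_iff)
qed

end

section \<open>Eve's output for thermal inputs\<close>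

lemma eve_channel_thermal:
  assumes "0 < \<eta>" "\<eta> < 1" "0 < N\<^sub>B" "0 \<le> N"
  shows "eve_channel \<eta> N\<^sub>B n (tensor_modes n (\<lambda>_. thermal N)) =
    tensor_modes n (\<lambda>_. thermal (\<eta> * N\<^sub>B + (1 - \<eta>) * N))"
proof (intro ext)
  fix y y'
  have pos: "0 \<le> (\<Sum>m\<le>p + q. therm N m * therm N\<^sub>B (p + q - m) * beam_amp \<eta> p q m (p + q - m) * beam_amp \<eta> p q m (p + q - m))" for p q
    using assms by (intro sum_nonneg) (simp add: therm_nonneg mult.assoc)
  have hs: "((\<lambda>p. channel1 \<eta> N\<^sub>B (thermal N) (p, b) (p, b')) has_sum thermal (\<eta> * N\<^sub>B + (1 - \<eta>) * N) b b') UNIV" for b b'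
  proof (cases "b = b'")
    case True
    have "((\<lambda>p. \<Sum>m\<le>p + b. therm N m * therm N\<^sub>B (p + b - m) * beam_amp \<eta> p b m (p + b - m) * beam_amp \<eta> p b m (p + b - m))
      has_sum therm (\<eta> * N\<^sub>B + (1 - \<eta>) * N) b) UNIV"
      using eve_thermal_sums[OF assms, of b] by (intro sums_nonneg_imp_has_sum pos) (simp add: power2_eq_square mult.assoc)
    from has_sum_of_real[OF this] True show ?thesis
      by (simp add: channel1_thermal thermal_therm)
  qed (simp add: channel1_thermal thermal_therm)
  have "eve_channel \<eta> N\<^sub>B n (tensor_modes n (\<lambda>_. thermal N)) y y' =
      (\<Sum>\<^sub>\<infinity>x\<in>fock n. \<Prod>j<n. channel1 \<eta> N\<^sub>B (thermal N) (x ! j, y ! j) (x ! j, y' ! j))"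
    by (simp add: eve_channel_def ptrace_fst_def channel_joint_tensor tensor_modes2_def)
  also have "\<dots> = (\<Prod>j<n. \<Sum>\<^sub>\<infinity>p. channel1 \<eta> N\<^sub>B (thermal N) (p, y ! j) (p, y' ! j))"
    unfolding summable_on_iff_abs_summable_on_complex[symmetric]
    by (intro infsum_prod_fock summable_on_iff_abs_summable_on_complex[THEN iffD1] has_sum_imp_summable[OF hs])
  also have "\<dots> = tensor_modes n (\<lambda>_. thermal (\<eta> * N\<^sub>B + (1 - \<eta>) * N)) y y'"
    using infsumI[OF hs] by (simp add: tensor_modes_def)
  finally show "eve_channel \<eta> N\<^sub>B n (tensor_modes n (\<lambda>_. thermal N)) y y' =
    tensor_modes n (\<lambda>_. thermal (\<eta> * N\<^sub>B + (1 - \<eta>) * N)) y y'" .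
qed

section \<open>Uniqueness of the positive square root, and the trace norm it yields\<close>

section \<open>Trace norm of diagonal operators\<close>

lemma op_form_diag2:
  assumes "finite F" "x \<in> F" "y \<in> F" "x \<noteq> y"
  shows "op_form F A (\<lambda>z. if z = x then a else if z = y then b else 0) (\<lambda>z. if z = x then c else if z = y then d else 0)
    = cnj a * A x x * c + cnj a * A x y * d + cnj b * A y x * c + cnj b * A y y * d"
proof -
  let ?u = "\<lambda>z. if z = x then a else if z = y then b else 0" and ?v = "\<lambda>z. if z = x then c else if z = y then d else 0"
  have "op_form F A ?u ?v = (\<Sum>z\<in>{x, y}. \<Sum>z'\<in>{x, y}. cnj (?u z) * A z z' * ?v z')"
    unfolding op_form_def using assms
    by (intro sum.mono_neutral_cong_right) (auto intro!: sum.mono_neutral_cong_right sum.neutral)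
  then show ?thesis using assms(4) by simp
qed

lemma op_pos_diag:
  assumes "op_pos S A" "x \<in> S"
  shows "Im (A x x) = 0" "0 \<le> Re (A x x)"
  using assms(1)[unfolded op_pos_def, rule_format, of "{x}" "\<lambda>_. 1"] assms(2) by (auto simp: op_form_def)

lemma op_pos_hermitian:
  assumes "op_pos S A" "x \<in> S" "y \<in> S"
  shows "A y x = cnj (A x y)"
proof (cases "x = y")
  case True
  then show ?thesis using op_pos_diag[OF assms(1,2)] by (simp add: complex_eq_iff)
next
  case False
  let ?v = "\<lambda>b z. if z = x then 1 else if z = y then b else 0 :: complex"
  have *: "Im (op_form {x, y} A (?v b) (?v b)) = 0" for b
    using assms by (auto simp: op_pos_def)
  \<comment> \<open>Reality of the form on the vectors (1, 1) and (1, i) settles the imaginary and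
    the real part.\<close>
  have "Im (A x y) + Im (A y x) = 0"
    using *[of 1] op_pos_diag[OF assms(1,2)] op_pos_diag[OF assms(1,3)] op_form_diag2[of "{x, y}" x y A 1 1 1 1] False by simp
  moreover have "Re (A x y) - Re (A y x) = 0"
    using *[of \<i>] op_pos_diag[OF assms(1,2)] op_pos_diag[OF assms(1,3)] op_form_diag2[of "{x, y}" x y A 1 \<i> 1 \<i>] False by simp
  ultimately show ?thesis by (simp add: complex_eq_iff)
qed

text \<open>Testing the bound on a unit vector against the conjugate row, cut off to a finite set,
  gives \<open>?s \<le> c * sqrt ?s\<close>. This convergence ensures that a diagonal entry of
  \<open>op_mult S R R\<close> is a genuine sum and not the default value 0.\<close>

lemma bounded_row_square_summable:
  assumes "op_bounded S R" "x \<in> S"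
  shows "(\<lambda>z. (cmod (R x z))\<^sup>2) summable_on S"
proof -
  obtain c where c: "\<forall>F u v. finite F \<and> F \<subseteq> S \<longrightarrow>
     cmod (op_form F R u v) \<le> c * sqrt (\<Sum>x\<in>F. (cmod (u x))\<^sup>2) * sqrt (\<Sum>x\<in>F. (cmod (v x))\<^sup>2)"
    using assms(1) unfolding op_bounded_def by (rule exE)
  show ?thesis
  proof (rule nonneg_bdd_above_summable_on)
    show "bdd_above (sum (\<lambda>z. (cmod (R x z))\<^sup>2) ` {F. F \<subseteq> S \<and> finite F})"
    proof (rule bdd_aboveI2)
      fix F assume "F \<in> {F. F \<subseteq> S \<and> finite F}"
      then have F: "finite (insert x F)" "insert x F \<subseteq> S" using assms(2) by auto
      let ?u = "\<lambda>z. if z = x then 1 else 0 :: complex" and ?v = "\<lambda>z. cnj (R x z)" and ?G = "insert x F"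
      let ?s = "\<Sum>z\<in>?G. (cmod (R x z))\<^sup>2"
      have "op_form ?G R ?u ?v = (\<Sum>z\<in>{x}. \<Sum>z'\<in>?G. cnj (?u z) * R z z' * ?v z')"
        unfolding op_form_def using F by (intro sum.mono_neutral_right) auto
      also have "\<dots> = of_real ?s"
        by (simp add: complex_norm_square del: of_real_power)
      finally have "\<bar>?s\<bar> \<le> c * sqrt (\<Sum>z\<in>?G. (cmod (?u z))\<^sup>2) * sqrt (\<Sum>z\<in>?G. (cmod (?v z))\<^sup>2)"
        using c[rule_format, OF conjI[OF F], of ?u ?v] by (metis norm_of_real)
      moreover have "(\<Sum>z\<in>?G. (cmod (?u z))\<^sup>2) = (\<Sum>z\<in>{x}. (cmod (?u z))\<^sup>2)"
        using F by (intro sum.mono_neutral_right) auto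
      moreover have nn: "0 \<le> ?s" by (intro sum_nonneg) auto
      ultimately have "?s \<le> c * sqrt ?s" by simp
      then have "sqrt ?s * sqrt ?s \<le> c * sqrt ?s" using nn by simp
      then have "sqrt ?s \<le> \<bar>c\<bar>"
        by (smt (verit) mult_le_cancel_right_pos nn real_sqrt_ge_zero)
      then have "(sqrt ?s)\<^sup>2 \<le> \<bar>c\<bar>\<^sup>2" by (intro power_mono) (use nn in auto)
      then have "?s \<le> c\<^sup>2" using nn by simp
      moreover have "(\<Sum>z\<in>F. (cmod (R x z))\<^sup>2) \<le> ?s"
        using F by (intro sum_mono2) auto
      ultimately show "(\<Sum>z\<in>F. (cmod (R x z))\<^sup>2) \<le> c\<^sup>2" by simp
    qed
  qed auto
qed

text \<open>Uniqueness of the positive square root: \<open>R\<close> commutes with \<open>R\<^sup>2\<close>, so it is block diagonal with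
  respect to the values of \<open>s\<close>; the block of a value \<open>t > 0\<close> is finite and there
  \<open>(R + t) (R - t) = 0\<close> with \<open>R + t\<close> positive definite.\<close>

lemma diagonal_sqrt_unique:
  fixes s :: "'i \<Rightarrow> real"
  assumes pos: "op_pos S R" and bdd: "op_bounded S R"
    and sq: "\<And>x y. x \<in> S \<Longrightarrow> y \<in> S \<Longrightarrow> op_mult S R R x y = (if x = y then of_real ((s x)\<^sup>2) else 0)"
    and s: "\<And>x. 0 \<le> s x" and sum: "s summable_on S"
    and "x \<in> S" "y \<in> S"
  shows "R x y = (if x = y then of_real (s x) else 0)"
proof -
  have herm: "R y x = cnj (R x y)" if "x \<in> S" "y \<in> S" for x y
    using op_pos_hermitian[OF pos that] .
  \<comment> \<open>The diagonal of the square says that row \<open>x\<close> has norm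
    \<open>s x\<close>.\<close>
  have row: "cmod (R x z) \<le> s x" if "x \<in> S" "z \<in> S" for x z
  proof -
    have "op_mult S R R x x = (\<Sum>\<^sub>\<infinity>z\<in>S. of_real ((cmod (R x z))\<^sup>2))"
      unfolding op_mult_def
    proof (rule infsum_cong)
      fix z assume "z \<in> S"
      then show "R x z * R z x = of_real ((cmod (R x z))\<^sup>2)"
        unfolding herm[OF that(1) \<open>z \<in> S\<close>] complex_norm_square by simp
    qed
    also have "\<dots> = of_real (\<Sum>\<^sub>\<infinity>z\<in>S. (cmod (R x z))\<^sup>2)"
      by (rule infsumI, rule has_sum_of_real, rule has_sum_infsum, rule bounded_row_square_summable[OF bdd that(1)])
    finally have "(\<Sum>\<^sub>\<infinity>z\<in>S. (cmod (R x z))\<^sup>2) = (s x)\<^sup>2"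
      using sq[OF that(1) that(1)] by (simp only: refl if_True of_real_eq_iff)
    moreover have "(\<Sum>z\<in>{z}. (cmod (R x z))\<^sup>2) \<le> (\<Sum>\<^sub>\<infinity>z\<in>S. (cmod (R x z))\<^sup>2)"
      using that by (intro finite_sum_le_infsum bounded_row_square_summable[OF bdd]) auto
    ultimately show ?thesis using s[of x] by (simp add: power2_le_iff_abs_le)
  qed
  have col: "cmod (R x z) \<le> s z" if "x \<in> S" "z \<in> S" for x z
    using row[OF that(2,1)] herm[OF that] by simp
  define c where "c = (\<Sum>\<^sub>\<infinity>x\<in>S. s x)"
  have s_le: "s x \<le> c" if "x \<in> S" for x
    using finite_sum_le_infsum[OF sum, of "{x}"] that s unfolding c_def by auto
  have block: "R x y = 0" if xy: "x \<in> S" "y \<in> S" and ne: "s x \<noteq> s y" for x y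
  proof -
    \<comment> \<open>Domination by a multiple of \<open>s w * s z\<close> gives the absolute
      convergence that makes \<open>R (R R) = (R R) R\<close> legitimate.\<close>
    have "(\<lambda>z. cmod (case z of (w, z) \<Rightarrow> R x w * R w z * R z y)) summable_on S \<times> S"
    proof (rule Infinite_Sum.abs_summable_on_comparison_test')
      have "(\<lambda>(w, z). s w * s z) abs_summable_on S \<times> S"
        using sum s by (intro abs_summable_times) (auto cong: summable_on_cong)
      then have "(\<lambda>(w, z). s w * s z) summable_on S \<times> S"
        by (rule abs_summable_summable)
      then show "(\<lambda>z. c * (case z of (w, z) \<Rightarrow> s w * s z)) summable_on S \<times> S"
        by (rule summable_on_cmult_right)
      fix z assume "z \<in> S \<times> S"
      then obtain w v where z: "z = (w, v)" "w \<in> S" "v \<in> S" by auto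
      have "cmod (R x w) * cmod (R w v) * cmod (R v y) \<le> s w * c * s v"
        using z xy col[of x w] row[of w v] s_le[of w] row[of v y] s[of w] s[of v]
        by (intro mult_mono) (auto intro: order_trans)
      then show "cmod (case z of (w, z) \<Rightarrow> R x w * R w z * R z y) \<le> c * (case z of (w, z) \<Rightarrow> s w * s z)"
        using z by (simp add: norm_mult mult_ac)
    qed
    then have "(\<lambda>(w, z). R x w * R w z * R z y) summable_on S \<times> S"
      by (rule abs_summable_summable)
    then have "(\<Sum>\<^sub>\<infinity>w\<in>S. \<Sum>\<^sub>\<infinity>z\<in>S. R x w * R w z * R z y) = (\<Sum>\<^sub>\<infinity>z\<in>S. \<Sum>\<^sub>\<infinity>w\<in>S. R x w * R w z * R z y)"
      by (rule infsum_swap_banach)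
    moreover have "(\<Sum>\<^sub>\<infinity>w\<in>S. \<Sum>\<^sub>\<infinity>z\<in>S. R x w * R w z * R z y) = R x y * of_real ((s y)\<^sup>2)"
    proof -
      have "(\<Sum>\<^sub>\<infinity>w\<in>S. \<Sum>\<^sub>\<infinity>z\<in>S. R x w * R w z * R z y) = (\<Sum>\<^sub>\<infinity>w\<in>S. R x w * op_mult S R R w y)"
        by (simp add: op_mult_def mult.assoc infsum_cmult_right')
      also have "\<dots> = (\<Sum>w\<in>{y}. R x w * op_mult S R R w y)"
        using xy sq by (intro infsum_eq_sum) auto
      finally show ?thesis using sq xy by simp
    qed
    moreover have "(\<Sum>\<^sub>\<infinity>z\<in>S. \<Sum>\<^sub>\<infinity>w\<in>S. R x w * R w z * R z y) = of_real ((s x)\<^sup>2) * R x y"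
    proof -
      have "(\<Sum>\<^sub>\<infinity>z\<in>S. \<Sum>\<^sub>\<infinity>w\<in>S. R x w * R w z * R z y) = (\<Sum>\<^sub>\<infinity>z\<in>S. op_mult S R R x z * R z y)"
        by (simp add: op_mult_def infsum_cmult_left')
      also have "\<dots> = (\<Sum>z\<in>{x}. op_mult S R R x z * R z y)"
        using xy sq by (intro infsum_eq_sum) auto
      finally show ?thesis using sq xy by simp
    qed
    ultimately have "R x y * of_real ((s y)\<^sup>2 - (s x)\<^sup>2) = 0"
      by (simp add: right_diff_distrib mult.commute)
    moreover have "(s y)\<^sup>2 - (s x)\<^sup>2 \<noteq> 0"
      using ne s by (simp add: power2_eq_iff_nonneg)
    ultimately show ?thesis by (metis mult_eq_0_iff of_real_eq_0_iff)
  qed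
  show ?thesis
  proof (cases "s x = s y \<and> 0 < s y")
    case False
    then show ?thesis
      using block[of x y] col[of x y] \<open>x \<in> S\<close> \<open>y \<in> S\<close> s[of y] by (cases "s x = s y") auto
  next
    case True
    define t B where "t = s y" and "B = {z \<in> S. s z = t}"
    have t: "0 < t" using True by (simp add: t_def)
    \<comment> \<open>Summability of \<open>s\<close> leaves room for only finitely many indices of
      one value \<open>t > 0\<close>.\<close>
    have "finite B"
    proof (rule ccontr)
      assume inf: "infinite B"
      obtain n :: nat where n: "c < real n * t" using t reals_Archimedean3 by blast
      obtain F where F: "F \<subseteq> B" "finite F" "card F = n" using inf infinite_arbitrarily_large by blast
      have "real n * t = sum s F" using F by (auto simp: B_def subset_iff)
      also have "\<dots> \<le> c" unfolding c_def using F s sum by (intro finite_sum_le_infsum) (auto simp: B_def)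
      finally show False using n by simp
    qed
    have B: "B \<subseteq> S" "x \<in> B" "y \<in> B" using True \<open>x \<in> S\<close> \<open>y \<in> S\<close> by (auto simp: B_def t_def)
    \<comment> \<open>Column \<open>y\<close> of \<open>R - t\<close> on the block. Below,
      \<open>q0\<close> is \<open>(R + t) q = 0\<close>, and positivity of \<open>R\<close> then
      forces \<open>q = 0\<close>.\<close>
    define q where "q z = R z y - (if z = y then of_real t else 0)" for z
    have mult: "(\<Sum>z\<in>B. R w z * R z y) = (if w = y then of_real (t\<^sup>2) else 0)" if "w \<in> B" for w
    proof -
      have "op_mult S R R w y = (\<Sum>z\<in>B. R w z * R z y)"
        unfolding op_mult_def using that B \<open>finite B\<close> by (intro infsum_eq_sum) (auto simp: B_def block)
      then show ?thesis using sq[of w y] that B by (auto simp: B_def)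
    qed
    have q0: "(\<Sum>z\<in>B. R w z * q z) + of_real t * q w = 0" if "w \<in> B" for w
    proof -
      have "(\<Sum>z\<in>B. R w z * q z) = (\<Sum>z\<in>B. R w z * R z y) - (\<Sum>z\<in>B. if z = y then R w z * of_real t else 0)"
        unfolding sum_subtractf[symmetric] by (intro sum.cong) (auto simp: q_def right_diff_distrib)
      then show ?thesis
        using that B \<open>finite B\<close> by (simp add: mult q_def right_diff_distrib power2_eq_square)
    qed
    have "op_form B R q q = (\<Sum>w\<in>B. cnj (q w) * (\<Sum>z\<in>B. R w z * q z))"
      by (simp add: op_form_def sum_distrib_left mult.assoc)
    also have "\<dots> = (\<Sum>w\<in>B. cnj (q w) * (- of_real t * q w))"
      using q0 by (intro sum.cong refl arg_cong2[where f = times]) (simp add: eq_neg_iff_add_eq_0)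
    also have "\<dots> = of_real (- (t * (\<Sum>w\<in>B. (cmod (q w))\<^sup>2)))"
      by (simp add: complex_norm_square sum_distrib_left sum_negf mult_ac del: of_real_power)
    finally have "Re (op_form B R q q) = - (t * (\<Sum>w\<in>B. (cmod (q w))\<^sup>2))" by simp
    moreover have "0 \<le> Re (op_form B R q q)"
      using pos \<open>finite B\<close> B by (auto simp: op_pos_def)
    ultimately have "t * (\<Sum>w\<in>B. (cmod (q w))\<^sup>2) \<le> 0" by simp
    then have "(\<Sum>w\<in>B. (cmod (q w))\<^sup>2) \<le> 0" using t by (simp add: mult_le_0_iff)
    then have "(\<Sum>w\<in>B. (cmod (q w))\<^sup>2) = 0" by (intro antisym sum_nonneg) auto
    then have "q x = 0" using \<open>finite B\<close> B by (subst (asm) sum_nonneg_eq_0_iff) auto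
    then show ?thesis using True by (auto simp: q_def t_def split: if_splits)
  qed
qed

text \<open>The diagonal of absolute values is one positive bounded root;
  \<open>diagonal_sqrt_unique\<close> makes it the one that \<open>THE\<close> selects. It is set to
  0 outside \<open>S\<close> to match the convention of \<open>op_abs\<close>.\<close>

lemma trace_norm_diagonal:
  fixes a :: "'i \<Rightarrow> real"
  assumes A: "\<And>x y. x \<in> S \<Longrightarrow> y \<in> S \<Longrightarrow> A x y = (if x = y then of_real (a x) else 0)"
    and sum: "(\<lambda>x. \<bar>a x\<bar>) summable_on S"
  shows "trace_norm S A = (\<Sum>\<^sub>\<infinity>x\<in>S. \<bar>a x\<bar>)"
proof -
  define D where "D x y = (if x = y \<and> x \<in> S then of_real \<bar>a x\<bar> else 0 :: complex)" for x y
  define c where "c = (\<Sum>\<^sub>\<infinity>x\<in>S. \<bar>a x\<bar>)"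
  have form: "op_form F D u v = (\<Sum>x\<in>F. cnj (u x) * of_real \<bar>a x\<bar> * v x)" if "finite F" "F \<subseteq> S" for F u v
    unfolding op_form_def
  proof (intro sum.cong refl)
    fix x assume "x \<in> F"
    then have "(\<Sum>y\<in>F. cnj (u x) * D x y * v y) = (\<Sum>y\<in>{x}. cnj (u x) * D x y * v y)"
      using that by (intro sum.mono_neutral_right) (auto simp: D_def)
    then show "(\<Sum>y\<in>F. cnj (u x) * D x y * v y) = cnj (u x) * of_real \<bar>a x\<bar> * v x"
      using that \<open>x \<in> F\<close> by (auto simp: D_def)
  qed
  have D2: "op_mult S D D x y = (if x = y then of_real (\<bar>a x\<bar>\<^sup>2) else 0)" if "x \<in> S" "y \<in> S" for x y
    unfolding op_mult_def using that by (subst infsum_eq_sum[where F = "{x}"]) (auto simp: D_def power2_eq_square simp flip: of_real_mult)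
  have A2: "op_mult S (op_adj A) A x y = (if x = y then of_real (\<bar>a x\<bar>\<^sup>2) else 0)" if "x \<in> S" "y \<in> S" for x y
    unfolding op_mult_def using that by (subst infsum_eq_sum[where F = "{x}"]) (auto simp: A op_adj_def power2_eq_square simp flip: of_real_mult)
  have Dpos: "op_pos S D"
    unfolding op_pos_def
  proof (intro allI impI)
    fix F :: "'i set" and v :: "'i \<Rightarrow> complex" assume F: "finite F \<and> F \<subseteq> S"
    have "op_form F D v v = of_real (\<Sum>x\<in>F. \<bar>a x\<bar> * (cmod (v x))\<^sup>2)"
      using F by (simp add: form complex_norm_square mult_ac del: of_real_power)
    moreover have "0 \<le> (\<Sum>x\<in>F. \<bar>a x\<bar> * (cmod (v x))\<^sup>2)" by (intro sum_nonneg) auto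
    ultimately show "Im (op_form F D v v) = 0 \<and> 0 \<le> Re (op_form F D v v)" by simp
  qed
  have Dbdd: "op_bounded S D"
    unfolding op_bounded_def
  proof (intro exI[of _ c] allI impI)
    fix F u v assume F: "finite F \<and> F \<subseteq> S"
    have le: "\<bar>a x\<bar> \<le> c" if "x \<in> F" for x
      using finite_sum_le_infsum[OF sum, of "{x}"] that F by (auto simp: c_def)
    have c0: "0 \<le> c" unfolding c_def by (intro infsum_nonneg) auto
    have "cmod (op_form F D u v) \<le> (\<Sum>x\<in>F. c * (cmod (u x) * cmod (v x)))"
    proof -
      have "cmod (op_form F D u v) \<le> (\<Sum>x\<in>F. cmod (cnj (u x) * of_real \<bar>a x\<bar> * v x))"
        using F by (simp add: form norm_sum)
      also have "\<dots> \<le> (\<Sum>x\<in>F. c * (cmod (u x) * cmod (v x)))"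
              proof (intro sum_mono)
        fix x assume "x \<in> F"
        have "cmod (cnj (u x) * of_real \<bar>a x\<bar> * v x) = \<bar>a x\<bar> * (cmod (u x) * cmod (v x))"
          by (simp add: norm_mult)
        also have "\<dots> \<le> c * (cmod (u x) * cmod (v x))"
          using le[OF \<open>x \<in> F\<close>] by (rule mult_right_mono) simp
        finally show "cmod (cnj (u x) * of_real \<bar>a x\<bar> * v x) \<le> c * (cmod (u x) * cmod (v x))" .
      qed
      finally show ?thesis .
    qed
    also have "\<dots> = c * (\<Sum>x\<in>F. cmod (u x) * cmod (v x))" by (simp add: sum_distrib_left)
    also have "\<dots> \<le> c * (L2_set (\<lambda>x. cmod (u x)) F * L2_set (\<lambda>x. cmod (v x)) F)"
      using L2_set_mult_ineq[of "\<lambda>x. cmod (u x)" "\<lambda>x. cmod (v x)" F] c0 by (intro mult_left_mono) auto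
    finally show "cmod (op_form F D u v) \<le> c * sqrt (\<Sum>x\<in>F. (cmod (u x))\<^sup>2) * sqrt (\<Sum>x\<in>F. (cmod (v x))\<^sup>2)"
      by (simp add: L2_set_def mult.assoc)
  qed
  have "op_abs S A = D"
    unfolding op_abs_def
  proof (rule the_equality)
    show "op_pos S D \<and> op_bounded S D \<and> (\<forall>x\<in>S. \<forall>y\<in>S. op_mult S D D x y = op_mult S (op_adj A) A x y)
        \<and> (\<forall>x y. \<not> (x \<in> S \<and> y \<in> S) \<longrightarrow> D x y = 0)"
      using Dpos Dbdd D2 A2 by (auto simp: D_def)
  next
    fix R assume R: "op_pos S R \<and> op_bounded S R \<and> (\<forall>x\<in>S. \<forall>y\<in>S. op_mult S R R x y = op_mult S (op_adj A) A x y)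
        \<and> (\<forall>x y. \<not> (x \<in> S \<and> y \<in> S) \<longrightarrow> R x y = 0)"
    have "R x y = D x y" for x y
    proof (cases "x \<in> S \<and> y \<in> S")
      case True
      then show ?thesis
        using diagonal_sqrt_unique[of S R "\<lambda>x. \<bar>a x\<bar>" x y] R A2 sum by (auto simp: D_def)
    next
      case False
      then show ?thesis using R by (auto simp: D_def)
    qed
    then show "R = D" by blast
  qed
  moreover have "op_trace S D = of_real c"
    unfolding op_trace_def c_def
    using has_sum_of_real[OF has_sum_infsum[OF sum], where 'a = complex] by (intro infsumI) (auto simp: D_def cong: has_sum_cong)
  ultimately show ?thesis by (simp add: trace_norm_def c_def)
qed

section \<open>Hellinger bound on what Eve can distinguish\<close>

section \<open>Covertness\<close>

text \<open>The affinity is a geometric series. Its square is exactly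
  \<open>1 - (b - a)\<^sup>2 / Z\<close> with
  \<open>sqrt Z = sqrt (a * (a + 1)) + sqrt (b * (b + 1))\<close>, and \<open>a \<le> b\<close>
  gives \<open>Z \<ge> 4 * (a * (a + 1))\<close>.\<close>

lemma bhattacharyya_therm:
  assumes "0 < a" "a \<le> b"
  shows "((\<lambda>k. sqrt (therm a k * therm b k)) has_sum (1 / (sqrt ((a + 1) * (b + 1)) - sqrt (a * b)))) UNIV"
    and "1 - (b - a)\<^sup>2 / (4 * (a * (a + 1))) \<le> (1 / (sqrt ((a + 1) * (b + 1)) - sqrt (a * b)))\<^sup>2"
proof -
  have lt: "a * b < (a + 1) * (b + 1)" using assms by (simp add: algebra_simps)
  have b: "0 < b" using assms by simp
  have XY: "0 < sqrt ((a + 1) * (b + 1)) - sqrt (a * b)" using lt by simp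
  let ?X = "sqrt ((a + 1) * (b + 1))" and ?Y = "sqrt (a * b)"
  have X: "0 < ?X" using assms by simp
  have eq: "sqrt (therm a k * therm b k) = (?Y / ?X) ^ k / ?X" for k
    using assms by (simp add: therm_def real_sqrt_divide real_sqrt_mult real_sqrt_power power_divide power_mult_distrib mult_ac)
  have "(\<lambda>k. (?Y / ?X) ^ k / ?X) sums (1 / (1 - ?Y / ?X) / ?X)"
    using X XY assms by (intro sums_divide geometric_sums) simp
  also have "1 / (1 - ?Y / ?X) / ?X = 1 / (?X - ?Y)"
  proof -
    have "(1 - y / x) * x = x - y" if "0 < x" for x y :: real using that by (simp add: left_diff_distrib)
    from this[OF X] have "(1 - ?Y / ?X) * ?X = ?X - ?Y" .
    then show ?thesis by (metis divide_divide_eq_left)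
  qed
  finally show "((\<lambda>k. sqrt (therm a k * therm b k)) has_sum (1 / (?X - ?Y))) UNIV"
    unfolding eq using assms by (intro sums_nonneg_imp_has_sum) auto
  define p q r t where "p = sqrt a" and "q = sqrt (a + 1)" and "r = sqrt b" and "t = sqrt (b + 1)"
  have sqs: "p\<^sup>2 = a" "q\<^sup>2 = a + 1" "r\<^sup>2 = b" "t\<^sup>2 = b + 1" using assms by (auto simp: p_def q_def r_def t_def)
  have pos: "0 < p" "0 < q" "0 < r" "0 < t" "p \<le> r" "q \<le> t" using assms by (auto simp: p_def q_def r_def t_def)
  have XYe: "?X = q * t" "?Y = p * r" by (auto simp: p_def q_def r_def t_def real_sqrt_mult)
  have id: "(q * t - p * r)\<^sup>2 * (p * q + r * t)\<^sup>2 = (p * q + r * t)\<^sup>2 + (b - a)\<^sup>2 * (q * t - p * r)\<^sup>2"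
  proof -
    define \<Delta> where "\<Delta> = b - a"
    have r: "q\<^sup>2 - r\<^sup>2 = 1 - \<Delta>" "t\<^sup>2 - p\<^sup>2 = 1 + \<Delta>" "q\<^sup>2 * r\<^sup>2 - p\<^sup>2 * t\<^sup>2 = \<Delta>"
      "(p * q + r * t)\<^sup>2 = (p * t + q * r)\<^sup>2 + \<Delta>\<^sup>2" "(q * t - p * r)\<^sup>2 = (q * r - p * t)\<^sup>2 + 1"
      unfolding power2_sum power2_diff power_mult_distrib sqs by (simp_all add: \<Delta>_def power2_eq_square algebra_simps)
    have "(q * t - p * r) * (p * q + r * t) = p * t * (q\<^sup>2 - r\<^sup>2) + q * r * (t\<^sup>2 - p\<^sup>2)"
      by (simp add: power2_eq_square algebra_simps)
    also have "\<dots> = (p * t + q * r) + \<Delta> * (q * r - p * t)"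
      unfolding r by (simp add: algebra_simps)
    finally have "(q * t - p * r)\<^sup>2 * (p * q + r * t)\<^sup>2 = ((p * t + q * r) + \<Delta> * (q * r - p * t))\<^sup>2"
      by (simp only: power_mult_distrib[symmetric])
    also have "\<dots> = (p * t + q * r)\<^sup>2 + 2 * \<Delta> * (q\<^sup>2 * r\<^sup>2 - p\<^sup>2 * t\<^sup>2) + \<Delta>\<^sup>2 * (q * r - p * t)\<^sup>2"
      by (simp add: power2_eq_square algebra_simps)
    also have "\<dots> = (p * q + r * t)\<^sup>2 + \<Delta>\<^sup>2 * (q * t - p * r)\<^sup>2"
      unfolding r by (simp add: power2_eq_square algebra_simps)
    finally show ?thesis by (simp add: \<Delta>_def)
  qed
  let ?Z = "(p * q + r * t)\<^sup>2" and ?W = "(q * t - p * r)\<^sup>2"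
  have W: "0 < ?W" using XY unfolding XYe by simp
  have Z: "4 * (a * (a + 1)) \<le> ?Z"
  proof -
    have "p * q \<le> r * t" using pos by (intro mult_mono) auto
    then have "(2 * (p * q))\<^sup>2 \<le> ?Z" using pos by (intro power_mono) auto
    then show ?thesis by (simp add: power_mult_distrib sqs)
  qed
  have Z0: "0 < 4 * (a * (a + 1))" using assms by simp
  have "1 / ?W = 1 - (b - a)\<^sup>2 / ?Z"
  proof -
    have "?W * ?Z - (b - a)\<^sup>2 * ?W = ?Z" using id by simp
    then have "?W * (?Z - (b - a)\<^sup>2) = ?Z" by (simp add: algebra_simps)
    moreover have nz: "?Z \<noteq> 0" "?W \<noteq> 0" using Z Z0 W by linarith+
    ultimately have "1 / ?W = (?Z - (b - a)\<^sup>2) / ?Z"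
      using frac_eq_eq[of ?W ?Z 1 "?Z - (b - a)\<^sup>2"] by (metis mult.commute mult_1)
    also have "\<dots> = 1 - (b - a)\<^sup>2 / ?Z"
      using divide_self[OF nz(1)] by (simp only: diff_divide_distrib)
    finally show ?thesis .
  qed
  moreover have "(b - a)\<^sup>2 / ?Z \<le> (b - a)\<^sup>2 / (4 * (a * (a + 1)))"
    using Z Z0 less_le_trans[OF Z0 Z] by (intro divide_left_mono[OF _ _ mult_pos_pos]) simp_all
  ultimately show "1 - (b - a)\<^sup>2 / (4 * (a * (a + 1))) \<le> (1 / (?X - ?Y))\<^sup>2"
    unfolding XYe by (simp add: power_divide)
qed

text \<open>Factor \<open>P - Q\<close> as a difference of squares of square roots and apply
  Cauchy-Schwarz; the two factors have square sums \<open>2 - 2 * B\<close> and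
  \<open>2 + 2 * B\<close>.\<close>

lemma total_variation_le_bhattacharyya:
  fixes P Q :: "'a \<Rightarrow> real"
  assumes "\<And>x. 0 \<le> P x" "\<And>x. 0 \<le> Q x" and P: "(P has_sum 1) S" and Q: "(Q has_sum 1) S"
    and B: "((\<lambda>x. sqrt (P x * Q x)) has_sum B) S"
  shows "(\<lambda>x. \<bar>P x - Q x\<bar>) summable_on S" and "(\<Sum>\<^sub>\<infinity>x\<in>S. \<bar>P x - Q x\<bar>) \<le> 2 * sqrt (1 - B\<^sup>2)"
proof -
  have "(\<lambda>x. P x + Q x) summable_on S"
    using P Q by (intro summable_on_add) (auto intro: has_sum_imp_summable)
  then show sum: "(\<lambda>x. \<bar>P x - Q x\<bar>) summable_on S"
    by (rule Infinite_Sum.abs_summable_on_comparison_test'[where f = "\<lambda>x. P x - Q x", unfolded real_norm_def])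
      (use assms(1,2) in \<open>auto simp: abs_le_iff\<close>)
  have h: "((\<lambda>x. P x + Q x + c * sqrt (P x * Q x)) has_sum (1 + 1 + c * B)) S" for c
    using P Q B by (intro has_sum_add has_sum_cmult_right)
  have sq: "P x + Q x + (- 2) * sqrt (P x * Q x) = (sqrt (P x) - sqrt (Q x))\<^sup>2"
    "P x + Q x + 2 * sqrt (P x * Q x) = (sqrt (P x) + sqrt (Q x))\<^sup>2" for x
    using assms(1,2)[of x] by (simp_all add: power2_eq_square algebra_simps real_sqrt_mult)
  have m: "((\<lambda>x. (sqrt (P x) - sqrt (Q x))\<^sup>2) has_sum (2 - 2 * B)) S"
    and p: "((\<lambda>x. (sqrt (P x) + sqrt (Q x))\<^sup>2) has_sum (2 + 2 * B)) S"
    using h[of "-2"] h[of 2] unfolding sq by (simp_all add: algebra_simps)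
  show "(\<Sum>\<^sub>\<infinity>x\<in>S. \<bar>P x - Q x\<bar>) \<le> 2 * sqrt (1 - B\<^sup>2)"
  proof (rule infsum_le_finite_sums[OF sum])
    fix F assume F: "finite F" "F \<subseteq> S"
    have "(\<Sum>x\<in>F. \<bar>P x - Q x\<bar>) = (\<Sum>x\<in>F. \<bar>sqrt (P x) - sqrt (Q x)\<bar> * \<bar>sqrt (P x) + sqrt (Q x)\<bar>)"
    proof (intro sum.cong refl)
      fix x
      have "P x - Q x = (sqrt (P x) - sqrt (Q x)) * (sqrt (P x) + sqrt (Q x))"
        using assms(1,2)[of x] by (simp add: algebra_simps)
      then show "\<bar>P x - Q x\<bar> = \<bar>sqrt (P x) - sqrt (Q x)\<bar> * \<bar>sqrt (P x) + sqrt (Q x)\<bar>"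
        by (simp only: abs_mult)
    qed
    also have "\<dots> \<le> sqrt (\<Sum>x\<in>F. (sqrt (P x) - sqrt (Q x))\<^sup>2) * sqrt (\<Sum>x\<in>F. (sqrt (P x) + sqrt (Q x))\<^sup>2)"
      using L2_set_mult_ineq[of "\<lambda>x. sqrt (P x) - sqrt (Q x)" "\<lambda>x. sqrt (P x) + sqrt (Q x)" F]
      by (simp add: L2_set_def)
    also have "\<dots> \<le> sqrt (2 - 2 * B) * sqrt (2 + 2 * B)"
      using finite_sum_le_has_sum[OF m F] finite_sum_le_has_sum[OF p F]
        sum_nonneg[of F "\<lambda>x. (sqrt (P x) - sqrt (Q x))\<^sup>2"]
      by (intro mult_mono real_sqrt_le_mono real_sqrt_ge_zero sum_nonneg) auto
    also have "\<dots> = sqrt (2\<^sup>2 * (1 - B\<^sup>2))"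
      unfolding real_sqrt_mult[symmetric] by (simp add: power2_eq_square algebra_simps)
    also have "\<dots> = 2 * sqrt (1 - B\<^sup>2)"
      by (simp only: real_sqrt_mult) simp
    finally show "(\<Sum>x\<in>F. \<bar>P x - Q x\<bar>) \<le> 2 * sqrt (1 - B\<^sup>2)" .
  qed
qed

lemma tensor_thermal_diag:
  assumes "x \<in> fock n" "y \<in> fock n"
  shows "tensor_modes n (\<lambda>_. thermal N) x y = (if x = y then of_real (\<Prod>j<n. therm N (x ! j)) else 0)"
proof (cases "x = y")
  case False
  then obtain j where "j < n" "x ! j \<noteq> y ! j"
    using assms by (auto simp: fock_def list_eq_iff_nth_eq)
  then have "tensor_modes n (\<lambda>_. thermal N) x y = 0"
    unfolding tensor_modes_def by (intro prod_zero) (auto simp: thermal_therm)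
  with False show ?thesis by simp
qed (simp add: tensor_modes_def thermal_therm)

lemma therm_abs_summable: "0 \<le> N \<Longrightarrow> therm N abs_summable_on UNIV"
  and therm_has_sum: "0 \<le> N \<Longrightarrow> (therm N has_sum 1) UNIV"
  using sums_nonneg_imp_has_sum[OF therm_sums[of N] therm_nonneg[of N]]
  by (auto simp: therm_nonneg dest: has_sum_imp_summable)

text \<open>Eve's average is over identical states, so the phases do not matter. The affinity of
  \<open>n\<close> modes is \<beta> to the power \<open>n\<close>, and Bernoulli's inequality bounds
  the defect of its square by \<open>n\<close> times the one-mode defect; this is how
  \<open>sqrt n\<close> enters.\<close>

lemma covert_TMSV:
  assumes \<eta>: "0 < \<eta>" "\<eta> < 1" and N: "0 < N\<^sub>B" and NS: "0 < photons C"
    and "1 \<le> num_msgs C" "1 \<le> num_keys C" and \<delta>: "0 < \<delta>"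
    and bound: "(1 - \<eta>) * photons C * sqrt (real n) \<le> 2 * \<delta> * sqrt (\<eta> * N\<^sub>B * (\<eta> * N\<^sub>B + 1))"
  shows "covert \<eta> N\<^sub>B n \<delta> C"
proof -
  define a b where "a = \<eta> * N\<^sub>B" and "b = \<eta> * N\<^sub>B + (1 - \<eta>) * photons C"
  have ab: "0 < a" "a \<le> b" "0 \<le> b" using \<eta> N NS by (auto simp: a_def b_def)
  define \<beta> where "\<beta> = 1 / (sqrt ((a + 1) * (b + 1)) - sqrt (a * b))"
  let ?P = "\<lambda>x. \<Prod>j<n. therm a (x ! j)" and ?Q = "\<lambda>x. \<Prod>j<n. therm b (x ! j)"
  have eve: "eve_state \<eta> N\<^sub>B n C = tensor_modes n (\<lambda>_. thermal b)"
    using assms by (auto simp: eve_state_def fun_eq_iff alice_state_eq eve_channel_thermal b_def)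
  have idle: "eve_idle_state \<eta> N\<^sub>B n = tensor_modes n (\<lambda>_. thermal a)"
    using eve_channel_thermal[OF \<eta> N order_refl, of n]
    by (simp add: eve_idle_state_def tensor_power_def vacuum_thermal a_def)
  have P: "(?P has_sum 1) (fock n)" and Q: "(?Q has_sum 1) (fock n)"
    using has_sum_prod_fock[of n "\<lambda>_. therm a"] has_sum_prod_fock[of n "\<lambda>_. therm b"] ab
      therm_abs_summable[of a] therm_abs_summable[of b] infsumI[OF therm_has_sum[of a]] infsumI[OF therm_has_sum[of b]]
    by auto
  have B: "((\<lambda>x. sqrt (?P x * ?Q x)) has_sum (\<beta> ^ n)) (fock n)"
  proof -
    note hs = bhattacharyya_therm(1)[OF ab(1,2), folded \<beta>_def]
    have "((\<lambda>x. \<Prod>j<n. sqrt (therm a (x ! j) * therm b (x ! j))) has_sum (\<Prod>j<n. \<Sum>\<^sub>\<infinity>k. sqrt (therm a k * therm b k))) (fock n)"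
      using hs ab by (intro has_sum_prod_fock[of n "\<lambda>_ k. sqrt (therm a k * therm b k)"])
        (auto simp: therm_nonneg dest: has_sum_imp_summable)
    moreover have "sqrt (?P x * ?Q x) = (\<Prod>j<n. sqrt (therm a (x ! j) * therm b (x ! j)))" for x
      unfolding prod.distrib[symmetric] by (induction n) (simp_all add: real_sqrt_mult)
    ultimately show ?thesis by (simp add: infsumI[OF hs])
  qed
  have nn: "0 \<le> ?P x" "0 \<le> ?Q x" for x using ab by (auto intro!: prod_nonneg simp: therm_nonneg)
  note TV = total_variation_le_bhattacharyya[OF nn(2) nn(1) Q P, of "\<beta> ^ n"]
  have B': "((\<lambda>x. sqrt (?Q x * ?P x)) has_sum (\<beta> ^ n)) (fock n)" using B by (simp add: mult.commute)
  have "trace_norm (fock n) (\<lambda>x y. eve_state \<eta> N\<^sub>B n C x y - eve_idle_state \<eta> N\<^sub>B n x y)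
      = (\<Sum>\<^sub>\<infinity>x\<in>fock n. \<bar>?Q x - ?P x\<bar>)"
    unfolding eve idle by (rule trace_norm_diagonal) (use TV(1)[OF B'] in \<open>auto simp: tensor_thermal_diag\<close>)
  also have "\<dots> \<le> 2 * sqrt (1 - (\<beta> ^ n)\<^sup>2)" by (rule TV(2)[OF B'])
  also have "1 - (\<beta> ^ n)\<^sup>2 \<le> real n * ((b - a)\<^sup>2 / (4 * (a * (a + 1))))"
  proof -
    have "1 + real n * (\<beta>\<^sup>2 - 1) \<le> (1 + (\<beta>\<^sup>2 - 1)) ^ n"
      by (rule Bernoulli_inequality) simp
    moreover have "real n * (1 - \<beta>\<^sup>2) \<le> real n * ((b - a)\<^sup>2 / (4 * (a * (a + 1))))"
      using bhattacharyya_therm(2)[OF ab(1,2), folded \<beta>_def] by (intro mult_left_mono) auto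
    moreover have "(\<beta> ^ n)\<^sup>2 = (\<beta>\<^sup>2) ^ n"
      by (simp only: power_mult[symmetric] mult.commute)
    ultimately show ?thesis by (simp add: right_diff_distrib)
  qed
  also have "sqrt (real n * ((b - a)\<^sup>2 / (4 * (a * (a + 1))))) \<le> \<delta>"
  proof -
    have "(b - a) * sqrt (real n) \<le> 2 * \<delta> * sqrt (a * (a + 1))"
      using bound by (simp add: a_def b_def)
    moreover have "0 \<le> (b - a) * sqrt (real n)" using ab by simp
    ultimately have "((b - a) * sqrt (real n))\<^sup>2 \<le> (2 * \<delta> * sqrt (a * (a + 1)))\<^sup>2"
      by (intro power_mono)
    then have "real n * (b - a)\<^sup>2 \<le> \<delta>\<^sup>2 * (4 * (a * (a + 1)))"
      using ab by (simp add: power_mult_distrib mult_ac)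
    then have "real n * ((b - a)\<^sup>2 / (4 * (a * (a + 1)))) \<le> \<delta>\<^sup>2"
      using ab by (simp add: divide_le_eq)
    then show ?thesis using \<delta> by (simp add: real_le_lsqrt)
  qed
  finally show ?thesis unfolding covert_def by simp
qed

section \<open>Codebook for the block channel: Chernoff bound and greedy choice\<close>

section \<open>Random coding for an erasure channel\<close>

definition agreement :: "nat \<Rightarrow> (nat \<Rightarrow> nat) \<Rightarrow> (nat \<Rightarrow> nat) \<Rightarrow> nat" where
  "agreement N c y = card {b. b < N \<and> y b = c b}"

lemma power_agreement:
  fixes z :: "'a :: comm_semiring_1"
  shows "(\<Prod>b<N. if y b = c b then z else 1) = z ^ agreement N c y"
proof -
  have "{b. b < N \<and> y b = c b} = {..<N} \<inter> {b. y b = c b}" by auto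
  then show ?thesis
    unfolding agreement_def by (simp add: prod.If_cases)
qed

text \<open>Inputs are symbols \<open>m < A\<close>; an output is a symbol or the erasure \<open>A\<close>.\<close>

locale symbol_channel =
  fixes A :: nat and Q :: "nat \<Rightarrow> nat \<Rightarrow> real" and s :: real
  assumes A: "0 < A" and Q_nonneg: "\<And>m y. m < A \<Longrightarrow> y \<le> A \<Longrightarrow> 0 \<le> Q m y"
    and Q_sum: "\<And>m. m < A \<Longrightarrow> (\<Sum>y\<le>A. Q m y) = 1" and Q_diag: "\<And>m. m < A \<Longrightarrow> s \<le> Q m m"
begin

definition inputs :: "nat \<Rightarrow> (nat \<Rightarrow> nat) set" where
  "inputs N = PiE {..<N} (\<lambda>_. {..<A})"

definition outputs :: "nat \<Rightarrow> (nat \<Rightarrow> nat) set" where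
  "outputs N = PiE {..<N} (\<lambda>_. {..A})"

definition prob_seq :: "nat \<Rightarrow> (nat \<Rightarrow> nat) \<Rightarrow> (nat \<Rightarrow> nat) \<Rightarrow> real" where
  "prob_seq N c y = (\<Prod>b<N. Q (c b) (y b))"

lemma finite_inputs: "finite (inputs N)" and finite_outputs: "finite (outputs N)"
  by (auto simp: inputs_def outputs_def intro: finite_PiE)

lemma inputs_less: "c \<in> inputs N \<Longrightarrow> b < N \<Longrightarrow> c b < A"
  and outputs_le: "y \<in> outputs N \<Longrightarrow> b < N \<Longrightarrow> y b \<le> A"
  by (auto simp: inputs_def outputs_def PiE_def Pi_def)

lemma card_inputs: "card (inputs N) = A ^ N"
  by (simp add: inputs_def card_PiE)

lemma inputs_nonempty: "inputs N \<noteq> {}"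
  using card_inputs[of N] A by auto

lemma prob_seq_nonneg: "c \<in> inputs N \<Longrightarrow> y \<in> outputs N \<Longrightarrow> 0 \<le> prob_seq N c y"
  unfolding prob_seq_def by (intro prod_nonneg ballI Q_nonneg) (auto simp: inputs_less outputs_le)

lemma sum_outputs_prod:
  fixes f :: "nat \<Rightarrow> nat \<Rightarrow> 'a :: comm_semiring_1"
  shows "(\<Sum>y\<in>outputs N. \<Prod>b<N. f b (y b)) = (\<Prod>b<N. \<Sum>a\<le>A. f b a)"
  unfolding outputs_def by (rule prod_sum_PiE[symmetric]) auto

lemma sum_prob_seq: "c \<in> inputs N \<Longrightarrow> (\<Sum>y\<in>outputs N. prob_seq N c y) = 1"
  unfolding prob_seq_def sum_outputs_prod[where f = "\<lambda>b a. Q (c b) a"] by (simp add: Q_sum inputs_less)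

text \<open>Chernoff bound: the event of too few agreements is dominated by
  \<open>exp (\<kappa> * (t - agreement))\<close>, whose mean factorises over positions, each factor
  being controlled through \<open>s\<close>.\<close>

lemma miss_probability:
  assumes c: "c \<in> inputs N" and \<kappa>: "0 \<le> \<kappa>"
  shows "(\<Sum>y\<in>outputs N. if real (agreement N c y) < t then prob_seq N c y else 0)
    \<le> exp (\<kappa> * t - real N * s * (1 - exp (- \<kappa>)))"
proof -
  have "(\<Sum>y\<in>outputs N. if real (agreement N c y) < t then prob_seq N c y else 0)
      \<le> (\<Sum>y\<in>outputs N. exp (\<kappa> * t) * (\<Prod>b<N. Q (c b) (y b) * (if y b = c b then exp (- \<kappa>) else 1)))"
  proof (intro sum_mono)
    fix y assume y: "y \<in> outputs N"
    have "exp (\<kappa> * t) * (\<Prod>b<N. Q (c b) (y b) * (if y b = c b then exp (- \<kappa>) else 1))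
        = prob_seq N c y * exp (\<kappa> * (t - real (agreement N c y)))"
      unfolding prod.distrib power_agreement prob_seq_def
      using exp_of_nat_mult[of "agreement N c y" "- \<kappa>"]
      by (simp add: right_diff_distrib exp_diff exp_minus divide_inverse mult_ac)
    moreover have "1 \<le> exp (\<kappa> * (t - real (agreement N c y)))" if "real (agreement N c y) < t"
      using that \<kappa> by simp
    ultimately show "(if real (agreement N c y) < t then prob_seq N c y else 0)
        \<le> exp (\<kappa> * t) * (\<Prod>b<N. Q (c b) (y b) * (if y b = c b then exp (- \<kappa>) else 1))"
      using prob_seq_nonneg[OF c y] mult_left_mono[of 1 "exp (\<kappa> * (t - real (agreement N c y)))" "prob_seq N c y"]
      by auto
  qed
  also have "\<dots> = exp (\<kappa> * t) * (\<Prod>b<N. \<Sum>a\<le>A. Q (c b) a * (if a = c b then exp (- \<kappa>) else 1))"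
    unfolding sum_distrib_left[symmetric]
      sum_outputs_prod[where f = "\<lambda>b a. Q (c b) a * (if a = c b then exp (- \<kappa>) else 1)"] ..
  also have "\<dots> \<le> exp (\<kappa> * t) * (\<Prod>b<N. exp (- (s * (1 - exp (- \<kappa>)))))"
  proof (intro mult_left_mono prod_mono conjI)
    fix b assume b: "b \<in> {..<N}"
    then have cb: "c b < A" using c by (simp add: inputs_less)
    show "0 \<le> (\<Sum>a\<le>A. Q (c b) a * (if a = c b then exp (- \<kappa>) else 1))"
      by (intro sum_nonneg) (use cb Q_nonneg in auto)
    have "(\<Sum>a\<le>A. Q (c b) a * (if a = c b then exp (- \<kappa>) else 1))
        = (\<Sum>a\<le>A. Q (c b) a - (if a = c b then Q (c b) (c b) * (1 - exp (- \<kappa>)) else 0))"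
      by (intro sum.cong) (auto simp: algebra_simps)
    also have "\<dots> = 1 - Q (c b) (c b) * (1 - exp (- \<kappa>))"
      using cb by (simp add: sum_subtractf Q_sum)
    also have "\<dots> \<le> 1 - s * (1 - exp (- \<kappa>))"
      using Q_diag[OF cb] \<kappa> by (simp add: mult_right_mono)
    also have "\<dots> \<le> exp (- (s * (1 - exp (- \<kappa>))))"
      using exp_ge_add_one_self[of "- (s * (1 - exp (- \<kappa>)))"] by simp
    finally show "(\<Sum>a\<le>A. Q (c b) a * (if a = c b then exp (- \<kappa>) else 1)) \<le> exp (- (s * (1 - exp (- \<kappa>))))" .
  qed auto
  also have "\<dots> = exp (\<kappa> * t - real N * s * (1 - exp (- \<kappa>)))"
    by (simp add: exp_of_nat_mult[symmetric] exp_add[symmetric] mult.assoc)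
  finally show ?thesis .
qed

definition confusion :: "nat \<Rightarrow> real \<Rightarrow> (nat \<Rightarrow> nat) \<Rightarrow> (nat \<Rightarrow> nat) \<Rightarrow> real" where
  "confusion N t c c' = (\<Sum>y\<in>outputs N. if t \<le> real (agreement N c' y) then prob_seq N c y else 0)"

text \<open>Markov's inequality for \<open>A ^ agreement\<close>, whose mean over uniform \<open>c'\<close> is at most \<open>2 ^ N\<close>.\<close>

lemma sum_confusion_le:
  assumes c: "c \<in> inputs N"
  shows "(\<Sum>c'\<in>inputs N. confusion N t c c') \<le> 2 ^ N * real A powr (- t) * real (card (inputs N))"
proof -
  have cnt: "(\<Sum>c'\<in>inputs N. if t \<le> real (agreement N c' y) then 1 else 0) \<le> 2 ^ N * real A powr (- t) * real A ^ N" for y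
  proof -
    have "(\<Sum>c'\<in>inputs N. if t \<le> real (agreement N c' y) then 1 else 0)
        \<le> (\<Sum>c'\<in>inputs N. real A powr (- t) * (\<Prod>b<N. if y b = c' b then real A else 1))"
    proof (intro sum_mono)
      fix c'
      have "real A powr (- t) * real A ^ agreement N c' y = real A powr (real (agreement N c' y) - t)"
        using A by (simp add: powr_diff powr_realpow powr_minus divide_inverse)
      moreover have "1 \<le> real A powr (real (agreement N c' y) - t)" if "t \<le> real (agreement N c' y)"
        using that A by (intro ge_one_powr_ge_zero) auto
      ultimately show "(if t \<le> real (agreement N c' y) then 1 else 0)
          \<le> real A powr (- t) * (\<Prod>b<N. if y b = c' b then real A else 1)"
        unfolding power_agreement by auto
    qed
    also have "\<dots> = real A powr (- t) * (\<Prod>b<N. \<Sum>a<A. if y b = a then real A else 1)"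
      unfolding sum_distrib_left[symmetric] inputs_def by (subst prod_sum_PiE) auto
    also have "\<dots> \<le> real A powr (- t) * (\<Prod>b<N. 2 * real A)"
    proof (intro mult_left_mono prod_mono conjI sum_nonneg)
      fix b
      \<comment> \<open>At most one symbol matches \<open>y b\<close>, and none does if
        \<open>y b\<close> is the erasure \<open>A\<close>.\<close>
      have "(\<Sum>a<A. if y b = a then real A else 1) \<le> (\<Sum>a<A. (if y b = a then real A else 0) + 1)"
        by (intro sum_mono) auto
      also have "\<dots> \<le> real A + real A" by (simp add: sum.distrib)
      finally show "(\<Sum>a<A. if y b = a then real A else 1) \<le> 2 * real A" by simp
    qed auto
    finally show ?thesis by (simp add: power_mult_distrib mult_ac)
  qed
  have "(\<Sum>c'\<in>inputs N. confusion N t c c') =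
      (\<Sum>y\<in>outputs N. prob_seq N c y * (\<Sum>c'\<in>inputs N. if t \<le> real (agreement N c' y) then 1 else 0))"
    unfolding confusion_def by (subst sum.swap) (auto simp: sum_distrib_left intro!: sum.cong)
  also have "\<dots> \<le> (\<Sum>y\<in>outputs N. prob_seq N c y * (2 ^ N * real A powr (- t) * real A ^ N))"
    by (intro sum_mono mult_left_mono cnt prob_seq_nonneg c)
  also have "\<dots> = 2 ^ N * real A powr (- t) * real (card (inputs N))"
    by (simp add: sum_distrib_right[symmetric] sum_prob_seq[OF c] card_inputs)
  finally show ?thesis .
qed

text \<open>By averaging over \<open>c'\<close>, some new codeword attracts confusion of at most
  \<open>M * \<zeta> N t\<close> in total from all earlier ones. Only pairs whose sent word comes
  first are counted, and the induction closes by
  \<open>M\<^sup>2 + M \<le> (M + 1)\<^sup>2\<close>.\<close>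

lemma greedy_codebook:
  defines "\<zeta> N t \<equiv> 2 ^ N * real A powr (- t)"
  shows "\<exists>cs. (\<forall>w. cs w \<in> inputs N) \<and>
    (\<Sum>w'\<in>{1..M}. \<Sum>w\<in>{1..<w'}. confusion N t (cs w) (cs w')) \<le> real M * real M * \<zeta> N t"
proof (induction M)
  case 0
  from inputs_nonempty obtain c where "c \<in> inputs N" by blast
  then show ?case by (intro exI[of _ "\<lambda>_. c"]) auto
next
  case (Suc M)
  then obtain cs where cs: "\<forall>w. cs w \<in> inputs N"
    "(\<Sum>w'\<in>{1..M}. \<Sum>w\<in>{1..<w'}. confusion N t (cs w) (cs w')) \<le> real M * real M * \<zeta> N t" by blast
  have "\<exists>c\<in>inputs N. (\<Sum>w\<in>{1..M}. confusion N t (cs w) c) \<le> real M * \<zeta> N t"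
  proof (rule ccontr)
    assume "\<not> ?thesis"
    then have "(\<Sum>c\<in>inputs N. real M * \<zeta> N t) < (\<Sum>c\<in>inputs N. \<Sum>w\<in>{1..M}. confusion N t (cs w) c)"
      using inputs_nonempty finite_inputs by (intro sum_strict_mono) (auto simp: not_le)
    also have "\<dots> = (\<Sum>w\<in>{1..M}. \<Sum>c\<in>inputs N. confusion N t (cs w) c)"
      by (rule sum.swap)
    also have "\<dots> \<le> (\<Sum>w\<in>{1..M}. \<zeta> N t * real (card (inputs N)))"
      unfolding \<zeta>_def by (intro sum_mono sum_confusion_le) (use cs in blast)
    finally show False by simp
  qed
  then obtain c where c: "c \<in> inputs N" "(\<Sum>w\<in>{1..M}. confusion N t (cs w) c) \<le> real M * \<zeta> N t" by blast
  define ds where "ds = cs(Suc M := c)"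
  have "(\<Sum>w'\<in>{1..Suc M}. \<Sum>w\<in>{1..<w'}. confusion N t (ds w) (ds w')) =
      (\<Sum>w'\<in>{1..M}. \<Sum>w\<in>{1..<w'}. confusion N t (ds w) (ds w')) + (\<Sum>w\<in>{1..<Suc M}. confusion N t (ds w) (ds (Suc M)))"
    by simp
  also have "(\<Sum>w'\<in>{1..M}. \<Sum>w\<in>{1..<w'}. confusion N t (ds w) (ds w')) = (\<Sum>w'\<in>{1..M}. \<Sum>w\<in>{1..<w'}. confusion N t (cs w) (cs w'))"
    by (intro sum.cong) (auto simp: ds_def)
  also have "(\<Sum>w\<in>{1..<Suc M}. confusion N t (ds w) (ds (Suc M))) = (\<Sum>w\<in>{1..M}. confusion N t (cs w) c)"
    by (intro sum.cong) (auto simp: ds_def)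
  also have "(\<Sum>w'\<in>{1..M}. \<Sum>w\<in>{1..<w'}. confusion N t (cs w) (cs w')) + (\<Sum>w\<in>{1..M}. confusion N t (cs w) c)
      \<le> real M * real M * \<zeta> N t + real M * \<zeta> N t"
    using cs(2) c(2) by (rule add_mono)
  also have "\<dots> \<le> real (Suc M) * real (Suc M) * \<zeta> N t"
    by (simp add: \<zeta>_def algebra_simps)
  finally show ?case using cs(1) c(1) by (intro exI[of _ ds]) (auto simp: ds_def)
qed

text \<open>The decoder returns the largest message whose codeword agrees with the output in at least
  \<open>t\<close> places, so that only later codewords can spoil an earlier one; this is what the greedy choice
  controls.\<close>

lemma coding:
  assumes M: "1 \<le> M" and \<kappa>: "0 \<le> \<kappa>"
  shows "\<exists>cs dec. (\<forall>w. cs w \<in> inputs N) \<and> (\<forall>y. dec y \<in> {1..M}) \<and>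
    (\<Sum>w\<in>{1..M}. \<Sum>y\<in>outputs N. if dec y \<noteq> w then prob_seq N (cs w) y else 0) / real M
      \<le> exp (\<kappa> * t - real N * s * (1 - exp (- \<kappa>))) + real M * (2 ^ N * real A powr (- t))"
proof -
  obtain cs where cs: "\<And>w. cs w \<in> inputs N"
    and conf: "(\<Sum>w'\<in>{1..M}. \<Sum>w\<in>{1..<w'}. confusion N t (cs w) (cs w')) \<le> real M * real M * (2 ^ N * real A powr (- t))"
    using greedy_codebook[where N = N and M = M and t = t] by blast
  define V where "V y = {w \<in> {1..M}. t \<le> real (agreement N (cs w) y)}" for y
  define dec where "dec y = (if V y = {} then 1 else Max (V y))" for y
  have fin: "finite (V y)" and sub: "V y \<subseteq> {1..M}" for y by (auto simp: V_def)
  have dec: "dec y \<in> {1..M}" for y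
    using subsetD[OF sub[of y] Max_in[OF fin, of y]] M by (auto simp: dec_def)
  let ?miss = "\<lambda>w. \<Sum>y\<in>outputs N. if real (agreement N (cs w) y) < t then prob_seq N (cs w) y else 0"
  have "(\<Sum>y\<in>outputs N. if dec y \<noteq> w then prob_seq N (cs w) y else 0) \<le>
      ?miss w + (\<Sum>w'\<in>{1..M}. if w < w' then confusion N t (cs w) (cs w') else 0)" if w: "w \<in> {1..M}" for w
  proof -
    let ?ind = "\<lambda>w' y. if w < w' \<and> t \<le> real (agreement N (cs w') y) then prob_seq N (cs w) y else 0"
    have "(\<Sum>y\<in>outputs N. if dec y \<noteq> w then prob_seq N (cs w) y else 0) \<le>
        (\<Sum>y\<in>outputs N. (if real (agreement N (cs w) y) < t then prob_seq N (cs w) y else 0) + (\<Sum>w'\<in>{1..M}. ?ind w' y))"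
    proof (intro sum_mono)
      fix y assume "y \<in> outputs N"
      then have p: "0 \<le> prob_seq N (cs w) y" by (intro prob_seq_nonneg cs)
      then have nn: "0 \<le> (\<Sum>w'\<in>{1..M}. ?ind w' y)" by (intro sum_nonneg) auto
      show "(if dec y \<noteq> w then prob_seq N (cs w) y else 0) \<le>
        (if real (agreement N (cs w) y) < t then prob_seq N (cs w) y else 0) + (\<Sum>w'\<in>{1..M}. ?ind w' y)"
      proof (cases "dec y \<noteq> w \<and> t \<le> real (agreement N (cs w) y)")
        \<comment> \<open>The sent word passes the test, so a wrong decision is a later message that
          passes as well.\<close>
        case True
        then have wV: "w \<in> V y" using w by (simp add: V_def)
        then have d: "dec y = Max (V y)" by (auto simp: dec_def)
        then have "w < dec y" using True Max_ge[OF fin wV] by simp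
        moreover have "dec y \<in> V y" unfolding d using wV fin by (intro Max_in) auto
        ultimately have "?ind (dec y) y = prob_seq N (cs w) y" "dec y \<in> {1..M}" by (auto simp: V_def)
        then have "prob_seq N (cs w) y \<le> (\<Sum>w'\<in>{1..M}. ?ind w' y)"
          using member_le_sum[of "dec y" "{1..M}" "\<lambda>w'. ?ind w' y"] p by auto
        then show ?thesis using p by auto
      qed (use p nn in auto)
    qed
    also have "\<dots> = ?miss w + (\<Sum>w'\<in>{1..M}. \<Sum>y\<in>outputs N. ?ind w' y)"
      unfolding sum.distrib by (subst sum.swap[of _ "{1..M}"]) simp
    also have "(\<Sum>w'\<in>{1..M}. \<Sum>y\<in>outputs N. ?ind w' y) = (\<Sum>w'\<in>{1..M}. if w < w' then confusion N t (cs w) (cs w') else 0)"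
      unfolding confusion_def by (intro sum.cong) auto
    finally show ?thesis .
  qed
  then have "(\<Sum>w\<in>{1..M}. \<Sum>y\<in>outputs N. if dec y \<noteq> w then prob_seq N (cs w) y else 0) \<le>
      (\<Sum>w\<in>{1..M}. ?miss w + (\<Sum>w'\<in>{1..M}. if w < w' then confusion N t (cs w) (cs w') else 0))"
    by (intro sum_mono)
  also have "\<dots> = (\<Sum>w\<in>{1..M}. ?miss w) + (\<Sum>w'\<in>{1..M}. \<Sum>w\<in>{1..<w'}. confusion N t (cs w) (cs w'))"
  proof -
    have "(\<Sum>w\<in>{1..M}. \<Sum>w'\<in>{1..M}. if w < w' then confusion N t (cs w) (cs w') else 0) =
        (\<Sum>w'\<in>{1..M}. \<Sum>w\<in>{1..M}. if w < w' then confusion N t (cs w) (cs w') else 0)"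
      by (rule sum.swap)
    also have "\<dots> = (\<Sum>w'\<in>{1..M}. \<Sum>w\<in>{1..<w'}. confusion N t (cs w) (cs w'))"
      by (intro sum.cong refl sum.mono_neutral_cong_right) auto
    finally show ?thesis by (simp add: sum.distrib)
  qed
  also have "\<dots> \<le> (\<Sum>w\<in>{1..M}. exp (\<kappa> * t - real N * s * (1 - exp (- \<kappa>)))) + real M * real M * (2 ^ N * real A powr (- t))"
    by (intro add_mono sum_mono miss_probability cs \<kappa> conf)
  also have "\<dots> = real M * (exp (\<kappa> * t - real N * s * (1 - exp (- \<kappa>))) + real M * (2 ^ N * real A powr (- t)))"
    by (simp add: distrib_left)
  finally have "(\<Sum>w\<in>{1..M}. \<Sum>y\<in>outputs N. if dec y \<noteq> w then prob_seq N (cs w) y else 0) / real M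
      \<le> exp (\<kappa> * t - real N * s * (1 - exp (- \<kappa>))) + real M * (2 ^ N * real A powr (- t))"
    using M by (simp add: divide_le_eq mult.commute)
  with cs dec show ?thesis by blast
qed

end

section \<open>Closure properties of positive operators\<close>

section \<open>Positive operators\<close>

lemma op_pos_subset: "op_pos S A \<Longrightarrow> T \<subseteq> S \<Longrightarrow> op_pos T A"
  unfolding op_pos_def by blast

lemma op_pos_rank1: "op_pos S (\<lambda>x y. f x * cnj (f y))"
  unfolding op_pos_def
proof (intro allI impI)
  fix F v
  have "op_form F (\<lambda>x y. f x * cnj (f y)) v v = (\<Sum>x\<in>F. cnj (v x) * f x) * cnj (\<Sum>x\<in>F. cnj (v x) * f x)"
    by (simp add: op_form_def sum_product cnj_sum mult_ac)
  also have "\<dots> = of_real ((cmod (\<Sum>x\<in>F. cnj (v x) * f x))\<^sup>2)"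
    by (simp only: complex_norm_square)
  finally show "Im (op_form F (\<lambda>x y. f x * cnj (f y)) v v) = 0 \<and> 0 \<le> Re (op_form F (\<lambda>x y. f x * cnj (f y)) v v)"
    by simp
qed

lemma op_pos_scale:
  assumes "op_pos S A" "0 \<le> c"
  shows "op_pos S (\<lambda>x y. of_real c * A x y)"
proof -
  have "op_form F (\<lambda>x y. of_real c * A x y) v v = of_real c * op_form F A v v" for F v
    by (simp add: op_form_def sum_distrib_left mult_ac)
  then show ?thesis using assms by (simp add: op_pos_def)
qed

lemma op_form_sum: "op_form F (\<lambda>x y. \<Sum>k\<in>I. A k x y) u v = (\<Sum>k\<in>I. op_form F (A k) u v)"
proof -
  have "op_form F (\<lambda>x y. \<Sum>k\<in>I. A k x y) u v = (\<Sum>x\<in>F. \<Sum>y\<in>F. \<Sum>k\<in>I. cnj (u x) * A k x y * v y)"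
    by (simp add: op_form_def sum_distrib_left sum_distrib_right)
  also have "\<dots> = (\<Sum>x\<in>F. \<Sum>k\<in>I. \<Sum>y\<in>F. cnj (u x) * A k x y * v y)"
    by (intro sum.cong refl sum.swap)
  also have "\<dots> = (\<Sum>k\<in>I. \<Sum>x\<in>F. \<Sum>y\<in>F. cnj (u x) * A k x y * v y)"
    by (rule sum.swap)
  finally show ?thesis by (simp add: op_form_def)
qed

lemma op_pos_sum:
  assumes "\<And>k. k \<in> I \<Longrightarrow> op_pos S (A k)"
  shows "op_pos S (\<lambda>x y. \<Sum>k\<in>I. A k x y)"
  using assms unfolding op_pos_def op_form_sum by (auto simp: Im_sum Re_sum intro!: sum_nonneg)

lemma has_sum_finite_sum:
  fixes f :: "'k \<Rightarrow> 'a \<Rightarrow> 'b :: topological_comm_monoid_add"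
  assumes "finite I" "\<And>k. k \<in> I \<Longrightarrow> (f k has_sum s k) A"
  shows "((\<lambda>x. \<Sum>k\<in>I. f k x) has_sum (\<Sum>k\<in>I. s k)) A"
  using assms by (induction I rule: finite_induct) (auto intro: has_sum_add)

text \<open>Positivity is tested on finitely many indices at a time, so entrywise convergence is
  enough.\<close>

lemma op_pos_infsum:
  assumes "\<And>k. k \<in> I \<Longrightarrow> op_pos S (A k)"
    and "\<And>x y. x \<in> S \<Longrightarrow> y \<in> S \<Longrightarrow> ((\<lambda>k. A k x y) has_sum B x y) I"
  shows "op_pos S B"
  unfolding op_pos_def
proof (intro allI impI)
  fix F v assume F: "finite F \<and> F \<subseteq> S"
  have h: "((\<lambda>k. op_form F (A k) v v) has_sum op_form F B v v) I"
    unfolding op_form_def using F assms(2)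
    by (intro has_sum_finite_sum has_sum_cmult_left has_sum_cmult_right) auto
  have "Im (op_form F (A k) v v) = 0" "0 \<le> Re (op_form F (A k) v v)" if "k \<in> I" for k
    using assms(1)[OF that] F by (auto simp: op_pos_def)
  then show "Im (op_form F B v v) = 0 \<and> 0 \<le> Re (op_form F B v v)"
    using has_sum_Im[OF h] has_sum_Re[OF h] has_sum_nonneg[OF has_sum_Re[OF h]]
    by (metis (no_types, lifting) has_sum_0 has_sum_unique)
qed

lemma op_pos_transpose:
  assumes "op_pos S A"
  shows "op_pos S (\<lambda>x y. A y x)"
proof -
  have "op_form F (\<lambda>x y. A y x) v v = op_form F A (\<lambda>x. cnj (v x)) (\<lambda>x. cnj (v x))" for F v
    unfolding op_form_def by (subst sum.swap) (simp add: mult_ac)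
  then show ?thesis using assms by (simp add: op_pos_def)
qed

text \<open>The test vector is summed over the fibres of \<open>p\<close>, so \<open>p\<close> may
  fail to be injective. In this way a factor on one mode or one block is seen as an operator on the
  whole index set.\<close>

lemma op_pos_pullback:
  assumes "op_pos T A" "p ` S \<subseteq> T"
  shows "op_pos S (\<lambda>x y. A (p x) (p y))"
proof -
  have "op_form F (\<lambda>x y. A (p x) (p y)) v v =
      op_form (p ` F) A (\<lambda>t. \<Sum>x\<in>{x \<in> F. p x = t}. v x) (\<lambda>t. \<Sum>x\<in>{x \<in> F. p x = t}. v x)"
    if F: "finite F" for F v
  proof -
    let ?w = "\<lambda>t. \<Sum>x\<in>{x \<in> F. p x = t}. v x"
    have inner: "(\<Sum>y\<in>F. g (p y) * v y) = (\<Sum>t\<in>p ` F. g t * ?w t)" for g :: "'a \<Rightarrow> complex"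
      by (subst sum.image_gen[OF F, of _ p]) (auto simp: sum_distrib_left intro!: sum.cong)
    have inner': "(\<Sum>y\<in>F. cnj (v y) * g (p y)) = (\<Sum>t\<in>p ` F. cnj (?w t) * g t)" for g :: "'a \<Rightarrow> complex"
      by (subst sum.image_gen[OF F, of _ p]) (auto simp: sum_distrib_right intro!: sum.cong)
    have "op_form F (\<lambda>x y. A (p x) (p y)) v v = (\<Sum>x\<in>F. cnj (v x) * (\<Sum>y\<in>F. A (p x) (p y) * v y))"
      by (simp add: op_form_def sum_distrib_left mult.assoc)
    also have "\<dots> = (\<Sum>x\<in>F. cnj (v x) * (\<Sum>t\<in>p ` F. A (p x) t * ?w t))"
      by (simp only: inner)
    also have "\<dots> = (\<Sum>s\<in>p ` F. cnj (?w s) * (\<Sum>t\<in>p ` F. A s t * ?w t))"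
      by (rule inner')
    finally show ?thesis
      by (simp add: op_form_def sum_distrib_left mult.assoc)
  qed
  note form = this
  show ?thesis
    unfolding op_pos_def
  proof (intro allI impI)
    fix F v assume F: "finite F \<and> F \<subseteq> S"
    then have "finite (p ` F) \<and> p ` F \<subseteq> T" using assms(2) by auto
    with assms(1) F show "Im (op_form F (\<lambda>x y. A (p x) (p y)) v v) = 0 \<and> 0 \<le> Re (op_form F (\<lambda>x y. A (p x) (p y)) v v)"
      by (simp add: op_pos_def form)
  qed
qed

lemma op_pos_zero_row:
  assumes pos: "op_pos S A" and xy: "x \<in> S" "y \<in> S" and 0: "A x x = 0"
  shows "A x y = 0"
proof (cases "x = y")
  case False
  have *: "- (2 * T) * (cmod (A x y))\<^sup>2 + Re (A y y) \<ge> 0" for T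
  proof -
    let ?u = "\<lambda>z. if z = x then - of_real T * A x y else if z = y then 1 else 0"
    have "0 \<le> Re (op_form {x, y} A ?u ?u)"
      using pos xy by (auto simp: op_pos_def)
    also have "op_form {x, y} A ?u ?u = - of_real (2 * T) * (A x y * cnj (A x y)) + A y y"
      using False 0 op_pos_hermitian[OF pos xy] by (subst op_form_diag2) (auto simp: algebra_simps)
    also have "Re \<dots> = - (2 * T) * (cmod (A x y))\<^sup>2 + Re (A y y)"
      by (simp add: complex_norm_square[symmetric] del: of_real_power)
    finally show ?thesis .
  qed
  show ?thesis
  proof (rule ccontr)
    assume "A x y \<noteq> 0"
    then have "0 < (cmod (A x y))\<^sup>2" by simp
    \<comment> \<open>This \<open>T\<close> makes the form equal to -1.\<close>
    with *[of "(1 + Re (A y y)) / (2 * (cmod (A x y))\<^sup>2)"] show False by simp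
  qed
qed (use 0 in simp)

text \<open>The test vector spans the kernel direction of the first row of the minor. Later this
  bounds a population from below by a coherence.\<close>

lemma op_pos_minor:
  assumes pos: "op_pos S A" and xy: "x \<in> S" "y \<in> S"
  shows "(cmod (A x y))\<^sup>2 \<le> Re (A x x) * Re (A y y)"
proof (cases "A x x = 0")
  case True
  then show ?thesis using op_pos_zero_row[OF pos xy] by simp
next
  case False
  define r where "r = Re (A x x)"
  have Axx: "A x x = of_real r" using op_pos_diag[OF pos xy(1)] by (simp add: r_def complex_eq_iff)
  have "r \<noteq> 0" using False Axx by auto
  then have r: "0 < r" using op_pos_diag(2)[OF pos xy(1)] by (simp add: r_def)
  show ?thesis
  proof (cases "x = y")
    case True
    then show ?thesis using Axx r by (simp add: power2_eq_square)
  next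
    case False
    let ?u = "\<lambda>z. if z = x then - A x y else if z = y then A x x else 0"
    have "0 \<le> Re (op_form {x, y} A ?u ?u)"
      using pos xy by (auto simp: op_pos_def)
    also have "op_form {x, y} A ?u ?u = of_real r * (of_real r * A y y - A x y * cnj (A x y))"
      using False op_pos_hermitian[OF pos xy] by (subst op_form_diag2) (auto simp: Axx algebra_simps)
    also have "Re \<dots> = r * (r * Re (A y y) - (cmod (A x y))\<^sup>2)"
      by (simp add: complex_norm_square[symmetric] del: of_real_power)
    finally show ?thesis using r by (simp add: zero_le_mult_iff Axx)
  qed
qed

text \<open>Cholesky decomposition, by taking Schur complements.\<close>

lemma op_pos_gram:
  assumes "finite F" "op_pos F A"
  shows "\<exists>v. \<forall>x\<in>F. \<forall>y\<in>F. A x y = (\<Sum>k\<in>F. v k x * cnj (v k y))"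
  using assms
proof (induction F arbitrary: A rule: finite_induct)
  case (insert a F)
  let ?G = "insert a F"
  note pos = insert.prems
  show ?case
  proof (cases "A a a = 0")
    case True
    have row: "A a y = 0" "A y a = 0" if "y \<in> ?G" for y
      using op_pos_zero_row[OF pos _ that True] op_pos_hermitian[OF pos, of a y] that by auto
    obtain v where v: "\<forall>x\<in>F. \<forall>y\<in>F. A x y = (\<Sum>k\<in>F. v k x * cnj (v k y))"
      using insert.IH op_pos_subset[OF pos] by blast
    define v' where "v' k x = (if k = a \<or> x = a then 0 else v k x)" for k x
    have "A x y = (\<Sum>k\<in>?G. v' k x * cnj (v' k y))" if "x \<in> ?G" "y \<in> ?G" for x y
    proof -
      have "(\<Sum>k\<in>?G. v' k x * cnj (v' k y)) = (\<Sum>k\<in>F. v' k x * cnj (v' k y))"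
        using insert.hyps by (simp add: v'_def)
      also have "\<dots> = (\<Sum>k\<in>F. if x = a \<or> y = a then 0 else v k x * cnj (v k y))"
        using insert.hyps by (intro sum.cong) (auto simp: v'_def)
      finally show ?thesis using that v row by (cases "x = a \<or> y = a") auto
    qed
    then show ?thesis by blast
  next
    case False
    define r where "r = Re (A a a)"
    have Aaa: "A a a = of_real r" using op_pos_diag[OF pos] by (simp add: r_def complex_eq_iff)
    have "r \<noteq> 0" using False Aaa by auto
    then have r: "0 < r" using op_pos_diag(2)[OF pos, of a] by (simp add: r_def)
    have herm: "A x a = cnj (A a x)" if "x \<in> ?G" for x
      using op_pos_hermitian[OF pos, of a x] that by simp
    define A' where "A' x y = A x y - A x a * A a y / of_real r" for x y
    have "op_pos F A'"
      unfolding op_pos_def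
    proof (intro allI impI)
      fix H u assume H: "finite H \<and> H \<subseteq> F"
      then have aH: "a \<notin> H" using insert.hyps by blast
      define z where "z = (\<Sum>y\<in>H. A a y * u y)"
      \<comment> \<open>The entry at \<open>a\<close> completes the square, so the form of
        \<open>A\<close> at \<open>w\<close> is the form of the Schur complement at
        \<open>u\<close>.\<close>
      define w where "w x = (if x = a then - z / of_real r else u x)" for x
      have wa: "w a = - z / of_real r" by (simp add: w_def)
      have z': "(\<Sum>x\<in>H. cnj (u x) * A x a) = cnj z"
        unfolding z_def cnj_sum using H herm by (intro sum.cong) auto
      have "op_form (insert a H) A w w = cnj (w a) * A a a * w a + cnj (w a) * (\<Sum>y\<in>H. A a y * w y)
          + (\<Sum>x\<in>H. cnj (w x) * A x a) * w a + (\<Sum>x\<in>H. \<Sum>y\<in>H. cnj (w x) * A x y * w y)"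
        using H aH by (simp add: op_form_def sum.distrib sum_distrib_left sum_distrib_right mult.assoc)
      also have "(\<Sum>y\<in>H. A a y * w y) = z" unfolding z_def using aH by (intro sum.cong) (auto simp: w_def)
      also have "(\<Sum>x\<in>H. cnj (w x) * A x a) = cnj z"
        unfolding z'[symmetric] using aH by (intro sum.cong) (auto simp: w_def)
      also have "(\<Sum>x\<in>H. \<Sum>y\<in>H. cnj (w x) * A x y * w y) = op_form H A u u"
        unfolding op_form_def using aH by (intro sum.cong) (auto simp: w_def)
      finally have 1: "op_form (insert a H) A w w = op_form H A u u - cnj z * z / of_real r"
        using r by (simp add: wa Aaa field_simps)
      have "op_form H A' u u = op_form H A u u - (\<Sum>x\<in>H. cnj (u x) * A x a) * (\<Sum>y\<in>H. A a y * u y) / of_real r"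
        unfolding op_form_def A'_def sum_product sum_divide_distrib sum_subtractf[symmetric]
        by (intro sum.cong refl) (simp add: algebra_simps)
      then have "op_form H A' u u = op_form (insert a H) A w w"
        unfolding 1 z' z_def[symmetric] .
      then show "Im (op_form H A' u u) = 0 \<and> 0 \<le> Re (op_form H A' u u)"
        using pos H by (simp add: op_pos_def subset_insertI2)
    qed
    then obtain v where v: "\<forall>x\<in>F. \<forall>y\<in>F. A' x y = (\<Sum>k\<in>F. v k x * cnj (v k y))"
      using insert.IH by blast
    define v' where "v' k x = (if k = a then A x a / of_real (sqrt r) else if x = a then 0 else v k x)" for k x
    have "A x y = (\<Sum>k\<in>?G. v' k x * cnj (v' k y))" if "x \<in> ?G" "y \<in> ?G" for x y
    proof -
      have rr: "complex_of_real (sqrt r) * complex_of_real (sqrt r) = of_real r"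
        using r by (simp flip: of_real_mult)
      have "v' a x * cnj (v' a y) = A x a * A a y / of_real r"
        using that rr herm by (simp add: v'_def)
      moreover have "(\<Sum>k\<in>F. v' k x * cnj (v' k y)) = (\<Sum>k\<in>F. if x = a \<or> y = a then 0 else v k x * cnj (v k y))"
        using insert.hyps by (intro sum.cong) (auto simp: v'_def)
      moreover have "A' x y = 0" if "x = a \<or> y = a"
        using that r by (auto simp: A'_def Aaa)
      ultimately show ?thesis
        using that v insert.hyps by (cases "x = a \<or> y = a") (auto simp: A'_def diff_eq_eq add.commute)
    qed
    then show ?thesis by blast
  qed
qed simp

text \<open>Schur product theorem: \<open>B\<close> is a sum of rank-one matrices, and multiplying
  entrywise by one of them only rescales the test vector of \<open>A\<close>.\<close>

lemma op_pos_schur: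
  assumes "op_pos S A" "op_pos S B"
  shows "op_pos S (\<lambda>x y. A x y * B x y)"
  unfolding op_pos_def
proof (intro allI impI)
  fix F u assume F: "finite F \<and> F \<subseteq> S"
  obtain b where b: "\<And>x y. x \<in> F \<Longrightarrow> y \<in> F \<Longrightarrow> B x y = (\<Sum>k\<in>F. b k x * cnj (b k y))"
    using op_pos_gram[of F B] F op_pos_subset[OF assms(2)] by blast
  have "op_form F (\<lambda>x y. A x y * B x y) u u = op_form F (\<lambda>x y. \<Sum>k\<in>F. A x y * (b k x * cnj (b k y))) u u"
    unfolding op_form_def by (intro sum.cong refl) (simp add: b sum_distrib_left)
  also have "\<dots> = (\<Sum>k\<in>F. op_form F A (\<lambda>x. cnj (b k x) * u x) (\<lambda>x. cnj (b k x) * u x))"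
    unfolding op_form_sum by (intro sum.cong refl) (simp add: op_form_def mult_ac)
  finally show "Im (op_form F (\<lambda>x y. A x y * B x y) u u) = 0 \<and> 0 \<le> Re (op_form F (\<lambda>x y. A x y * B x y) u u)"
    using assms(1) F by (auto simp: op_pos_def Im_sum Re_sum intro!: sum_nonneg)
qed

lemma op_pos_prod:
  fixes n :: nat
  assumes "\<And>j. j < n \<Longrightarrow> op_pos S (A j)"
  shows "op_pos S (\<lambda>x y. \<Prod>j<n. A j x y)"
  using assms
proof (induction n)
  case 0
  then show ?case using op_pos_rank1[of S "\<lambda>_. 1"] by simp
next
  case (Suc n)
  then show ?case using op_pos_schur[of S "\<lambda>x y. \<Prod>j<n. A j x y" "A n"] by simp
qed

text \<open>A tensor product is the entrywise product of its factors pulled back along the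
  coordinate maps.\<close>

lemma op_pos_tensor_modes2:
  assumes "\<And>j. j < n \<Longrightarrow> op_pos UNIV (A j)"
  shows "op_pos S (tensor_modes2 n A)"
proof -
  have "op_pos S (\<lambda>x y. \<Prod>j<n. A j (fst x ! j, snd x ! j) (fst y ! j, snd y ! j))"
    by (intro op_pos_prod op_pos_pullback[of UNIV "A j" "\<lambda>x. (fst x ! j, snd x ! j)" for j] assms) auto
  then show ?thesis by (simp add: tensor_modes2_def case_prod_unfold)
qed

text \<open>The trace is the form of the entrywise product of \<open>P\<close> with the transpose of
  \<open>A\<close>, evaluated at the all-ones vector.\<close>

lemma op_pos_trace_nonneg:
  assumes "finite G" "op_pos G A" "op_pos G P"
  shows "Im (\<Sum>x\<in>G. \<Sum>z\<in>G. P x z * A z x) = 0" "0 \<le> Re (\<Sum>x\<in>G. \<Sum>z\<in>G. P x z * A z x)"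
proof -
  have "op_pos G (\<lambda>x z. P x z * A z x)"
    by (rule op_pos_schur[OF assms(3) op_pos_transpose[OF assms(2)]])
  from this[unfolded op_pos_def, rule_format, of G "\<lambda>_. 1"]
  show "Im (\<Sum>x\<in>G. \<Sum>z\<in>G. P x z * A z x) = 0" "0 \<le> Re (\<Sum>x\<in>G. \<Sum>z\<in>G. P x z * A z x)"
    using assms(1) by (simp_all add: op_form_def)
qed

text \<open>Bessel's inequality: the form equals the squared norm of the test vector minus its
  projection. The computation runs on \<open>F \<union> G\<close>, since the test set may miss part
  of the supports.\<close>

lemma op_pos_complement_orthonormal:
  fixes e :: "'k \<Rightarrow> 'i \<Rightarrow> complex"
  assumes "finite I" "finite G" and supp: "\<And>k x. k \<in> I \<Longrightarrow> x \<notin> G \<Longrightarrow> e k x = 0"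
    and orth: "\<And>k k'. k \<in> I \<Longrightarrow> k' \<in> I \<Longrightarrow> (\<Sum>x\<in>G. cnj (e k x) * e k' x) = (if k = k' then 1 else 0)"
  shows "op_pos S (\<lambda>x y. op_id x y - (\<Sum>k\<in>I. e k x * cnj (e k y)))"
  unfolding op_pos_def
proof (intro allI impI)
  fix F :: "'i set" and v :: "'i \<Rightarrow> complex" assume F: "finite F \<and> F \<subseteq> S"
  define H where "H = F \<union> G"
  have H: "finite H" "F \<subseteq> H" "G \<subseteq> H" using F assms(2) by (auto simp: H_def)
  define w where "w x = (if x \<in> F then v x else 0)" for x
  define c where "c k = (\<Sum>x\<in>H. cnj (e k x) * w x)" for k
  have orthH: "(\<Sum>x\<in>H. cnj (e k x) * e k' x) = (if k = k' then 1 else 0)" if "k \<in> I" "k' \<in> I" for k k'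
    unfolding orth[OF that, symmetric] using H that supp by (intro sum.mono_neutral_right) auto
  have sw: "(\<Sum>x\<in>F. f x * v x) = (\<Sum>x\<in>H. f x * w x)" "(\<Sum>x\<in>F. cnj (v x) * f x) = (\<Sum>x\<in>H. cnj (w x) * f x)" for f
    using H by (auto simp: w_def intro!: sum.mono_neutral_cong_left)
  have id: "op_form F op_id v v = (\<Sum>x\<in>H. cnj (w x) * w x)"
  proof -
    have "(\<Sum>y\<in>F. op_id x y * v y) = (if x \<in> F then v x else 0)" for x
      using F by (simp add: op_id_def if_distrib[of "\<lambda>a. a * _"] cong: if_cong)
    then have "op_form F op_id v v = (\<Sum>x\<in>F. cnj (v x) * w x)"
      by (simp add: op_form_def mult.assoc sum_distrib_left[symmetric] w_def)
    then show ?thesis by (simp only: sw)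
  qed
  have rank1: "op_form F (\<lambda>x y. e k x * cnj (e k y)) v v = cnj (c k) * c k" for k
  proof -
    have "op_form F (\<lambda>x y. e k x * cnj (e k y)) v v = (\<Sum>x\<in>F. cnj (v x) * e k x) * (\<Sum>y\<in>F. cnj (e k y) * v y)"
      by (simp add: op_form_def sum_product mult.assoc)
    then show ?thesis unfolding sw by (simp add: c_def cnj_sum mult.commute)
  qed
  have "op_form F (\<lambda>x y. op_id x y - (\<Sum>k\<in>I. e k x * cnj (e k y))) v v
      = op_form F op_id v v - op_form F (\<lambda>x y. \<Sum>k\<in>I. e k x * cnj (e k y)) v v"
    by (simp add: op_form_def left_diff_distrib right_diff_distrib sum_subtractf)
  also have "\<dots> = (\<Sum>x\<in>H. cnj (w x) * w x) - (\<Sum>k\<in>I. cnj (c k) * c k)"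
    unfolding op_form_sum rank1 id ..
  also have "\<dots> = (\<Sum>x\<in>H. cnj (w x - (\<Sum>k\<in>I. c k * e k x)) * (w x - (\<Sum>k\<in>I. c k * e k x)))"
  proof -
    have cross: "(\<Sum>x\<in>H. cnj (\<Sum>k\<in>I. c k * e k x) * w x) = (\<Sum>k\<in>I. cnj (c k) * c k)"
    proof -
      have "(\<Sum>x\<in>H. cnj (\<Sum>k\<in>I. c k * e k x) * w x) = (\<Sum>x\<in>H. \<Sum>k\<in>I. cnj (c k) * (cnj (e k x) * w x))"
        by (simp add: cnj_sum sum_distrib_right mult.assoc)
      also have "\<dots> = (\<Sum>k\<in>I. \<Sum>x\<in>H. cnj (c k) * (cnj (e k x) * w x))" by (rule sum.swap)
      finally show ?thesis by (simp add: c_def sum_distrib_left)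
    qed
    have cross': "(\<Sum>x\<in>H. cnj (w x) * (\<Sum>k\<in>I. c k * e k x)) = (\<Sum>k\<in>I. cnj (c k) * c k)"
      using arg_cong[OF cross, of cnj] by (simp add: cnj_sum mult.commute)
    have sq: "(\<Sum>x\<in>H. cnj (\<Sum>k\<in>I. c k * e k x) * (\<Sum>k\<in>I. c k * e k x)) = (\<Sum>k\<in>I. cnj (c k) * c k)"
    proof -
      have "(\<Sum>x\<in>H. cnj (\<Sum>k\<in>I. c k * e k x) * (\<Sum>k\<in>I. c k * e k x)) =
          (\<Sum>x\<in>H. \<Sum>k\<in>I. \<Sum>k'\<in>I. cnj (c k) * c k' * (cnj (e k x) * e k' x))"
        by (simp only: cnj_sum complex_cnj_mult sum_product) (simp only: mult_ac)
      also have "\<dots> = (\<Sum>k\<in>I. \<Sum>k'\<in>I. \<Sum>x\<in>H. cnj (c k) * c k' * (cnj (e k x) * e k' x))"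
        by (subst sum.swap, intro sum.cong refl sum.swap)
      also have "\<dots> = (\<Sum>k\<in>I. \<Sum>k'\<in>I. if k = k' then cnj (c k) * c k' else 0)"
        by (intro sum.cong refl) (simp add: sum_distrib_left[symmetric] orthH)
      finally show ?thesis using assms(1) by simp
    qed
    show ?thesis
      unfolding complex_cnj_diff left_diff_distrib right_diff_distrib sum_subtractf cross cross' sq by simp
  qed
  also have "\<dots> = of_real (\<Sum>x\<in>H. (cmod (w x - (\<Sum>k\<in>I. c k * e k x)))\<^sup>2)"
    by (simp add: complex_norm_square mult.commute del: of_real_power)
  finally show "Im (op_form F (\<lambda>x y. op_id x y - (\<Sum>k\<in>I. e k x * cnj (e k y))) v v) = 0 \<and>
      0 \<le> Re (op_form F (\<lambda>x y. op_id x y - (\<Sum>k\<in>I. e k x * cnj (e k y))) v v)"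
    by (simp add: sum_nonneg)
qed

section \<open>Positivity and normalisation of Bob's single-mode state\<close>

section \<open>Bob's single-mode state\<close>

context
  fixes \<eta> N :: real
  assumes \<eta>: "0 < \<eta>" "\<eta> < 1" and N: "0 < N"
begin

text \<open>The TMSV coefficients with their phases form a rank-one matrix; the remaining factor is
  a sum, over thermal input \<open>n\<close> and Eve's count \<open>q\<close>, of rank-one matrices
  of amplitudes. The state is their entrywise product.\<close>

lemma op_pos_bob_mode: "op_pos UNIV (bob_mode \<eta> N N\<^sub>S t)"
proof -
  define f where "f = (\<lambda>(p :: nat, i). exp (\<i> * of_real (t * real i)) * of_real (tmsv_coeff N\<^sub>S i))"
  define g where "g n q = (\<lambda>(p, i). of_real (beam_amp \<eta> p q i n) :: complex)" for n q
  have 1: "op_pos UNIV (\<lambda>(p, i) (p', i'). of_real (bob_term \<eta> N p i p' i' q) :: complex)" for q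
  proof (rule op_pos_infsum[where I = UNIV and A = "\<lambda>n x y. of_real (therm N n) * (g n q x * cnj (g n q y))"])
    show "op_pos UNIV (\<lambda>x y. of_real (therm N n) * (g n q x * cnj (g n q y)))" for n
      using N by (intro op_pos_scale op_pos_rank1 therm_nonneg) simp
    fix x y :: "nat \<times> nat"
    obtain p i p' i' where xy: "x = (p, i)" "y = (p', i')" by (cases x, cases y)
    show "((\<lambda>n. of_real (therm N n) * (g n q x * cnj (g n q y))) has_sum
        (case x of (p, i) \<Rightarrow> \<lambda>(p', i'). of_real (bob_term \<eta> N p i p' i' q)) y) UNIV"
      by (rule has_sum_finite_neutralI[where B = "if i \<le> p + q then {p + q - i} else {}"])
        (auto simp: xy g_def bob_term_def beam_amp_def)
  qed
  have 2: "op_pos UNIV (\<lambda>(p, i) (p', i'). (\<Sum>\<^sub>\<infinity>q. of_real (bob_term \<eta> N p i p' i' q)) :: complex)"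
    by (rule op_pos_infsum[OF 1, where I = UNIV])
      (auto intro!: has_sum_infsum abs_summable_summable bob_term_summable[OF \<eta> N])
  have "exp (\<i> * of_real (t * (real i - real i'))) = exp (\<i> * of_real (t * real i)) * cnj (exp (\<i> * of_real (t * real i')))" for i i'
    by (simp add: exp_cnj exp_add[symmetric] algebra_simps)
  then have "bob_mode \<eta> N N\<^sub>S t = (\<lambda>x y. (f x * cnj (f y)) *
      (\<lambda>(p, i) (p', i'). (\<Sum>\<^sub>\<infinity>q. of_real (bob_term \<eta> N p i p' i' q)) :: complex) x y)"
    by (auto simp: fun_eq_iff bob_mode_def f_def mult_ac)
  then show ?thesis
    using op_pos_schur[OF op_pos_rank1 2, of f] by simp
qed

text \<open>Reindexing the outputs \<open>(p, q)\<close> by \<open>(n, p)\<close> with thermal input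
  \<open>n = p + q - i\<close> turns the sum into thermal weights times the squared norms of beam
  splitter columns, which are 1 by \<open>beam_norm\<close>.\<close>

lemma bob_term_total:
  "((\<lambda>p. \<Sum>\<^sub>\<infinity>q. bob_term \<eta> N p i p i q) has_sum 1) UNIV"
proof -
  let ?h = "\<lambda>(n, p). therm N n * (beam_amp \<eta> p (i + n - p) i n)\<^sup>2"
  have in1: "((\<lambda>p. ?h (n, p)) has_sum therm N n) {..i + n}" for n
    using beam_norm[of \<eta> i n] \<eta> by (intro has_sum_finiteI) (auto simp: sum_distrib_left[symmetric])
  have "(?h has_sum 1) (Sigma UNIV (\<lambda>n. {..i + n}))"
  proof (rule has_sum_SigmaI[OF in1])
    show "(therm N has_sum 1) UNIV" using N by (simp add: therm_has_sum)
    then show "?h summable_on Sigma UNIV (\<lambda>n. {..i + n})"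
      using N by (intro summable_on_SigmaI[OF in1]) (auto intro: has_sum_imp_summable simp: therm_nonneg)
  qed
  also have "(?h has_sum 1) (Sigma UNIV (\<lambda>n. {..i + n})) \<longleftrightarrow> ((\<lambda>(p, q). bob_term \<eta> N p i p i q) has_sum 1) {(p, q). i \<le> p + q}"
    by (rule has_sum_reindex_bij_witness[of _ "\<lambda>(p, q). (p + q - i, p)" "\<lambda>(n, p). (p, i + n - p)"])
      (auto simp: bob_term_def power2_eq_square)
  also have "\<dots> \<longleftrightarrow> ((\<lambda>(p, q). bob_term \<eta> N p i p i q) has_sum 1) (UNIV \<times> UNIV)"
    by (rule has_sum_cong_neutral) (auto simp: bob_term_def)
  finally have "((\<lambda>(p, q). bob_term \<eta> N p i p i q) has_sum 1) (UNIV \<times> UNIV)" .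
  then show ?thesis
  proof (rule has_sum_SigmaD)
    show "((\<lambda>q. case (p, q) of (p, q) \<Rightarrow> bob_term \<eta> N p i p i q) has_sum (\<Sum>\<^sub>\<infinity>q. bob_term \<eta> N p i p i q)) UNIV" for p
    proof -
      have "(\<lambda>q. bob_term \<eta> N p i p i q) abs_summable_on UNIV"
        using bob_term_summable[OF \<eta> N, of p i p i] by simp
      then show ?thesis by (simp add: abs_summable_summable)
    qed
  qed
qed

lemma bob_mode_diag:
  assumes "0 < N\<^sub>S"
  shows "bob_mode \<eta> N N\<^sub>S t (p, i) (p, i) = of_real (therm N\<^sub>S i * (\<Sum>\<^sub>\<infinity>q. bob_term \<eta> N p i p i q))"
proof -
  have "(\<lambda>q. bob_term \<eta> N p i p i q) abs_summable_on UNIV"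
    using bob_term_summable[OF \<eta> N, of p i p i] by simp
  then have hs: "((\<lambda>q. of_real (bob_term \<eta> N p i p i q) :: complex) has_sum of_real (\<Sum>\<^sub>\<infinity>q. bob_term \<eta> N p i p i q)) UNIV"
    by (rule has_sum_of_real[OF has_sum_infsum[OF abs_summable_summable]])
  then show ?thesis
    using assms therm_nonneg[of N\<^sub>S i] unfolding bob_mode_def prod.case infsumI[OF hs]
    by (simp add: tmsv_coeff_def flip: of_real_mult)
qed

lemma bob_mode_trace:
  assumes "0 < N\<^sub>S"
  shows "((\<lambda>(p, i). bob_mode \<eta> N N\<^sub>S t (p, i) (p, i)) has_sum 1) UNIV"
proof -
  let ?b = "\<lambda>p i. \<Sum>\<^sub>\<infinity>q. bob_term \<eta> N p i p i q"
  have nn: "0 \<le> ?b p i" for p i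
    using N by (intro infsum_nonneg) (auto simp: bob_term_def therm_nonneg mult.assoc)
  have in1: "((\<lambda>p. (\<lambda>(i, p). therm N\<^sub>S i * ?b p i) (i, p)) has_sum therm N\<^sub>S i) UNIV" for i
    using has_sum_cmult_right[OF bob_term_total[of i], of "therm N\<^sub>S i"] by simp
  have "((\<lambda>(i, p). therm N\<^sub>S i * ?b p i) has_sum 1) (UNIV \<times> UNIV)"
  proof (rule has_sum_SigmaI[OF in1])
    show "(therm N\<^sub>S has_sum 1) UNIV" using assms by (simp add: therm_has_sum)
    then show "(\<lambda>(i, p). therm N\<^sub>S i * ?b p i) summable_on UNIV \<times> UNIV"
      using assms nn by (intro summable_on_SigmaI[OF in1]) (auto intro: has_sum_imp_summable simp: therm_nonneg)
  qed
  then have "((\<lambda>(p, i). therm N\<^sub>S i * ?b p i) has_sum 1) (UNIV \<times> UNIV)"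
    by (subst (asm) has_sum_swap) (simp add: case_prod_unfold)
  from has_sum_of_real[OF this, where 'a = complex] show ?thesis
    using assms by (simp add: bob_mode_diag case_prod_unfold)
qed

end

section \<open>Traces carried together with their convergence\<close>

section \<open>Traces of products\<close>

text \<open>A relation rather than a value, since \<open>op_trace\<close> and \<open>op_mult\<close>
  fall back to a default on divergent sums. Row-finiteness of \<open>P\<close> makes the entries of
  the product finite sums for every \<rho>.\<close>

definition has_trace :: "'i set \<Rightarrow> 'i op \<Rightarrow> 'i op \<Rightarrow> complex \<Rightarrow> bool" where
  "has_trace S P \<rho> \<tau> \<longleftrightarrow> (\<forall>x\<in>S. finite {z \<in> S. P x z \<noteq> 0}) \<and> ((\<lambda>x. op_mult S P \<rho> x x) has_sum \<tau>) S"

lemma has_trace_op_trace: "has_trace S P \<rho> \<tau> \<Longrightarrow> op_trace S (op_mult S P \<rho>) = \<tau>"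
  by (auto simp: has_trace_def op_trace_def infsumI)

lemma has_trace_finite:
  assumes "finite G" "G \<subseteq> S" and "\<And>x z. x \<notin> G \<or> z \<notin> G \<Longrightarrow> P x z = 0"
  shows "has_trace S P \<rho> (\<Sum>x\<in>G. \<Sum>z\<in>G. P x z * \<rho> z x)"
proof -
  have "finite {z \<in> S. P x z \<noteq> 0}" for x
    by (rule finite_subset[OF _ assms(1)]) (use assms(3) in auto)
  moreover have "op_mult S P \<rho> x x = (\<Sum>z\<in>G. P x z * \<rho> z x)" for x
    unfolding op_mult_def using assms by (intro infsum_eq_sum) auto
  moreover have "((\<lambda>x. \<Sum>z\<in>G. P x z * \<rho> z x) has_sum (\<Sum>x\<in>G. \<Sum>z\<in>G. P x z * \<rho> z x)) S"
    using assms by (intro has_sum_finite_neutralI[of G]) (auto intro!: sum.neutral)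
  ultimately show ?thesis by (simp add: has_trace_def)
qed

lemma has_trace_id:
  assumes "((\<lambda>x. \<rho> x x) has_sum \<tau>) S"
  shows "has_trace S op_id \<rho> \<tau>"
proof -
  have "finite {z \<in> S. op_id x z \<noteq> 0}" for x
    by (rule finite_subset[of _ "{x}"]) (auto simp: op_id_def)
  moreover have "op_mult S op_id \<rho> x x = \<rho> x x" if "x \<in> S" for x
    unfolding op_mult_def using that by (subst infsum_eq_sum[of "{x}"]) (auto simp: op_id_def)
  ultimately show ?thesis using assms by (auto simp: has_trace_def cong: has_sum_cong)
qed

lemma has_trace_diff:
  assumes "has_trace S P \<rho> \<tau>" "has_trace S P' \<rho> \<tau>'"
  shows "has_trace S (\<lambda>x z. P x z - P' x z) \<rho> (\<tau> - \<tau>')"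
proof -
  have fin: "finite {z \<in> S. P x z - P' x z \<noteq> 0}" if "x \<in> S" for x
    by (rule finite_subset[of _ "{z \<in> S. P x z \<noteq> 0} \<union> {z \<in> S. P' x z \<noteq> 0}"])
      (use assms that in \<open>auto simp: has_trace_def\<close>)
  have "op_mult S (\<lambda>x z. P x z - P' x z) \<rho> x x = op_mult S P \<rho> x x - op_mult S P' \<rho> x x" if x: "x \<in> S" for x
  proof -
    let ?G = "{z \<in> S. P x z \<noteq> 0} \<union> {z \<in> S. P' x z \<noteq> 0}"
    have G: "finite ?G" "?G \<subseteq> S" using assms x by (auto simp: has_trace_def)
    have "op_mult S (\<lambda>x z. P x z - P' x z) \<rho> x x = (\<Sum>z\<in>?G. (P x z - P' x z) * \<rho> z x)"
      "op_mult S P \<rho> x x = (\<Sum>z\<in>?G. P x z * \<rho> z x)" "op_mult S P' \<rho> x x = (\<Sum>z\<in>?G. P' x z * \<rho> z x)"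
      unfolding op_mult_def by (rule infsum_eq_sum[OF G]; simp)+
    then show ?thesis by (simp add: left_diff_distrib sum_subtractf)
  qed
  moreover have "((\<lambda>x. op_mult S P \<rho> x x - op_mult S P' \<rho> x x) has_sum (\<tau> - \<tau>')) S"
    using assms has_sum_add[of "\<lambda>x. op_mult S P \<rho> x x" S \<tau> "\<lambda>x. - 1 * op_mult S P' \<rho> x x" "- 1 * \<tau>'"]
      has_sum_cmult_right[of "\<lambda>x. op_mult S P' \<rho> x x" S \<tau>' "- 1"]
    by (simp add: has_trace_def)
  ultimately show ?thesis
    using fin by (auto simp: has_trace_def cong: has_sum_cong)
qed

text \<open>Used with \<open>h\<close> the concatenation of a first block and the remaining
  modes.\<close>

lemma has_trace_product:
  assumes 1: "has_trace S1 P1 \<rho>1 \<tau>1" and 2: "has_trace S2 P2 \<rho>2 \<tau>2" and h: "bij_betw h (S1 \<times> S2) S"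
    and P: "\<And>u u' v v'. u \<in> S1 \<Longrightarrow> u' \<in> S1 \<Longrightarrow> v \<in> S2 \<Longrightarrow> v' \<in> S2 \<Longrightarrow> P (h (u, v)) (h (u', v')) = P1 u u' * P2 v v'"
    and \<rho>: "\<And>u u' v v'. u \<in> S1 \<Longrightarrow> u' \<in> S1 \<Longrightarrow> v \<in> S2 \<Longrightarrow> v' \<in> S2 \<Longrightarrow> \<rho> (h (u, v)) (h (u', v')) = \<rho>1 u u' * \<rho>2 v v'"
  shows "has_trace S P \<rho> (\<tau>1 * \<tau>2)"
proof -
  have fin: "finite {z \<in> S. P x z \<noteq> 0}" if x: "x \<in> S" for x
  proof -
    obtain u v where uv: "u \<in> S1" "v \<in> S2" "x = h (u, v)"
      using x h by (auto simp: bij_betw_def)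
    have "{z \<in> S. P x z \<noteq> 0} \<subseteq> h ` ({u' \<in> S1. P1 u u' \<noteq> 0} \<times> {v' \<in> S2. P2 v v' \<noteq> 0})"
    proof
      fix z assume z: "z \<in> {z \<in> S. P x z \<noteq> 0}"
      then obtain u' v' where uv': "u' \<in> S1" "v' \<in> S2" "z = h (u', v')"
        using h by (auto simp: bij_betw_def)
      then show "z \<in> h ` ({u' \<in> S1. P1 u u' \<noteq> 0} \<times> {v' \<in> S2. P2 v v' \<noteq> 0})"
        using z P[OF uv(1) uv'(1) uv(2) uv'(2)] uv by auto
    qed
    moreover have "finite ({u' \<in> S1. P1 u u' \<noteq> 0} \<times> {v' \<in> S2. P2 v v' \<noteq> 0})"
      using 1 2 uv by (auto simp: has_trace_def)
    ultimately show ?thesis using finite_subset by blast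
  qed
  have mult: "op_mult S P \<rho> (h (u, v)) (h (u, v)) = op_mult S1 P1 \<rho>1 u u * op_mult S2 P2 \<rho>2 v v"
    if uv: "u \<in> S1" "v \<in> S2" for u v
  proof -
    have s: "(\<lambda>u'. P1 u u' * \<rho>1 u' u) abs_summable_on S1" "(\<lambda>v'. P2 v v' * \<rho>2 v' v) abs_summable_on S2"
      using 1 2 uv
      by (auto simp: has_trace_def intro!: abs_summable_finite_support[of "{z \<in> S1. P1 u z \<noteq> 0}"]
          abs_summable_finite_support[of "{z \<in> S2. P2 v z \<noteq> 0}"])
    have "op_mult S P \<rho> (h (u, v)) (h (u, v)) =
        (\<Sum>\<^sub>\<infinity>w\<in>S1 \<times> S2. P (h (u, v)) (h w) * \<rho> (h w) (h (u, v)))"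
      unfolding op_mult_def by (rule infsum_reindex_bij_betw[OF h, symmetric])
    also have "\<dots> = (\<Sum>\<^sub>\<infinity>(u', v')\<in>S1 \<times> S2. (P1 u u' * \<rho>1 u' u) * (P2 v v' * \<rho>2 v' v))"
      using uv by (intro infsum_cong) (auto simp: P \<rho>)
    also have "\<dots> = op_mult S1 P1 \<rho>1 u u * op_mult S2 P2 \<rho>2 v v"
      unfolding op_mult_def using has_sum_times[OF s] by (rule infsumI)
    finally show ?thesis .
  qed
  have t: "((\<lambda>u. op_mult S1 P1 \<rho>1 u u) has_sum \<tau>1) S1" "((\<lambda>v. op_mult S2 P2 \<rho>2 v v) has_sum \<tau>2) S2"
    using 1 2 by (auto simp: has_trace_def)
  have "((\<lambda>(u, v). op_mult S1 P1 \<rho>1 u u * op_mult S2 P2 \<rho>2 v v) has_sum (\<tau>1 * \<tau>2)) (S1 \<times> S2)"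
    using has_sum_times[of "\<lambda>u. op_mult S1 P1 \<rho>1 u u" S1 "\<lambda>v. op_mult S2 P2 \<rho>2 v v" S2] t
    by (simp add: has_sum_imp_summable infsumI flip: summable_on_iff_abs_summable_on_complex)
  then have "((\<lambda>w. op_mult S P \<rho> (h w) (h w)) has_sum (\<tau>1 * \<tau>2)) (S1 \<times> S2)"
    by (rule has_sum_cong[THEN iffD1, rotated]) (auto simp: mult)
  then have "((\<lambda>x. op_mult S P \<rho> x x) has_sum (\<tau>1 * \<tau>2)) S"
    by (subst (asm) has_sum_reindex_bij_betw[OF h])
  with fin show ?thesis by (simp add: has_trace_def)
qed

section \<open>Independent measurements of consecutive blocks\<close>

section \<open>Measuring block by block\<close>

definition cat2 :: "('a list \<times> 'a list) \<times> ('a list \<times> 'a list) \<Rightarrow> 'a list \<times> 'a list" where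
  "cat2 = (\<lambda>((x, y), (x', y')). (x @ x', y @ y'))"

definition slice :: "nat \<Rightarrow> nat \<Rightarrow> 'a list \<times> 'a list \<Rightarrow> 'a list \<times> 'a list" where
  "slice K b = (\<lambda>(x, y). (take K (drop (b * K) x), take K (drop (b * K) y)))"

definition rest :: "nat \<Rightarrow> 'a list \<times> 'a list \<Rightarrow> 'a list \<times> 'a list" where
  "rest k = (\<lambda>(x, y). (drop k x, drop k y))"

text \<open>The modes behind the last complete block are left unmeasured: the identity acts on
  them.\<close>

definition block_measurement ::
  "nat \<Rightarrow> (nat \<Rightarrow> (nat list \<times> nat list) op) \<Rightarrow> nat \<Rightarrow> (nat \<Rightarrow> nat) \<Rightarrow> (nat list \<times> nat list) op" where
  "block_measurement K E N y = (\<lambda>x z. (\<Prod>b<N. E (y b) (slice K b x) (slice K b z)) * op_id (rest (N * K) x) (rest (N * K) z))"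

lemma bij_cat2: "bij_betw cat2 ((fock K \<times> fock K) \<times> (fock n \<times> fock n)) (fock (K + n) \<times> fock (K + n))"
  by (rule bij_betwI[where g = "\<lambda>(x, y). ((take K x, take K y), (drop K x, drop K y))"])
    (auto simp: cat2_def fock_def)

lemma tensor_modes2_cat2:
  assumes "u \<in> fock K \<times> fock K" "u' \<in> fock K \<times> fock K"
  shows "tensor_modes2 (K + n) A (cat2 (u, v)) (cat2 (u', v')) =
    tensor_modes2 K A u u' * tensor_modes2 n (\<lambda>j. A (K + j)) v v'"
proof -
  have split: "(\<Prod>j<K + n. f j) = (\<Prod>j<K. f j) * (\<Prod>j<n. f (K + j))" for f :: "nat \<Rightarrow> complex"
    by (induction n) (simp_all add: mult.assoc)
  show ?thesis
    using assms by (cases u; cases u'; cases v; cases v')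
      (auto simp: cat2_def tensor_modes2_def fock_def split nth_append)
qed

lemma block_measurement_Suc:
  assumes "u \<in> fock K \<times> fock K" "u' \<in> fock K \<times> fock K"
  shows "block_measurement K E (Suc N) y (cat2 (u, v)) (cat2 (u', v')) =
    E (y 0) u u' * block_measurement K E N (\<lambda>b. y (Suc b)) v v'"
proof -
  have "slice K 0 (cat2 (w, v)) = w" "slice K (Suc b) (cat2 (w, v)) = slice K b v"
    "rest (Suc N * K) (cat2 (w, v)) = rest (N * K) v"
    if "w \<in> fock K \<times> fock K" for w v :: "nat list \<times> nat list" and b
    using that by (cases w; cases v; auto simp: slice_def cat2_def rest_def fock_def)+
  then show ?thesis
    using assms unfolding block_measurement_def prod.lessThan_Suc_shift by (simp add: mult.assoc)
qed

lemma tensor_modes2_trace: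
  assumes "\<And>j. ((\<lambda>(a, b). A j (a, b) (a, b)) has_sum 1) UNIV"
  shows "((\<lambda>x. tensor_modes2 n A x x) has_sum 1) (fock n \<times> fock n)"
proof -
  have "(\<lambda>(a, b). A j (a, b) (a, b)) abs_summable_on UNIV" for j
    unfolding summable_on_iff_abs_summable_on_complex[symmetric] by (rule has_sum_imp_summable[OF assms])
  from prod_fock2(2)[of n "\<lambda>j a b. A j (a, b) (a, b)", OF this]
  show ?thesis using infsumI[OF assms] by (simp add: tensor_modes2_def case_prod_unfold)
qed

text \<open>This makes the blocks a memoryless classical channel: outcome probabilities multiply.
  Trace 1 of each mode accounts for the \<open>r\<close> unmeasured modes.\<close>

lemma block_measurement_trace:
  assumes "\<And>j. ((\<lambda>(a, b). A j (a, b) (a, b)) has_sum 1) UNIV"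
    and "\<And>b. b < N \<Longrightarrow> has_trace (fock K \<times> fock K) (E (y b)) (tensor_modes2 K (\<lambda>j. A (b * K + j))) (\<tau> b)"
  shows "has_trace (fock (N * K + r) \<times> fock (N * K + r)) (block_measurement K E N y) (tensor_modes2 (N * K + r) A) (\<Prod>b<N. \<tau> b)"
  using assms
proof (induction N arbitrary: A y \<tau>)
  case 0
  have "block_measurement K E 0 y = op_id"
    by (auto simp: fun_eq_iff block_measurement_def rest_def)
  then show ?case using has_trace_id[where \<rho> = "tensor_modes2 r A", OF tensor_modes2_trace[where A = A and n = r, OF 0(1)]] by simp
next
  case (Suc N)
  have IH: "has_trace (fock (N * K + r) \<times> fock (N * K + r)) (block_measurement K E N (\<lambda>b. y (Suc b)))
      (tensor_modes2 (N * K + r) (\<lambda>j. A (K + j))) (\<Prod>b<N. \<tau> (Suc b))"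
  proof (rule Suc.IH)
    show "has_trace (fock K \<times> fock K) (E (y (Suc b))) (tensor_modes2 K (\<lambda>j. A (K + (b * K + j)))) (\<tau> (Suc b))"
      if "b < N" for b
      using Suc.prems(2)[of "Suc b"] that by (simp add: add.assoc)
  qed (rule Suc.prems(1))
  have "has_trace (fock K \<times> fock K) (E (y 0)) (tensor_modes2 K A) (\<tau> 0)"
    using Suc.prems(2)[of 0] by simp
  from has_trace_product[OF this IH bij_cat2, where P = "block_measurement K E (Suc N) y" and \<rho> = "tensor_modes2 (K + (N * K + r)) A"]
  have "has_trace (fock (K + (N * K + r)) \<times> fock (K + (N * K + r))) (block_measurement K E (Suc N) y)
      (tensor_modes2 (K + (N * K + r)) A) (\<tau> 0 * (\<Prod>b<N. \<tau> (Suc b)))"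
    by (simp add: block_measurement_Suc tensor_modes2_cat2)
  then show ?case unfolding prod.lessThan_Suc_shift by (simp add: add.assoc)
qed

lemma op_pos_op_id: "op_pos S op_id"
  using op_pos_complement_orthonormal[of "{}" "{}" "\<lambda>_ _. 0" S] by simp

lemma op_pos_block_measurement:
  assumes "\<And>b. b < N \<Longrightarrow> op_pos UNIV (E (y b))"
  shows "op_pos S (block_measurement K E N y)"
  unfolding block_measurement_def
  by (intro op_pos_schur op_pos_prod)
    (auto intro!: op_pos_pullback[where p = "rest (N * K)" and T = UNIV and A = op_id] op_pos_op_id
      op_pos_pullback[where p = "slice K b" and T = UNIV and A = "E (y b)" for b] assms)

lemma block_measurement_complete:
  assumes E: "\<And>x z. (\<Sum>a\<le>A. E a x z) = op_id x z"
    and xz: "x \<in> fock (N * K + r) \<times> fock (N * K + r)" "z \<in> fock (N * K + r) \<times> fock (N * K + r)"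
  shows "(\<Sum>y\<in>PiE {..<N} (\<lambda>_. {..A}). block_measurement K E N y x z) = op_id x z"
proof -
  have "(\<Sum>y\<in>PiE {..<N} (\<lambda>_. {..A}). block_measurement K E N y x z) =
      (\<Prod>b<N. \<Sum>a\<le>A. E a (slice K b x) (slice K b z)) * op_id (rest (N * K) x) (rest (N * K) z)"
    unfolding block_measurement_def sum_distrib_right[symmetric]
    by (subst prod_sum_PiE) auto
  also have "\<dots> = (\<Prod>b<N. op_id (slice K b x) (slice K b z)) * op_id (rest (N * K) x) (rest (N * K) z)"
    by (simp only: E)
  also have "\<dots> = op_id x z"
    using xz
  proof (induction N arbitrary: x z)
    case 0
    then show ?case by (auto simp: op_id_def rest_def)
  next
    case (Suc N)
    let ?F = "fock K \<times> fock K" and ?G = "fock (N * K + r) \<times> fock (N * K + r)"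
    have "x \<in> cat2 ` (?F \<times> ?G)" "z \<in> cat2 ` (?F \<times> ?G)"
      using Suc.prems bij_cat2[of K "N * K + r"] by (auto simp: bij_betw_def add.assoc)
    then obtain u v u' v' where uv: "x = cat2 (u, v)" "z = cat2 (u', v')" "u \<in> ?F" "u' \<in> ?F" "v \<in> ?G" "v' \<in> ?G"
      by blast
    have "slice K 0 (cat2 (w, v)) = w" "slice K (Suc b) (cat2 (w, v)) = slice K b v"
      "rest (Suc N * K) (cat2 (w, v)) = rest (N * K) v"
      if "w \<in> ?F" for w v :: "nat list \<times> nat list" and b
      using that by (cases w; cases v; auto simp: slice_def cat2_def rest_def fock_def)+
    then have "(\<Prod>b<Suc N. op_id (slice K b x) (slice K b z)) * op_id (rest (Suc N * K) x) (rest (Suc N * K) z)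
        = op_id u u' * op_id v v'"
      unfolding uv(1,2) prod.lessThan_Suc_shift using uv Suc.IH[OF uv(5,6)] by (simp add: mult.assoc)
    also have "\<dots> = op_id x z"
    proof -
      have "cat2 (u, v) = cat2 (u', v') \<longleftrightarrow> (u, v) = (u', v')"
        using uv by (intro inj_on_eq_iff[OF bij_betw_imp_inj_on[OF bij_cat2]]) blast+
      then show ?thesis by (simp add: op_id_def uv(1,2))
    qed
    finally show ?case .
  qed
  finally show ?thesis .
qed

section \<open>Fourier measurement on the states with one idler photon\<close>

section \<open>The measurement of one block\<close>

lemma sum_nat_blocks:
  fixes f :: "nat \<Rightarrow> 'a :: comm_monoid_add"
  shows "(\<Sum>j<A * R. f j) = (\<Sum>l<A. \<Sum>r<R. f (l * R + r))"
proof -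
  have "sum f {a..<a + R} = (\<Sum>r<R. f (a + r))" for a
    by (rule sum.reindex_bij_witness[of _ "\<lambda>r. a + r" "\<lambda>j. j - a"]) auto
  then show ?thesis
    using sum.nat_group[of f R A] by simp
qed

lemma sum_roots_of_unity:
  assumes "m < A" "m' < A"
  shows "(\<Sum>l<A. cis (2 * pi * real m' * real l / real A) * cnj (cis (2 * pi * real m * real l / real A)))
    = (if m = m' then of_nat A else 0)"
proof (cases "m = m'")
  case True
  then show ?thesis by (simp add: complex_norm_square[symmetric])
next
  case False
  define w where "w = cis (2 * pi * (real m' - real m) / real A)"
  have w: "w ^ l = cis (2 * pi * real m' * real l / real A) * cnj (cis (2 * pi * real m * real l / real A))" for l
    unfolding w_def Complex.DeMoivre cis_cnj cis_mult
    by (rule arg_cong[where f = cis]) (simp add: diff_divide_distrib algebra_simps)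
  have "w ^ A = 1"
  proof -
    have "real A * (2 * pi * (real m' - real m) / real A) = 2 * pi * of_int (int m' - int m)"
      using assms by simp
    then show ?thesis unfolding w_def Complex.DeMoivre by (metis cis_multiple_2pi Ints_of_int)
  qed
  moreover have "w \<noteq> 1"
  proof
    assume "w = 1"
    then have "cos (2 * pi * (real m' - real m) / real A) = 1" by (simp add: w_def complex_eq_iff)
    then obtain k :: int where "2 * pi * (real m' - real m) / real A = of_int k * 2 * pi"
      using cos_one_2pi_int by blast
    then have "2 * pi * (real m' - real m) = 2 * pi * (of_int k * real A)"
      using assms by (simp add: divide_eq_eq mult_ac)
    then have "real m' - real m = of_int k * real A"
      by (subst (asm) mult_cancel_left) simp
    then have "real_of_int (int m' - int m) = real_of_int (k * int A)" by simp
    then have eq: "int m' - int m = k * int A" by (simp only: of_int_eq_iff)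
    have "k = 0"
    proof (rule ccontr)
      assume "k \<noteq> 0"
      then have "int A \<le> \<bar>k * int A\<bar>" using mult_right_mono[of 1 "\<bar>k\<bar>" "int A"] by (simp add: abs_mult)
      then show False using assms unfolding eq[symmetric] by linarith
    qed
    then show False using eq False by simp
  qed
  ultimately have "(\<Sum>l<A. w ^ l) = 0" by (simp add: geometric_sum)
  then show ?thesis using False by (simp add: w)
qed

text \<open>Number states of a block are given by Bob's excess photon numbers \<open>d\<close>; \<open>excite d j\<close> is the state with
  one idler photon, in mode \<open>j\<close>, and excess numbers \<open>d\<close>.\<close>

definition excite :: "nat list \<Rightarrow> nat \<Rightarrow> nat list \<times> nat list" where
  "excite d j = (d[j := Suc (d ! j)], (replicate (length d) 0)[j := 1])"

lemma excite_inj: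
  assumes "j < length d" "k < length d'" "length d = length d'"
  shows "excite d j = excite d' k \<longleftrightarrow> d = d' \<and> j = k"
proof
  assume eq: "excite d j = excite d' k"
  have "(replicate (length d) 0)[j := 1] ! j = (replicate (length d) 0)[k := (1::nat)] ! j"
    using eq assms by (auto simp: excite_def)
  then have jk: "j = k" using assms by (auto simp: nth_list_update split: if_splits)
  have "d ! i = d' ! i" if "i < length d" for i
  proof -
    have "d[j := Suc (d ! j)] ! i = d'[j := Suc (d' ! j)] ! i" using eq jk by (simp add: excite_def)
    then show ?thesis using that assms by (auto simp: nth_list_update split: if_splits)
  qed
  then show "d = d' \<and> j = k" using jk assms by (auto intro: nth_equalityI)
qed auto

text \<open>\<open>D\<close> is the finite set of excess patterns that the measurement resolves. All
  other patterns are counted as erasures.\<close>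

locale block =
  fixes A R :: nat and D :: "nat list set"
  assumes A: "0 < A" and R: "0 < R" and D: "finite D" "D \<subseteq> fock (A * R)"
begin

definition weight :: "nat list \<Rightarrow> nat \<Rightarrow> real" where
  "weight d l = (\<Sum>r<R. real (d ! (l * R + r)) + 1)"

lemma weight_pos: "0 < weight d l"
  unfolding weight_def using R by (intro sum_pos) auto

definition phase :: "nat \<Rightarrow> nat \<Rightarrow> real" where
  "phase m j = 2 * pi * real m * real (j div R) / real A"

text \<open>The normalisation gives each of the \<open>A\<close> phase groups total squared weight
  exactly \<open>1 / A\<close>, whatever \<open>d\<close> is. Fourier vectors for different symbols
  are therefore exactly orthogonal, at the price of an imperfect match with the signal
  amplitudes.\<close>

definition amp :: "nat \<Rightarrow> nat list \<Rightarrow> nat \<Rightarrow> complex" where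
  "amp m d j = cis (phase m j) * of_real (sqrt (real (d ! j) + 1) / sqrt (real A * weight d (j div R)))"

definition ket :: "nat \<Rightarrow> nat list \<Rightarrow> nat list \<times> nat list \<Rightarrow> complex" where
  "ket m d x = (\<Sum>j<A * R. if x = excite d j then amp m d j else 0)"

definition supp :: "(nat list \<times> nat list) set" where
  "supp = (\<lambda>(d, j). excite d j) ` (D \<times> {..<A * R})"

lemma supp: "finite supp" "supp \<subseteq> fock (A * R) \<times> fock (A * R)" 
  using D by (auto simp: supp_def excite_def fock_def)

lemma excite_supp: "d \<in> D \<Longrightarrow> j < A * R \<Longrightarrow> excite d j \<in> supp"
  by (auto simp: supp_def)

lemma length_D: "d \<in> D \<Longrightarrow> length d = A * R"
  using D by (auto simp: fock_def)

lemma ket_outside: "d \<in> D \<Longrightarrow> x \<notin> supp \<Longrightarrow> ket m d x = 0"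
  unfolding ket_def by (intro sum.neutral) (auto simp: excite_supp)

lemma sum_ket:
  assumes "d \<in> D"
  shows "(\<Sum>x\<in>supp. f x * ket m d x) = (\<Sum>j<A * R. f (excite d j) * amp m d j)"
proof -
  have "(\<Sum>x\<in>supp. f x * ket m d x) = (\<Sum>x\<in>supp. \<Sum>j<A * R. if x = excite d j then f x * amp m d j else 0)"
    unfolding ket_def sum_distrib_left by (intro sum.cong) auto
  also have "\<dots> = (\<Sum>j<A * R. \<Sum>x\<in>supp. if x = excite d j then f x * amp m d j else 0)"
    by (rule sum.swap)
  also have "\<dots> = (\<Sum>j<A * R. f (excite d j) * amp m d j)"
    using supp assms by (intro sum.cong) (auto simp: excite_supp)
  finally show ?thesis .
qed

lemma sum_cnj_ket:
  assumes "d \<in> D"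
  shows "(\<Sum>x\<in>supp. cnj (ket m d x) * f x) = (\<Sum>j<A * R. cnj (amp m d j) * f (excite d j))"
  using arg_cong[OF sum_ket[OF assms, of "\<lambda>x. cnj (f x)" m], of cnj] by (simp add: cnj_sum mult.commute)

text \<open>Different patterns have disjoint supports by \<open>excite_inj\<close>. For equal
  patterns the equal group weights reduce the product to a sum of roots of unity.\<close>

lemma ket_orthonormal:
  assumes "d \<in> D" "d' \<in> D" "m < A" "m' < A"
  shows "(\<Sum>x\<in>supp. cnj (ket m d x) * ket m' d' x) = (if (m, d) = (m', d') then 1 else 0)"
proof -
  have k: "ket m' d' (excite d j) = (if d = d' then amp m' d j else 0)" if "j < A * R" for j
  proof -
    have "ket m' d' (excite d j) = (\<Sum>i<A * R. if i = j then (if d = d' then amp m' d j else 0) else 0)"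
      unfolding ket_def using excite_inj[of j d _ d'] length_D assms that by (intro sum.cong) auto
    then show ?thesis using that by simp
  qed
  have "(\<Sum>x\<in>supp. cnj (ket m d x) * ket m' d' x) = (if d = d' then \<Sum>j<A * R. cnj (amp m d j) * amp m' d j else 0)"
    unfolding sum_cnj_ket[OF assms(1)] by (auto simp: k)
  also have "(\<Sum>j<A * R. cnj (amp m d j) * amp m' d j) =
      (\<Sum>l<A. \<Sum>r<R. cis (2 * pi * real m' * real l / real A) * cnj (cis (2 * pi * real m * real l / real A))
        * of_real ((real (d ! (l * R + r)) + 1) / (real A * weight d l)))"
    unfolding sum_nat_blocks
  proof (intro sum.cong refl)
    fix l r assume "r \<in> {..<R}"
    then have div: "(l * R + r) div R = l" by simp
    have sq: "complex_of_real (sqrt x / sqrt y) * complex_of_real (sqrt x / sqrt y) = of_real (x / y)" if "0 \<le> x" "0 \<le> y" for x y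
      using that by (simp flip: of_real_mult)
    have "cnj (amp m d (l * R + r)) * amp m' d (l * R + r) = cis (phase m' (l * R + r)) * cnj (cis (phase m (l * R + r)))
      * (complex_of_real (sqrt (real (d ! (l * R + r)) + 1) / sqrt (real A * weight d l))
        * complex_of_real (sqrt (real (d ! (l * R + r)) + 1) / sqrt (real A * weight d l)))"
      unfolding amp_def div complex_cnj_mult complex_cnj_complex_of_real by (simp only: mult_ac)
    also have "\<dots> = cis (2 * pi * real m' * real l / real A) * cnj (cis (2 * pi * real m * real l / real A))
        * of_real ((real (d ! (l * R + r)) + 1) / (real A * weight d l))"
      using weight_pos[of d l] by (subst sq) (auto simp: phase_def div)
    finally show "cnj (amp m d (l * R + r)) * amp m' d (l * R + r) = cis (2 * pi * real m' * real l / real A) * cnj (cis (2 * pi * real m * real l / real A))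
        * of_real ((real (d ! (l * R + r)) + 1) / (real A * weight d l))" .
  qed
  also have "\<dots> = (\<Sum>l<A. cis (2 * pi * real m' * real l / real A) * cnj (cis (2 * pi * real m * real l / real A)) * of_real (1 / real A))"
  proof (intro sum.cong refl)
    fix l
    have *: "(\<Sum>r<R. (real (d ! (l * R + r)) + 1) / (real A * weight d l)) = 1 / real A"
      using weight_pos[of d l] A by (simp add: sum_divide_distrib[symmetric] weight_def[symmetric])
    show "(\<Sum>r<R. cis (2 * pi * real m' * real l / real A) * cnj (cis (2 * pi * real m * real l / real A))
        * of_real ((real (d ! (l * R + r)) + 1) / (real A * weight d l))) =
      cis (2 * pi * real m' * real l / real A) * cnj (cis (2 * pi * real m * real l / real A)) * of_real (1 / real A)"
      by (simp only: sum_distrib_left[symmetric] of_real_sum[symmetric] *)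
  qed
  also have "\<dots> = (if m = m' then 1 else 0)"
    using A unfolding sum_distrib_right[symmetric] sum_roots_of_unity[OF assms(3,4)] by simp
  finally show ?thesis by simp
qed

text \<open>Outcome \<open>A\<close> is the erasure: everything orthogonal to the kets, in
  particular zero or several idler photons and patterns outside \<open>D\<close>.\<close>

definition outcome :: "nat \<Rightarrow> (nat list \<times> nat list) op" where
  "outcome a = (if a < A then (\<lambda>x z. \<Sum>d\<in>D. ket a d x * cnj (ket a d z))
     else (\<lambda>x z. op_id x z - (\<Sum>k\<in>{..<A} \<times> D. ket (fst k) (snd k) x * cnj (ket (fst k) (snd k) z))))"

lemma outcome_complete: "(\<Sum>a\<le>A. outcome a x z) = op_id x z"
proof -
  have "(\<Sum>a<A. outcome a x z) = (\<Sum>k\<in>{..<A} \<times> D. ket (fst k) (snd k) x * cnj (ket (fst k) (snd k) z))"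
    by (simp add: outcome_def sum.cartesian_product case_prod_unfold)
  moreover have "(\<Sum>a\<le>A. outcome a x z) = (\<Sum>a<A. outcome a x z) + outcome A x z"
    by (simp add: lessThan_Suc_atMost[symmetric])
  ultimately show ?thesis by (simp add: outcome_def)
qed

lemma op_pos_outcome: "op_pos S (outcome a)"
proof (cases "a < A")
  case True
  then show ?thesis unfolding outcome_def by (auto intro!: op_pos_sum op_pos_rank1)
next
  case False
  have "op_pos S (\<lambda>x z. op_id x z - (\<Sum>k\<in>{..<A} \<times> D. ket (fst k) (snd k) x * cnj (ket (fst k) (snd k) z)))"
    using D supp by (intro op_pos_complement_orthonormal[where G = supp]) (auto simp: ket_outside ket_orthonormal split: if_splits)
  then show ?thesis using False by (simp add: outcome_def)
qed

lemma outcome_trace_symbol: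
  assumes "a < A"
  shows "has_trace (fock (A * R) \<times> fock (A * R)) (outcome a) \<rho> (\<Sum>d\<in>D. op_form supp \<rho> (ket a d) (ket a d))"
proof -
  have "has_trace (fock (A * R) \<times> fock (A * R)) (outcome a) \<rho> (\<Sum>x\<in>supp. \<Sum>z\<in>supp. outcome a x z * \<rho> z x)"
    using assms supp by (intro has_trace_finite) (auto simp: outcome_def ket_outside intro!: sum.neutral)
  also have "(\<Sum>x\<in>supp. \<Sum>z\<in>supp. outcome a x z * \<rho> z x) = (\<Sum>x\<in>supp. \<Sum>z\<in>supp. \<Sum>d\<in>D. cnj (ket a d z) * \<rho> z x * ket a d x)"
    using assms by (simp add: outcome_def sum_distrib_right sum_distrib_left mult_ac)
  also have "\<dots> = (\<Sum>z\<in>supp. \<Sum>x\<in>supp. \<Sum>d\<in>D. cnj (ket a d z) * \<rho> z x * ket a d x)"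
    by (rule sum.swap)
  also have "\<dots> = (\<Sum>z\<in>supp. \<Sum>d\<in>D. \<Sum>x\<in>supp. cnj (ket a d z) * \<rho> z x * ket a d x)"
    by (intro sum.cong refl sum.swap)
  also have "\<dots> = (\<Sum>d\<in>D. op_form supp \<rho> (ket a d) (ket a d))"
    unfolding op_form_def by (rule sum.swap)
  finally show ?thesis .
qed

text \<open>The erasure has infinite rank, so its probability is found by subtracting the symbol
  probabilities from the total trace.\<close>

lemma outcome_trace:
  assumes pos: "op_pos (fock (A * R) \<times> fock (A * R)) \<rho>"
    and tr: "((\<lambda>x. \<rho> x x) has_sum 1) (fock (A * R) \<times> fock (A * R))"
  shows "\<exists>q :: nat \<Rightarrow> real. (\<forall>a\<le>A. 0 \<le> q a \<and> has_trace (fock (A * R) \<times> fock (A * R)) (outcome a) \<rho> (of_real (q a)))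
    \<and> (\<Sum>a\<le>A. q a) = 1 \<and> (\<forall>a<A. q a = (\<Sum>d\<in>D. Re (op_form supp \<rho> (ket a d) (ket a d))))"
proof -
  let ?S = "fock (A * R) \<times> fock (A * R)"
  define q' where "q' a = (\<Sum>d\<in>D. Re (op_form supp \<rho> (ket a d) (ket a d)))" for a
  define q where "q a = (if a < A then q' a else 1 - (\<Sum>a<A. q' a))" for a
  have form: "op_form supp \<rho> (ket a d) (ket a d) = of_real (Re (op_form supp \<rho> (ket a d) (ket a d)))"
    "0 \<le> Re (op_form supp \<rho> (ket a d) (ket a d))" for a d
    using pos supp by (auto simp: op_pos_def complex_eq_iff)
  have sym: "has_trace ?S (outcome a) \<rho> (of_real (q' a))" if "a < A" for a
    using outcome_trace_symbol[OF that, of \<rho>] form(1) by (simp add: q'_def)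
  define P where "P x z = (\<Sum>k\<in>{..<A} \<times> D. ket (fst k) (snd k) x * cnj (ket (fst k) (snd k) z))" for x z
  have P: "P x z = (\<Sum>a<A. outcome a x z)" for x z
    by (simp add: P_def outcome_def sum.cartesian_product case_prod_unfold)
  have P0: "P x z = 0" if "x \<notin> supp \<or> z \<notin> supp" for x z
    unfolding P_def using that by (intro sum.neutral) (auto simp: ket_outside)
  have trP: "(\<Sum>x\<in>supp. \<Sum>z\<in>supp. P x z * \<rho> z x) = of_real (\<Sum>a<A. q' a)"
  proof -
    have "(\<Sum>x\<in>supp. \<Sum>z\<in>supp. P x z * \<rho> z x) = (\<Sum>x\<in>supp. \<Sum>a<A. \<Sum>z\<in>supp. outcome a x z * \<rho> z x)"
      unfolding P sum_distrib_right by (intro sum.cong refl sum.swap)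
    also have "\<dots> = (\<Sum>a<A. \<Sum>x\<in>supp. \<Sum>z\<in>supp. outcome a x z * \<rho> z x)" by (rule sum.swap)
    also have "\<dots> = (\<Sum>a<A. of_real (q' a))"
    proof (intro sum.cong refl)
      fix a assume a: "a \<in> {..<A}"
      have "has_trace ?S (outcome a) \<rho> (\<Sum>x\<in>supp. \<Sum>z\<in>supp. outcome a x z * \<rho> z x)"
        using a supp by (intro has_trace_finite) (auto simp: outcome_def ket_outside intro!: sum.neutral)
      from has_trace_op_trace[OF this] has_trace_op_trace[OF sym] a
      show "(\<Sum>x\<in>supp. \<Sum>z\<in>supp. outcome a x z * \<rho> z x) = of_real (q' a)"
        by simp
    qed
    finally show ?thesis by simp
  qed
  have erasure: "has_trace ?S (outcome A) \<rho> (of_real (1 - (\<Sum>a<A. q' a)))"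
  proof -
    have "has_trace ?S P \<rho> (of_real (\<Sum>a<A. q' a))"
      unfolding trP[symmetric] by (rule has_trace_finite[OF supp P0])
    from has_trace_diff[OF has_trace_id[where \<rho> = \<rho>, OF tr] this] show ?thesis
      by (simp add: outcome_def P_def)
  qed
  \<comment> \<open>The erasure element is compared with the state on the finite set
    \<open>supp\<close> only, where the trace is a finite sum and the diagonal of the state sums to
    at most 1.\<close>
  have le: "(\<Sum>a<A. q' a) \<le> 1"
  proof -
    have "op_pos supp (outcome A)" "op_pos supp \<rho>"
      using op_pos_outcome op_pos_subset[OF pos supp(2)] by auto
    then have "0 \<le> Re (\<Sum>x\<in>supp. \<Sum>z\<in>supp. outcome A x z * \<rho> z x)"
      using op_pos_trace_nonneg[OF supp(1)] by blast
    also have "(\<Sum>x\<in>supp. \<Sum>z\<in>supp. outcome A x z * \<rho> z x) = (\<Sum>x\<in>supp. \<rho> x x) - of_real (\<Sum>a<A. q' a)"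
    proof -
      have "(\<Sum>z\<in>supp. op_id x z * \<rho> z x) = \<rho> x x" if "x \<in> supp" for x
      proof -
        have "(\<Sum>z\<in>supp. op_id x z * \<rho> z x) = (\<Sum>z\<in>{x}. op_id x z * \<rho> z x)"
          using supp that by (intro sum.mono_neutral_right) (auto simp: op_id_def)
        then show ?thesis by (simp add: op_id_def)
      qed
      then show ?thesis
        unfolding trP[symmetric] by (simp add: outcome_def P_def left_diff_distrib sum_subtractf)
    qed
    finally have "(\<Sum>a<A. q' a) \<le> (\<Sum>x\<in>supp. Re (\<rho> x x))" by simp
    also have "\<dots> \<le> 1"
      using has_sum_Re[OF tr] supp op_pos_diag[OF pos]
      by (intro finite_sum_le_has_sum[where f = "\<lambda>x. Re (\<rho> x x)" and S = 1 and A = ?S]) auto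
    finally show ?thesis .
  qed
  have "0 \<le> q' a" for a unfolding q'_def by (intro sum_nonneg form)
  moreover have "(\<Sum>a\<le>A. q a) = 1"
    by (simp add: lessThan_Suc_atMost[symmetric] q_def)
  ultimately show ?thesis
    using sym erasure le by (intro exI[of _ q]) (auto simp: q_def q'_def nat_less_le)
qed

end

section \<open>Lower bound on the probability of recovering the symbol\<close>

section \<open>The success probability of one block\<close>

lemma prod_single_factor:
  fixes c :: "'a :: comm_monoid_mult" and n :: nat
  assumes "j < n"
  shows "(\<Prod>i<n. if i = j then c else 1) = c"
  using assms by simp

locale signal =
  fixes \<eta> N N\<^sub>T N\<^sub>S :: real
  assumes \<eta>: "0 < \<eta>" "\<eta> < 1" and N: "0 < N" and NT: "N\<^sub>T = (1 - \<eta>) * N" and NS: "0 < N\<^sub>S"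
begin

text \<open>The \<open>c\<close> of the superposition in exact form:
  \<open>sqrt (N\<^sub>S / (N\<^sub>S + 1))\<close> is the ratio of the one-photon to the
  zero-photon TMSV coefficient, and the rest comes from \<open>bob_coherence_sums\<close>.\<close>

definition coherence :: real where
  "coherence = sqrt (N\<^sub>S / (N\<^sub>S + 1)) * sqrt \<eta> / (N\<^sub>T + 1)"

abbreviation mode :: "real \<Rightarrow> (nat \<times> nat) op" where
  "mode \<equiv> bob_mode \<eta> N N\<^sub>S"

lemma NT_pos: "0 < N\<^sub>T" using NT \<eta> N by simp

lemma bob_mode_ground: "mode t (p, 0) (p, 0) = of_real (therm N\<^sub>S 0 * therm N\<^sub>T p)"
proof -
  have "bob_term \<eta> N p 0 p 0 sums therm N\<^sub>T p"
    using bob_vacuum_sums[OF \<eta> N NT, of p] by (simp add: bob_term_def[abs_def] power2_eq_square mult.assoc)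
  from bob_term_has_sum[OF \<eta> N this] show ?thesis
    using therm_nonneg[of N\<^sub>S 0] NS by (simp add: bob_mode_def tmsv_coeff_def flip: of_real_mult)
qed

lemma bob_mode_coherence:
  "mode t (Suc p, 1) (p, 0) =
     of_real (therm N\<^sub>S 0 * therm N\<^sub>T p) * (cis t * of_real (coherence * sqrt (real p + 1)))"
proof -
  have "bob_term \<eta> N (Suc p) 1 p 0 sums (sqrt \<eta> * sqrt (real (Suc p)) * therm N\<^sub>T p / (N\<^sub>T + 1))"
    using bob_coherence_sums[OF \<eta> N NT, of p] by (simp add: bob_term_def[abs_def])
  note s = bob_term_has_sum[OF \<eta> N this]
  have c: "tmsv_coeff N\<^sub>S 1 * tmsv_coeff N\<^sub>S 0 = therm N\<^sub>S 0 * sqrt (N\<^sub>S / (N\<^sub>S + 1))"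
  proof -
    have "therm N\<^sub>S 1 * therm N\<^sub>S 0 = (therm N\<^sub>S 0)\<^sup>2 * (N\<^sub>S / (N\<^sub>S + 1))"
      using NS by (simp add: therm_eq power2_eq_square)
    then have "tmsv_coeff N\<^sub>S 1 * tmsv_coeff N\<^sub>S 0 = sqrt ((therm N\<^sub>S 0)\<^sup>2) * sqrt (N\<^sub>S / (N\<^sub>S + 1))"
      unfolding tmsv_coeff_def by (simp only: real_sqrt_mult[symmetric])
    then show ?thesis using therm_nonneg[of N\<^sub>S 0] NS by simp
  qed
  have "mode t (Suc p, 1) (p, 0) = cis t * of_real (tmsv_coeff N\<^sub>S 1 * tmsv_coeff N\<^sub>S 0) *
      of_real (sqrt \<eta> * sqrt (real (Suc p)) * therm N\<^sub>T p / (N\<^sub>T + 1))"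
    unfolding bob_mode_def prod.case s by (simp add: cis_conv_exp)
  also have "\<dots> = cis t * of_real ((tmsv_coeff N\<^sub>S 1 * tmsv_coeff N\<^sub>S 0) * (sqrt \<eta> * sqrt (real (Suc p)) * therm N\<^sub>T p / (N\<^sub>T + 1)))"
    by simp
  also have "(tmsv_coeff N\<^sub>S 1 * tmsv_coeff N\<^sub>S 0) * (sqrt \<eta> * sqrt (real (Suc p)) * therm N\<^sub>T p / (N\<^sub>T + 1)) =
      (therm N\<^sub>S 0 * therm N\<^sub>T p) * (coherence * sqrt (real p + 1))"
    unfolding c by (simp add: coherence_def add.commute)
  finally show ?thesis by (simp add: mult_ac)
qed

text \<open>The excited population is not computed. The minor that joins it to the ground population
  and the coherence already forces it to be at least that of the pure superposition.\<close>

lemma bob_mode_excited: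
  "\<exists>h. mode t (Suc p, 1) (Suc p, 1) = of_real (therm N\<^sub>S 0 * therm N\<^sub>T p * h)
     \<and> coherence\<^sup>2 * (real p + 1) \<le> h"
proof -
  define a where "a = therm N\<^sub>S 0 * therm N\<^sub>T p"
  let ?x = "(Suc p, 1) :: nat \<times> nat" and ?y = "(p, 0) :: nat \<times> nat"
  let ?s = "mode t"
  have a: "0 < a" unfolding a_def using NS NT_pos by (intro mult_pos_pos therm_pos)
  have pos: "op_pos UNIV ?s" using op_pos_bob_mode[OF \<eta> N] .
  define X where "X = Re (?s ?x ?x)"
  have "?s ?x ?x = of_real X"
    using op_pos_diag[OF pos, of ?x] by (simp add: X_def complex_eq_iff)
  then have "?s ?x ?x = of_real (a * (X / a))" using a by simp
  moreover have "coherence\<^sup>2 * (real p + 1) \<le> X / a"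
  proof -
    have "(cmod (?s ?x ?y))\<^sup>2 = a\<^sup>2 * (coherence\<^sup>2 * (real p + 1))"
      unfolding bob_mode_coherence a_def[symmetric] by (simp add: norm_mult power_mult_distrib)
    then have "a\<^sup>2 * (coherence\<^sup>2 * (real p + 1)) \<le> X * a"
      using op_pos_minor[OF pos, of ?x ?y] unfolding bob_mode_ground a_def[symmetric] X_def by simp
    also have "X * a = a\<^sup>2 * (X / a)" using a by (simp add: power2_eq_square)
    finally show ?thesis using a by (subst (asm) mult_le_cancel_left_pos) auto
  qed
  ultimately show ?thesis unfolding a_def by blast
qed

end

locale signal_block = signal + block
begin

abbreviation state :: "nat \<Rightarrow> (nat list \<times> nat list) op" where
  "state m \<equiv> tensor_modes2 (A * R) (\<lambda>j. mode (phase m j))"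

text \<open>Weight of the state with empty idlers and counts \<open>d\<close> at Bob; the entries
  within pattern \<open>d\<close> are expressed relative to it.\<close>

definition ground :: "nat list \<Rightarrow> real" where
  "ground d = (\<Prod>i<A * R. therm N\<^sub>S 0 * therm N\<^sub>T (d ! i))"

definition \<beta> :: "nat \<Rightarrow> nat list \<Rightarrow> nat \<Rightarrow> complex" where
  "\<beta> m d j = cis (phase m j) * of_real (coherence * sqrt (real (d ! j) + 1))"

lemma excite_nth:
  assumes "length d = A * R" "i < A * R"
  shows "fst (excite d j) ! i = (if i = j then Suc (d ! i) else d ! i)"
    "snd (excite d j) ! i = (if i = j then 1 else 0)"
  using assms by (auto simp: excite_def nth_list_update)

lemma state_eq: "state m x z = (\<Prod>i<A * R. mode (phase m i) (fst x ! i, snd x ! i) (fst z ! i, snd z ! i))"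
  by (simp add: tensor_modes2_def case_prod_unfold)

text \<open>Mode \<open>j\<close> supplies a coherence, mode \<open>k\<close> a conjugate one, and
  all other modes a ground population. Off the diagonal the state is thus exactly the rank-one
  matrix of \<open>\<beta> m d\<close>, without error term.\<close>

lemma state_offdiag:
  assumes d: "length d = A * R" and jk: "j < A * R" "k < A * R" "j \<noteq> k"
  shows "state m (excite d j) (excite d k) = of_real (ground d) * (\<beta> m d j * cnj (\<beta> m d k))"
proof -
  have coh: "mode (phase m i) (Suc (d ! i), 1) (d ! i, 0) = of_real (therm N\<^sub>S 0 * therm N\<^sub>T (d ! i)) * \<beta> m d i" for i
    unfolding bob_mode_coherence \<beta>_def ..
  have coh': "mode (phase m i) (d ! i, 0) (Suc (d ! i), 1) = of_real (therm N\<^sub>S 0 * therm N\<^sub>T (d ! i)) * cnj (\<beta> m d i)" for i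
    using op_pos_hermitian[OF op_pos_bob_mode[OF \<eta> N, of N\<^sub>S "phase m i"], of "(Suc (d ! i), 1)" "(d ! i, 0)"] coh[of i]
    by simp
  have "state m (excite d j) (excite d k) = (\<Prod>i<A * R. of_real (therm N\<^sub>S 0 * therm N\<^sub>T (d ! i))
      * (if i = j then \<beta> m d j else 1) * (if i = k then cnj (\<beta> m d k) else 1))"
    unfolding state_eq
  proof (intro prod.cong refl)
    fix i assume "i \<in> {..<A * R}"
    then show "mode (phase m i) (fst (excite d j) ! i, snd (excite d j) ! i) (fst (excite d k) ! i, snd (excite d k) ! i) =
      of_real (therm N\<^sub>S 0 * therm N\<^sub>T (d ! i)) * (if i = j then \<beta> m d j else 1) * (if i = k then cnj (\<beta> m d k) else 1)"
      using jk coh[of i] coh'[of i] bob_mode_ground[of "phase m i" "d ! i"]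
      by (auto simp: excite_nth[OF d])
  qed
  also have "\<dots> = of_real (ground d) * (\<beta> m d j * cnj (\<beta> m d k))"
    unfolding prod.distrib prod_single_factor[OF jk(1)] prod_single_factor[OF jk(2)] by (simp add: ground_def)
  finally show ?thesis .
qed

lemma state_diag:
  assumes d: "length d = A * R" and j: "j < A * R"
  shows "\<exists>g. 0 \<le> g \<and> state m (excite d j) (excite d j) = of_real (ground d) * (\<beta> m d j * cnj (\<beta> m d j)) + of_real g"
proof -
  obtain h where h: "mode (phase m j) (Suc (d ! j), 1) (Suc (d ! j), 1) = of_real (therm N\<^sub>S 0 * therm N\<^sub>T (d ! j) * h)"
    "coherence\<^sup>2 * (real (d ! j) + 1) \<le> h"
    using bob_mode_excited by blast
  have g0: "0 \<le> ground d" unfolding ground_def using NS NT_pos by (intro prod_nonneg) (auto simp: therm_nonneg)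
  have "state m (excite d j) (excite d j) = (\<Prod>i<A * R. of_real (therm N\<^sub>S 0 * therm N\<^sub>T (d ! i)) * (if i = j then of_real h else 1))"
    unfolding state_eq
  proof (intro prod.cong refl)
    fix i assume "i \<in> {..<A * R}"
    then show "mode (phase m i) (fst (excite d j) ! i, snd (excite d j) ! i) (fst (excite d j) ! i, snd (excite d j) ! i) =
      of_real (therm N\<^sub>S 0 * therm N\<^sub>T (d ! i)) * (if i = j then of_real h else 1)"
      using h(1) bob_mode_ground[of "phase m i" "d ! i"] by (auto simp: excite_nth[OF d])
  qed
  also have "\<dots> = of_real (ground d) * of_real h"
    unfolding prod.distrib prod_single_factor[OF j] by (simp add: ground_def)
  finally have 1: "state m (excite d j) (excite d j) = of_real (ground d * h)" by simp
  have "\<beta> m d j * cnj (\<beta> m d j) = of_real ((cmod (\<beta> m d j))\<^sup>2)"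
    by (simp only: complex_norm_square)
  also have "(cmod (\<beta> m d j))\<^sup>2 = coherence\<^sup>2 * (real (d ! j) + 1)"
    by (simp add: \<beta>_def norm_mult power_mult_distrib)
  finally have 2: "\<beta> m d j * cnj (\<beta> m d j) = of_real (coherence\<^sup>2 * (real (d ! j) + 1))" .
  show ?thesis
  proof (intro exI conjI)
    show "0 \<le> ground d * (h - coherence\<^sup>2 * (real (d ! j) + 1))" using h(2) g0 by simp
    show "state m (excite d j) (excite d j) = of_real (ground d) * (\<beta> m d j * cnj (\<beta> m d j)) +
        of_real (ground d * (h - coherence\<^sup>2 * (real (d ! j) + 1)))"
      unfolding 1 2 by (simp add: algebra_simps)
  qed
qed

text \<open>For the matching symbol all phases cancel, and group \<open>l\<close> contributes its
  weight divided by the square root of that weight.\<close>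

lemma overlap:
  "(\<Sum>j<A * R. cnj (amp m d j) * \<beta> m d j) = of_real (coherence * (\<Sum>l<A. sqrt (weight d l)) / sqrt (real A))"
proof -
  have "(\<Sum>j<A * R. cnj (amp m d j) * \<beta> m d j) =
      (\<Sum>l<A. \<Sum>r<R. complex_of_real (coherence / sqrt (real A) * ((real (d ! (l * R + r)) + 1) / sqrt (weight d l))))"
    unfolding sum_nat_blocks
  proof (intro sum.cong refl)
    fix l r assume "r \<in> {..<R}"
    then have div: "(l * R + r) div R = l" by simp
    let ?j = "l * R + r"
    have "cnj (amp m d ?j) * \<beta> m d ?j = (cnj (cis (phase m ?j)) * cis (phase m ?j)) *
        of_real (sqrt (real (d ! ?j) + 1) / sqrt (real A * weight d l) * (coherence * sqrt (real (d ! ?j) + 1)))"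
      by (simp add: amp_def \<beta>_def div)
    also have "cnj (cis (phase m ?j)) * cis (phase m ?j) = 1"
      by (simp add: cis_cnj cis_mult)
    also have "sqrt (real (d ! ?j) + 1) / sqrt (real A * weight d l) * (coherence * sqrt (real (d ! ?j) + 1)) =
        coherence * (sqrt (real (d ! ?j) + 1) * sqrt (real (d ! ?j) + 1)) / (sqrt (real A) * sqrt (weight d l))"
      by (simp only: real_sqrt_mult) (simp add: mult_ac)
    also have "sqrt (real (d ! ?j) + 1) * sqrt (real (d ! ?j) + 1) = real (d ! ?j) + 1" by simp
    finally show "cnj (amp m d ?j) * \<beta> m d ?j = of_real (coherence / sqrt (real A) * ((real (d ! ?j) + 1) / sqrt (weight d l)))"
      by simp
  qed
  also have "\<dots> = of_real (\<Sum>l<A. coherence / sqrt (real A) * ((\<Sum>r<R. real (d ! (l * R + r)) + 1) / sqrt (weight d l)))"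
    by (simp only: of_real_sum sum_distrib_left sum_divide_distrib)
  also have "(\<Sum>l<A. coherence / sqrt (real A) * ((\<Sum>r<R. real (d ! (l * R + r)) + 1) / sqrt (weight d l))) =
      (\<Sum>l<A. coherence / sqrt (real A) * sqrt (weight d l))"
    using weight_pos[of d] unfolding weight_def[symmetric] by (intro sum.cong refl) (simp add: real_div_sqrt less_imp_le)
  also have "\<dots> = coherence * (\<Sum>l<A. sqrt (weight d l)) / sqrt (real A)"
    by (simp only: sum_distrib_left[symmetric]) simp
  finally show ?thesis .
qed

text \<open>Within pattern \<open>d\<close> the state is \<open>ground d\<close> times the
  projector-like matrix of \<open>\<beta> m d\<close> plus a nonnegative diagonal, so the form is at
  least \<open>ground d\<close> times the squared overlap.\<close>

lemma success_ge:
  assumes "d \<in> D"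
  shows "coherence\<^sup>2 * (ground d * ((\<Sum>l<A. sqrt (weight d l))\<^sup>2 / real A)) \<le> Re (op_form supp (state m) (ket m d) (ket m d))"
proof -
  have d: "length d = A * R" using length_D[OF assms] .
  have "\<forall>j. \<exists>g. j < A * R \<longrightarrow> 0 \<le> g \<and> state m (excite d j) (excite d j) = of_real (ground d) * (\<beta> m d j * cnj (\<beta> m d j)) + of_real g"
    using state_diag[OF d] by blast
  then obtain g where g: "\<And>j. j < A * R \<Longrightarrow> 0 \<le> g j"
    "\<And>j. j < A * R \<Longrightarrow> state m (excite d j) (excite d j) = of_real (ground d) * (\<beta> m d j * cnj (\<beta> m d j)) + of_real (g j)"
    by metis
  let ?c = "\<Sum>j<A * R. cnj (amp m d j) * \<beta> m d j"
  have "op_form supp (state m) (ket m d) (ket m d) = (\<Sum>x\<in>supp. cnj (ket m d x) * (\<Sum>z\<in>supp. state m x z * ket m d z))"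
    by (simp add: op_form_def sum_distrib_left mult.assoc)
  also have "\<dots> = (\<Sum>j<A * R. cnj (amp m d j) * (\<Sum>k<A * R. state m (excite d j) (excite d k) * amp m d k))"
    unfolding sum_ket[OF assms] by (rule sum_cnj_ket[OF assms])
  also have "\<dots> = (\<Sum>j<A * R. \<Sum>k<A * R. of_real (ground d) * ((cnj (amp m d j) * \<beta> m d j) * cnj (cnj (amp m d k) * \<beta> m d k))
      + (if k = j then of_real (g j * (cmod (amp m d j))\<^sup>2) else 0))"
    unfolding sum_distrib_left
  proof (intro sum.cong refl)
    fix j k assume jk: "j \<in> {..<A * R}" "k \<in> {..<A * R}"
    show "cnj (amp m d j) * (state m (excite d j) (excite d k) * amp m d k) =
      of_real (ground d) * ((cnj (amp m d j) * \<beta> m d j) * cnj (cnj (amp m d k) * \<beta> m d k))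
      + (if k = j then of_real (g j * (cmod (amp m d j))\<^sup>2) else 0)"
    proof (cases "k = j")
      case True
      have "complex_of_real (g j * (cmod (amp m d j))\<^sup>2) = of_real (g j) * (amp m d j * cnj (amp m d j))"
        by (simp only: of_real_mult complex_norm_square)
      note e = this
      show ?thesis using jk unfolding True e by (simp add: g(2) algebra_simps)
    next
      case False
      then show ?thesis using jk state_offdiag[OF d, of j k m] by (simp add: mult_ac)
    qed
  qed
  also have "\<dots> = of_real (ground d) * (?c * cnj ?c) + (\<Sum>j<A * R. of_real (g j * (cmod (amp m d j))\<^sup>2))"
  proof -
    have "(\<Sum>j<A * R. \<Sum>k<A * R. of_real (ground d) * ((cnj (amp m d j) * \<beta> m d j) * cnj (cnj (amp m d k) * \<beta> m d k)))
        = of_real (ground d) * (?c * cnj ?c)"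
      unfolding cnj_sum sum_product by (simp only: sum_distrib_left)
    moreover have "(\<Sum>j<A * R. \<Sum>k<A * R. if k = j then complex_of_real (g j * (cmod (amp m d j))\<^sup>2) else 0) =
        (\<Sum>j<A * R. of_real (g j * (cmod (amp m d j))\<^sup>2))"
      by (intro sum.cong refl) simp
    ultimately show ?thesis by (simp only: sum.distrib)
  qed
  also have "?c * cnj ?c = of_real ((coherence * (\<Sum>l<A. sqrt (weight d l)) / sqrt (real A))\<^sup>2)"
    unfolding overlap by (simp only: complex_cnj_complex_of_real of_real_mult[symmetric] power2_eq_square)
  finally have "Re (op_form supp (state m) (ket m d) (ket m d)) =
      ground d * (coherence * (\<Sum>l<A. sqrt (weight d l)) / sqrt (real A))\<^sup>2 + (\<Sum>j<A * R. g j * (cmod (amp m d j))\<^sup>2)"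
    by simp
  moreover have "0 \<le> (\<Sum>j<A * R. g j * (cmod (amp m d j))\<^sup>2)" using g(1) by (intro sum_nonneg) auto
  moreover have "ground d * (coherence * (\<Sum>l<A. sqrt (weight d l)) / sqrt (real A))\<^sup>2 =
      coherence\<^sup>2 * (ground d * ((\<Sum>l<A. sqrt (weight d l))\<^sup>2 / real A))"
    by (simp add: power_mult_distrib power_divide)
  ultimately show ?thesis by simp
qed

end

section \<open>Thermal moments and the mean success weight\<close>

section \<open>Moments of thermal statistics\<close>

text \<open>Mean and variance come from the series of \<open>z ^ k\<close> with weights
  \<open>1\<close>, \<open>k + 1\<close> and \<open>(k + 1) * (k + 2)\<close>. The centred first
  moment changes sign, so its absolute summability is taken from the second.\<close>

lemma therm_moments:
  assumes "0 < N"
  shows "((\<lambda>k. therm N k * (real k - N)) has_sum 0) UNIV"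
    and "((\<lambda>k. therm N k * (real k - N)\<^sup>2) has_sum (N * (N + 1))) UNIV"
proof -
  define z where "z = N / (N + 1)"
  have z: "0 < z" "z < 1" "1 - z = 1 / (N + 1)" using assms by (auto simp: z_def divide_simps)
  have th: "therm N k = z ^ k / (N + 1)" for k using assms by (simp add: therm_eq z_def)
  have s0: "(\<lambda>k. z ^ k) sums (N + 1)"
    using geometric_sums[of z] z by simp
  have s1: "(\<lambda>k. (real k + 1) * z ^ k) sums (N + 1)\<^sup>2"
    using geometric_deriv_sums[of z] z by (simp add: power_divide add.commute)
  have s2: "(\<lambda>k. (real k + 1) * (real k + 2) * z ^ k) sums (2 * (N + 1) ^ 3)"
  proof -
    \<comment> \<open>Multiplying the derived series once more by the geometric series produces the
      triangular numbers.\<close>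
    have "(\<lambda>k. \<Sum>i\<le>k. (real i + 1) * z ^ i * z ^ (k - i)) sums ((\<Sum>k. (real k + 1) * z ^ k) * (\<Sum>k. z ^ k))"
      using s0 s1 z by (intro Cauchy_product_sums) (auto simp: sums_iff abs_mult)
    also have "(\<Sum>k. (real k + 1) * z ^ k) * (\<Sum>k. z ^ k) = (N + 1) ^ 3"
      using s0 s1 by (simp add: sums_iff power2_eq_square power3_eq_cube)
    also have "(\<lambda>k. \<Sum>i\<le>k. (real i + 1) * z ^ i * z ^ (k - i)) = (\<lambda>k. (real k + 1) * (real k + 2) / 2 * z ^ k)"
    proof
      fix k
      have "(\<Sum>i\<le>k. (real i + 1) * z ^ i * z ^ (k - i)) = (\<Sum>i\<le>k. (real i + 1)) * z ^ k"
        unfolding sum_distrib_right by (intro sum.cong refl) (simp add: mult.assoc flip: power_add)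
      also have "(\<Sum>i\<le>k. (real i + 1)) = (real k + 1) * (real k + 2) / 2"
        by (induction k) (simp_all add: field_simps)
      finally show "(\<Sum>i\<le>k. (real i + 1) * z ^ i * z ^ (k - i)) = (real k + 1) * (real k + 2) / 2 * z ^ k" .
    qed
    finally have "(\<lambda>k. (real k + 1) * (real k + 2) / 2 * z ^ k) sums ((N + 1) ^ 3)" .
    from sums_mult[OF this, of 2] show ?thesis by (simp add: mult.assoc)
  qed
  have "(\<lambda>k. ((real k + 1) * (real k + 2) * z ^ k - (2 * N + 3) * ((real k + 1) * z ^ k) + (N + 1)\<^sup>2 * z ^ k) / (N + 1)) sums
      ((2 * (N + 1) ^ 3 - (2 * N + 3) * (N + 1)\<^sup>2 + (N + 1)\<^sup>2 * (N + 1)) / (N + 1))"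
    by (intro sums_divide sums_add sums_diff sums_mult s0 s1 s2)
  also have "(2 * (N + 1) ^ 3 - (2 * N + 3) * (N + 1)\<^sup>2 + (N + 1)\<^sup>2 * (N + 1)) / (N + 1) = N * (N + 1)"
    using assms by (simp add: divide_eq_eq power2_eq_square power3_eq_cube algebra_simps)
  also have "(\<lambda>k. ((real k + 1) * (real k + 2) * z ^ k - (2 * N + 3) * ((real k + 1) * z ^ k) + (N + 1)\<^sup>2 * z ^ k) / (N + 1)) =
      (\<lambda>k. therm N k * (real k - N)\<^sup>2)"
  proof
    fix k
    have "a * z ^ k - b * (c * z ^ k) + e * z ^ k = z ^ k * (a - b * c + e)" for a b c e :: real
      by (simp add: algebra_simps)
    moreover have "(real k + 1) * (real k + 2) - (2 * N + 3) * (real k + 1) + (N + 1)\<^sup>2 = (real k - N)\<^sup>2"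
      by (simp add: power2_eq_square algebra_simps)
    ultimately have "(real k + 1) * (real k + 2) * z ^ k - (2 * N + 3) * ((real k + 1) * z ^ k) + (N + 1)\<^sup>2 * z ^ k = z ^ k * (real k - N)\<^sup>2"
      by simp
    then show "((real k + 1) * (real k + 2) * z ^ k - (2 * N + 3) * ((real k + 1) * z ^ k) + (N + 1)\<^sup>2 * z ^ k) / (N + 1) =
        therm N k * (real k - N)\<^sup>2"
      by (simp add: th)
  qed
  finally show var: "((\<lambda>k. therm N k * (real k - N)\<^sup>2) has_sum (N * (N + 1))) UNIV"
    using assms by (intro sums_nonneg_imp_has_sum) (auto simp: therm_nonneg)
  have "(\<lambda>k. ((real k + 1) * z ^ k - (N + 1) * z ^ k) / (N + 1)) sums (((N + 1)\<^sup>2 - (N + 1) * (N + 1)) / (N + 1))"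
    by (intro sums_divide sums_diff sums_mult s0 s1)
  also have "(\<lambda>k. ((real k + 1) * z ^ k - (N + 1) * z ^ k) / (N + 1)) = (\<lambda>k. therm N k * (real k - N))"
    unfolding th by (simp add: fun_eq_iff algebra_simps)
  finally have m: "(\<lambda>k. therm N k * (real k - N)) sums 0" by (simp add: power2_eq_square)
  have "(\<lambda>k. therm N k * (real k - N)) abs_summable_on UNIV"
  proof (rule Infinite_Sum.abs_summable_on_comparison_test')
    show "(\<lambda>k. therm N k + therm N k * (real k - N)\<^sup>2) summable_on UNIV"
      using var therm_has_sum[of N] assms by (intro summable_on_add) (auto intro: has_sum_imp_summable)
    fix k
    have "\<bar>real k - N\<bar> \<le> 1 + (real k - N)\<^sup>2"
    proof -
      have "0 \<le> (\<bar>real k - N\<bar> - 1)\<^sup>2" by simp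
      then have "2 * \<bar>real k - N\<bar> \<le> 1 + (real k - N)\<^sup>2"
        unfolding power2_diff[of "\<bar>real k - N\<bar>" 1] by simp
      moreover have "\<bar>real k - N\<bar> \<le> 2 * \<bar>real k - N\<bar>" by simp
      ultimately show ?thesis by (rule order_trans[rotated])
    qed
    then show "norm (therm N k * (real k - N)) \<le> therm N k + therm N k * (real k - N)\<^sup>2"
      using mult_left_mono[of "\<bar>real k - N\<bar>" "1 + (real k - N)\<^sup>2" "therm N k"] therm_nonneg[of N k] assms
      by (simp add: abs_mult distrib_left)
  qed
  then show "((\<lambda>k. therm N k * (real k - N)) has_sum 0) UNIV"
    by (rule norm_summable_imp_has_sum[OF summable_on_imp_summable m])
qed

lemma therm_product_moments:
  assumes N: "0 < N" and jk: "j < n" "k < n"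
  shows "((\<lambda>d. \<Prod>i<n. therm N (d ! i)) has_sum 1) (fock n)"
    and "((\<lambda>d. (\<Prod>i<n. therm N (d ! i)) * (real (d ! j) - N)) has_sum 0) (fock n)"
    and "((\<lambda>d. (\<Prod>i<n. therm N (d ! i)) * ((real (d ! j) - N) * (real (d ! k) - N))) has_sum
      (if j = k then N * (N + 1) else 0)) (fock n)"
proof -
  note m0 = therm_has_sum[of N] and m1 = therm_moments(1)[OF N] and m2 = therm_moments(2)[OF N]
  have gen: "((\<lambda>d. \<Prod>i<n. f i (d ! i)) has_sum (\<Prod>i<n. s i)) (fock n)"
    if "\<And>i. (f i has_sum s i) UNIV" for f :: "nat \<Rightarrow> nat \<Rightarrow> real" and s
  proof -
    have "f i abs_summable_on UNIV" for i
      by (rule summable_on_iff_abs_summable_on_real[THEN iffD1, OF has_sum_imp_summable[OF that]])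
    from has_sum_prod_fock[of n f, OF this] show ?thesis by (simp add: infsumI[OF that])
  qed
  show "((\<lambda>d. \<Prod>i<n. therm N (d ! i)) has_sum 1) (fock n)"
    using gen[of "\<lambda>_. therm N" "\<lambda>_. 1"] m0 N by simp
  have "((\<lambda>d. \<Prod>i<n. therm N (d ! i) * (if i = j then real (d ! i) - N else 1)) has_sum (\<Prod>i<n. if i = j then 0 else 1)) (fock n)"
    using m0 m1 N by (intro gen[of "\<lambda>i a. therm N a * (if i = j then real a - N else 1)"]) auto
  moreover have "(\<Prod>i<n. therm N (d ! i) * (if i = j then real (d ! i) - N else 1)) = (\<Prod>i<n. therm N (d ! i)) * (real (d ! j) - N)" for d
  proof -
    have "(\<Prod>i<n. if i = j then real (d ! i) - N else 1) = (\<Prod>i<n. if i = j then real (d ! j) - N else 1)"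
      by (intro prod.cong) auto
    then show ?thesis unfolding prod.distrib using jk by simp
  qed
  ultimately show "((\<lambda>d. (\<Prod>i<n. therm N (d ! i)) * (real (d ! j) - N)) has_sum 0) (fock n)"
    using jk by simp
  let ?f = "\<lambda>i a. therm N a * ((if i = j then real a - N else 1) * (if i = k then real a - N else 1))"
  let ?s = "\<lambda>i. if i = j then (if j = k then N * (N + 1) else 0) else if i = k then 0 else 1"
  have "(?f i has_sum ?s i) UNIV" for i
    using m0 m1 m2 N by (auto simp: power2_eq_square)
  from gen[of ?f ?s, OF this] have "((\<lambda>d. \<Prod>i<n. ?f i (d ! i)) has_sum (\<Prod>i<n. ?s i)) (fock n)" .
  moreover have "(\<Prod>i<n. ?f i (d ! i)) = (\<Prod>i<n. therm N (d ! i)) * ((real (d ! j) - N) * (real (d ! k) - N))" for d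
  proof -
    have "(\<Prod>i<n. if i = j then real (d ! i) - N else 1) = (\<Prod>i<n. if i = j then real (d ! j) - N else 1)" for j
      by (intro prod.cong) auto
    then show ?thesis unfolding prod.distrib using jk by simp
  qed
  moreover have "(\<Prod>i<n. ?s i) = (if j = k then N * (N + 1) else 0)"
  proof (cases "j = k")
    case True
    then have "(\<Prod>i<n. ?s i) = (\<Prod>i<n. if i = j then N * (N + 1) else 1)" by (intro prod.cong) auto
    then show ?thesis using True jk by simp
  next
    case False
    then have "(\<Prod>i<n. ?s i) = 0" using jk by (intro prod_zero) auto
    then show ?thesis using False by simp
  qed
  ultimately show "((\<lambda>d. (\<Prod>i<n. therm N (d ! i)) * ((real (d ! j) - N) * (real (d ! k) - N))) has_sum
      (if j = k then N * (N + 1) else 0)) (fock n)"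
    by simp
qed

text \<open>From \<open>\<surd>y \<ge> 1 + (y - 1) / 2 - (y - 1)\<^sup>2 / 2\<close>.\<close>

lemma sum_sqrt_sq_ge:
  fixes S :: "nat \<Rightarrow> real"
  assumes A: "0 < A" and \<mu>: "0 < \<mu>" and S: "\<And>l. 0 \<le> S l"
  shows "(\<Sum>l<A. S l - (S l - \<mu>)\<^sup>2 / \<mu>) \<le> (\<Sum>l<A. sqrt (S l))\<^sup>2 / real A"
proof -
  define x where "x l = (S l - \<mu>) / \<mu>" for l
  \<comment> \<open>With \<open>z = sqrt y\<close>, twice the gap is
    \<open>(z - 1)\<^sup>2 * ((z + 1)\<^sup>2 - 1)\<close>.\<close>
  have *: "1 + (z\<^sup>2 - 1) / 2 - (z\<^sup>2 - 1)\<^sup>2 / 2 \<le> z" if "0 \<le> z" for z :: real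
  proof -
    have "2 * z - (2 + (z\<^sup>2 - 1) - (z\<^sup>2 - 1)\<^sup>2) = (z - 1)\<^sup>2 * ((z + 1)\<^sup>2 - 1)"
      by (simp add: power2_eq_square algebra_simps)
    moreover have "1 \<le> (z + 1)\<^sup>2" using that by (simp add: power2_eq_square algebra_simps)
    ultimately have "0 \<le> 2 * z - (2 + (z\<^sup>2 - 1) - (z\<^sup>2 - 1)\<^sup>2)" by simp
    then show ?thesis by (simp add: field_simps)
  qed
  have le: "sqrt \<mu> * (1 + x l / 2 - (x l)\<^sup>2 / 2) \<le> sqrt (S l)" for l
  proof -
    have "x l = (sqrt (S l / \<mu>))\<^sup>2 - 1" using S[of l] \<mu> by (simp add: x_def diff_divide_distrib)
    then have "1 + x l / 2 - (x l)\<^sup>2 / 2 \<le> sqrt (S l / \<mu>)" using *[of "sqrt (S l / \<mu>)"] S[of l] \<mu> by simp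
    then have "sqrt \<mu> * (1 + x l / 2 - (x l)\<^sup>2 / 2) \<le> sqrt \<mu> * sqrt (S l / \<mu>)"
      using \<mu> by (intro mult_left_mono) auto
    also have "\<dots> = sqrt (S l)" using \<mu> by (simp add: real_sqrt_mult[symmetric])
    finally show ?thesis .
  qed
  define Y where "Y = (\<Sum>l<A. x l - (x l)\<^sup>2) / (2 * real A)"
  have "sqrt \<mu> * real A * (1 + Y) = (\<Sum>l<A. sqrt \<mu> * (1 + x l / 2 - (x l)\<^sup>2 / 2))"
  proof -
    have "(\<Sum>l<A. 1 + x l / 2 - (x l)\<^sup>2 / 2) = (\<Sum>l<A. 1 + (x l - (x l)\<^sup>2) / 2)"
      by (intro sum.cong) (auto simp: diff_divide_distrib)
    also have "\<dots> = real A + (\<Sum>l<A. x l - (x l)\<^sup>2) / 2"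
      by (simp only: sum.distrib sum_divide_distrib[symmetric]) simp
    also have "(\<Sum>l<A. x l - (x l)\<^sup>2) = 2 * real A * Y" using A by (simp add: Y_def)
    finally have *: "(\<Sum>l<A. 1 + x l / 2 - (x l)\<^sup>2 / 2) = real A * (1 + Y)" by (simp add: algebra_simps)
    show ?thesis by (simp only: sum_distrib_left[symmetric] * mult.assoc)
  qed
  also have "\<dots> \<le> (\<Sum>l<A. sqrt (S l))" by (intro sum_mono le)
  finally have T: "sqrt \<mu> * real A * (1 + Y) \<le> (\<Sum>l<A. sqrt (S l))" .
  have "(sqrt \<mu> * real A)\<^sup>2 * (1 + 2 * Y) \<le> (\<Sum>l<A. sqrt (S l))\<^sup>2"
  \<comment> \<open>Squaring \<open>T\<close> needs \<open>0 \<le> 1 + Y\<close>; otherwise the left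
    side is negative anyway.\<close>
  proof (cases "0 \<le> 1 + Y")
    case True
    have "(sqrt \<mu> * real A)\<^sup>2 * (1 + 2 * Y) \<le> (sqrt \<mu> * real A)\<^sup>2 * (1 + Y)\<^sup>2"
      by (intro mult_left_mono) (auto simp: power2_eq_square algebra_simps)
    also have "\<dots> = (sqrt \<mu> * real A * (1 + Y))\<^sup>2" by (simp add: power_mult_distrib)
    also have "\<dots> \<le> (\<Sum>l<A. sqrt (S l))\<^sup>2" using T True \<mu> by (intro power_mono) auto
    finally show ?thesis .
  next
    case False
    then have "(sqrt \<mu> * real A)\<^sup>2 * (1 + 2 * Y) \<le> 0" by (intro mult_nonneg_nonpos) auto
    then show ?thesis by (rule order_trans) simp
  qed
  moreover have "(\<Sum>l<A. S l - (S l - \<mu>)\<^sup>2 / \<mu>) = \<mu> * real A * (1 + 2 * Y)"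
  proof -
    have "S l - (S l - \<mu>)\<^sup>2 / \<mu> = \<mu> + \<mu> * (x l - (x l)\<^sup>2)" for l
      using \<mu> by (simp add: x_def power2_eq_square field_simps)
    then have "(\<Sum>l<A. S l - (S l - \<mu>)\<^sup>2 / \<mu>) = real A * \<mu> + \<mu> * (\<Sum>l<A. x l - (x l)\<^sup>2)"
      by (simp only: sum.distrib sum_distrib_left[symmetric]) simp
    also have "(\<Sum>l<A. x l - (x l)\<^sup>2) = 2 * real A * Y"
      using A by (simp add: Y_def)
    finally show ?thesis by (simp add: algebra_simps)
  qed
  ultimately show ?thesis
    using A \<mu> by (simp add: power_mult_distrib le_divide_eq power2_eq_square mult_ac)
qed

text \<open>Each group weight has mean \<mu> and variance \<open>N * \<mu>\<close>, so by
  \<open>sum_sqrt_sq_ge\<close> the full sum over all patterns is at least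
  \<open>A * (\<mu> - N)\<close>. The claim asks only for \<open>A * (\<mu> - N - 1)\<close>, and
  this strict slack allows a finite partial sum.\<close>

lemma exists_finite_patterns:
  assumes N: "0 < N" and A: "0 < A" and R: "0 < (R :: nat)"
  shows "\<exists>D. finite D \<and> D \<subseteq> fock (A * R) \<and> real (A * R) * (N + 1) * (1 - 1 / real R) \<le>
    (\<Sum>d\<in>D. (\<Prod>i<A * R. therm N (d ! i)) * ((\<Sum>l<A. sqrt (\<Sum>r<R. real (d ! (l * R + r)) + 1))\<^sup>2 / real A))"
proof -
  define \<mu> where "\<mu> = real R * (N + 1)"
  have \<mu>: "0 < \<mu>" using N R by (simp add: \<mu>_def)
  let ?w = "\<lambda>d. \<Prod>i<A * R. therm N (d ! i)"
  let ?S = "\<lambda>d l. \<Sum>r<R. real (d ! (l * R + r)) + 1"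
  let ?G = "\<lambda>d. \<Sum>l<A. ?S d l - (?S d l - \<mu>)\<^sup>2 / \<mu>"
  have idx: "l * R + r < A * R" if "l < A" "r < R" for l r
  proof -
    have "l * R + r < Suc l * R" using that by simp
    also have "\<dots> \<le> A * R" using that by (intro mult_le_mono1) simp
    finally show ?thesis .
  qed
  have Sm: "?S d l - \<mu> = (\<Sum>r<R. real (d ! (l * R + r)) - N)" for d l
    by (simp add: \<mu>_def sum.distrib sum_subtractf algebra_simps)
  have m1: "((\<lambda>d. ?w d * ?S d l) has_sum \<mu>) (fock (A * R))" if l: "l < A" for l
  proof -
    have "((\<lambda>d. ?w d * \<mu> + (\<Sum>r<R. ?w d * (real (d ! (l * R + r)) - N))) has_sum (1 * \<mu> + (\<Sum>r<R. 0))) (fock (A * R))"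
      using idx[OF l] R idx[OF l, of 0] by (intro has_sum_add has_sum_cmult_left has_sum_finite_sum therm_product_moments N) auto
    moreover have "?w d * \<mu> + (\<Sum>r<R. ?w d * (real (d ! (l * R + r)) - N)) = ?w d * ?S d l" for d
      unfolding sum_distrib_left[symmetric] Sm[symmetric] by (simp add: algebra_simps)
    ultimately show ?thesis by simp
  qed
  have m2: "((\<lambda>d. ?w d * (?S d l - \<mu>)\<^sup>2) has_sum (real R * (N * (N + 1)))) (fock (A * R))" if l: "l < A" for l
  proof -
    have "((\<lambda>d. \<Sum>r<R. \<Sum>r'<R. ?w d * ((real (d ! (l * R + r)) - N) * (real (d ! (l * R + r')) - N))) has_sum
        (\<Sum>r<R. \<Sum>r'<R. if l * R + r = l * R + r' then N * (N + 1) else 0)) (fock (A * R))"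
      using idx[OF l] by (intro has_sum_finite_sum therm_product_moments N) auto
    moreover have "(\<Sum>r<R. \<Sum>r'<R. ?w d * ((real (d ! (l * R + r)) - N) * (real (d ! (l * R + r')) - N))) = ?w d * (?S d l - \<mu>)\<^sup>2" for d
      unfolding Sm power2_eq_square sum_product by (simp add: sum_distrib_left)
    moreover have "(\<Sum>r<R. \<Sum>r'<R. if l * R + r = l * R + r' then N * (N + 1) else 0) = real R * (N * (N + 1))"
      by simp
    ultimately show ?thesis by simp
  qed
  have "((\<lambda>d. \<Sum>l<A. ?w d * ?S d l + (- 1 / \<mu>) * (?w d * (?S d l - \<mu>)\<^sup>2)) has_sum
      (\<Sum>l<A. \<mu> + (- 1 / \<mu>) * (real R * (N * (N + 1))))) (fock (A * R))"
    by (intro has_sum_finite_sum has_sum_add has_sum_cmult_right m1 m2) auto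
  moreover have "(\<Sum>l<A. ?w d * ?S d l + (- 1 / \<mu>) * (?w d * (?S d l - \<mu>)\<^sup>2)) = ?w d * ?G d" for d
  proof -
    have "?w d * ?G d = (\<Sum>l<A. ?w d * (?S d l - (?S d l - \<mu>)\<^sup>2 / \<mu>))" by (rule sum_distrib_left)
    then show ?thesis by (simp add: right_diff_distrib)
  qed
  ultimately have hs: "((\<lambda>d. ?w d * ?G d) has_sum (\<Sum>l<A. \<mu> + (- 1 / \<mu>) * (real R * (N * (N + 1))))) (fock (A * R))"
    by simp
  have "real R * (N * (N + 1)) / \<mu> = N" using N R by (simp add: \<mu>_def)
  then have "(\<Sum>l<A. \<mu> + (- 1 / \<mu>) * (real R * (N * (N + 1)))) = real A * (\<mu> - N)" by simp
  also have "real (A * R) * (N + 1) * (1 - 1 / real R) < real A * (\<mu> - N)"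
  proof -
    have "real (A * R) * (N + 1) * (1 - 1 / real R) = real A * (\<mu> - N - 1)"
    proof -
      have "real R * (1 - 1 / real R) = real R - 1" using R by (simp add: right_diff_distrib)
      then have "real A * (N + 1) * (real R * (1 - 1 / real R)) = real A * (N + 1) * (real R - 1)" by simp
      then show ?thesis by (simp add: \<mu>_def algebra_simps)
    qed
    then show ?thesis using A by simp
  qed
  finally have lt: "real (A * R) * (N + 1) * (1 - 1 / real R) < (\<Sum>l<A. \<mu> + (- 1 / \<mu>) * (real R * (N * (N + 1))))" .
  from order_tendstoD(1)[OF hs[unfolded has_sum_def] lt]
  obtain D where D: "finite D" "D \<subseteq> fock (A * R)" "real (A * R) * (N + 1) * (1 - 1 / real R) < (\<Sum>d\<in>D. ?w d * ?G d)"
    unfolding eventually_finite_subsets_at_top by blast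
  have "(\<Sum>d\<in>D. ?w d * ?G d) \<le> (\<Sum>d\<in>D. ?w d * ((\<Sum>l<A. sqrt (?S d l))\<^sup>2 / real A))"
    using N by (intro sum_mono mult_left_mono sum_sqrt_sq_ge A \<mu> sum_nonneg prod_nonneg) (auto simp: therm_nonneg)
  with D show ?thesis by (intro exI[of _ D]) auto
qed

section \<open>From the symbol channel to a quantum code\<close>

section \<open>The code\<close>

lemma has_trace_sum:
  assumes "finite I" "\<And>k. k \<in> I \<Longrightarrow> has_trace S (P k) \<rho> (\<tau> k)"
  shows "has_trace S (\<lambda>x z. \<Sum>k\<in>I. P k x z) \<rho> (\<Sum>k\<in>I. \<tau> k)"
  using assms
proof (induction I rule: finite_induct)
  case empty
  then show ?case using has_trace_finite[of "{}" S "\<lambda>_ _. 0" \<rho>] by simp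
next
  case (insert k I)
  have "has_trace S (\<lambda>x z. 0 - (\<Sum>k\<in>I. P k x z)) \<rho> (0 - (\<Sum>k\<in>I. \<tau> k))"
    using insert has_trace_finite[of "{}" S "\<lambda>_ _. 0" \<rho>] by (intro has_trace_diff) auto
  from has_trace_diff[OF insert.prems[of k] this] show ?case
    using insert.hyps by simp
qed

text \<open>Measuring block by block turns Bob's output into a \<open>symbol_channel\<close> to
  which \<open>coding\<close> applies. In \<open>s\<close>, the power \<open>Suc (A * R)\<close>
  collects one factor per empty idler and one from the square of \<open>coherence\<close>.\<close>

lemma exists_code:
  fixes \<eta> N N\<^sub>T N\<^sub>S \<kappa> t s :: real and A R B M n :: nat
  assumes \<eta>: "0 < \<eta>" "\<eta> < 1" and N: "0 < N" and NT: "N\<^sub>T = (1 - \<eta>) * N" and NS: "0 < N\<^sub>S"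
    and A: "0 < A" and R: "0 < R" and M: "1 \<le> M" and n: "B * (A * R) \<le> n" and \<kappa>: "0 \<le> \<kappa>"
    and s: "s = real (A * R) * (N\<^sub>S * \<eta> / (N\<^sub>T + 1)) * (1 / (N\<^sub>S + 1)) ^ Suc (A * R) * (1 - 1 / real R)"
  shows "\<exists>C. is_code n C \<and> photons C = N\<^sub>S \<and> num_msgs C = M \<and> num_keys C = 1 \<and>
    error_prob \<eta> N n C 1 \<le> exp (\<kappa> * t - real B * s * (1 - exp (- \<kappa>))) + real M * (2 ^ B * real A powr (- t))"
proof -
  have NTpos: "0 < N\<^sub>T" using NT \<eta> N by simp
  define K where "K = A * R"
  obtain D where D: "finite D" "D \<subseteq> fock (A * R)" and D_ge: "real (A * R) * (N\<^sub>T + 1) * (1 - 1 / real R) \<le>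
    (\<Sum>d\<in>D. (\<Prod>i<A * R. therm N\<^sub>T (d ! i)) * ((\<Sum>l<A. sqrt (\<Sum>r<R. real (d ! (l * R + r)) + 1))\<^sup>2 / real A))"
    using exists_finite_patterns[OF NTpos A R] by blast
  interpret signal_block \<eta> N N\<^sub>T N\<^sub>S A R D
    using assms D by unfold_locales
  let ?K = "fock K \<times> fock K" and ?S = "fock n \<times> fock n"
  define \<rho> where "\<rho> m = tensor_modes2 K (\<lambda>j. bob_mode \<eta> N N\<^sub>S (phase m j))" for m
  have "\<exists>q :: nat \<Rightarrow> real. (\<forall>a\<le>A. 0 \<le> q a \<and> has_trace ?K (outcome a) (\<rho> m) (of_real (q a)))
    \<and> (\<Sum>a\<le>A. q a) = 1 \<and> (\<forall>a<A. q a = (\<Sum>d\<in>D. Re (op_form supp (\<rho> m) (ket a d) (ket a d))))" for m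
    unfolding K_def
  proof (rule outcome_trace)
    show "op_pos (fock (A * R) \<times> fock (A * R)) (\<rho> m)"
      unfolding \<rho>_def K_def by (intro op_pos_tensor_modes2 op_pos_bob_mode[OF \<eta> N])
    show "((\<lambda>x. \<rho> m x x) has_sum 1) (fock (A * R) \<times> fock (A * R))"
      unfolding \<rho>_def K_def by (rule tensor_modes2_trace) (rule bob_mode_trace[OF \<eta> N NS])
  qed
  then have "\<forall>m. \<exists>q :: nat \<Rightarrow> real. (\<forall>a\<le>A. 0 \<le> q a \<and> has_trace ?K (outcome a) (\<rho> m) (of_real (q a)))
    \<and> (\<Sum>a\<le>A. q a) = 1 \<and> (\<forall>a<A. q a = (\<Sum>d\<in>D. Re (op_form supp (\<rho> m) (ket a d) (ket a d))))" ..
  from choice[OF this] obtain Q :: "nat \<Rightarrow> nat \<Rightarrow> real"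
    where Q: "\<forall>m. (\<forall>a\<le>A. 0 \<le> Q m a \<and> has_trace ?K (outcome a) (\<rho> m) (of_real (Q m a)))
    \<and> (\<Sum>a\<le>A. Q m a) = 1 \<and> (\<forall>a<A. Q m a = (\<Sum>d\<in>D. Re (op_form supp (\<rho> m) (ket a d) (ket a d))))" ..
  have Q_nonneg: "0 \<le> Q m a" if "a \<le> A" for m a using Q that by simp
  have Q_trace: "has_trace ?K (outcome a) (\<rho> m) (of_real (Q m a))" if "a \<le> A" for m a using Q that by simp
  have Q_sum: "(\<Sum>a\<le>A. Q m a) = 1" for m using Q by simp
  have Q_eq: "Q m a = (\<Sum>d\<in>D. Re (op_form supp (\<rho> m) (ket a d) (ket a d)))" if "a < A" for m a using Q that by simp
  have Q_diag: "s \<le> Q m m" if "m < A" for m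
  proof -
    have coh: "coherence\<^sup>2 = N\<^sub>S * \<eta> / (N\<^sub>T + 1)\<^sup>2 * (1 / (N\<^sub>S + 1))"
      using NS \<eta> by (simp add: coherence_def power_divide power_mult_distrib)
    have th0: "therm N\<^sub>S 0 = 1 / (N\<^sub>S + 1)" by (simp add: therm_def)
    \<comment> \<open>The squared coherence has \<open>N\<^sub>T + 1\<close> squared in its
      denominator; the mean weight \<open>N\<^sub>T + 1\<close> per mode restores one power.\<close>
    have "s = coherence\<^sup>2 * ((therm N\<^sub>S 0) ^ K * (real (A * R) * (N\<^sub>T + 1) * (1 - 1 / real R)))"
    proof -
      have "(N\<^sub>S * \<eta> / (N\<^sub>T + 1)\<^sup>2 * (1 / (N\<^sub>S + 1))) * (N\<^sub>T + 1) = (N\<^sub>S * \<eta> / (N\<^sub>T + 1)) * (1 / (N\<^sub>S + 1))"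
        using NTpos by (simp add: power2_eq_square)
      note e = this
      have "coherence\<^sup>2 * ((therm N\<^sub>S 0) ^ K * (real (A * R) * (N\<^sub>T + 1) * (1 - 1 / real R))) =
          real (A * R) * ((N\<^sub>S * \<eta> / (N\<^sub>T + 1)\<^sup>2 * (1 / (N\<^sub>S + 1))) * (N\<^sub>T + 1)) * (1 / (N\<^sub>S + 1)) ^ K * (1 - 1 / real R)"
        unfolding coh th0 by (simp only: mult_ac)
      also have "\<dots> = s"
        unfolding e s power_Suc K_def by (simp only: mult_ac)
      finally show ?thesis ..
    qed
    also have "\<dots> \<le> coherence\<^sup>2 * ((therm N\<^sub>S 0) ^ K * (\<Sum>d\<in>D. (\<Prod>i<A * R. therm N\<^sub>T (d ! i)) *
        ((\<Sum>l<A. sqrt (\<Sum>r<R. real (d ! (l * R + r)) + 1))\<^sup>2 / real A)))"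
      using D_ge NS by (intro mult_left_mono) (auto simp: therm_nonneg)
    also have "\<dots> = (\<Sum>d\<in>D. coherence\<^sup>2 * (ground d * ((\<Sum>l<A. sqrt (weight d l))\<^sup>2 / real A)))"
      unfolding sum_distrib_left ground_def weight_def prod.distrib K_def by (simp add: mult_ac)
    also have "\<dots> \<le> (\<Sum>d\<in>D. Re (op_form supp (\<rho> m) (ket m d) (ket m d)))"
      unfolding \<rho>_def K_def by (intro sum_mono success_ge)
    finally show ?thesis by (simp add: Q_eq[OF that])
  qed
  interpret symbol_channel A Q s
    using A Q_nonneg Q_sum Q_diag by unfold_locales auto
  obtain cs dec where cs: "\<And>w. cs w \<in> inputs B" and dec: "\<And>y. dec y \<in> {1..M}"
    and err: "(\<Sum>w\<in>{1..M}. \<Sum>y\<in>outputs B. if dec y \<noteq> w then prob_seq B (cs w) y else 0) / real M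
      \<le> exp (\<kappa> * t - real B * s * (1 - exp (- \<kappa>))) + real M * (2 ^ B * real A powr (- t))"
    using coding[OF M \<kappa>, of B t] by blast
  define r where "r = n - B * K"
  have nr: "n = B * K + r" using n by (simp add: r_def K_def)
  \<comment> \<open>The modes behind the last complete block are sent unmodulated.\<close>
  define \<theta> where "\<theta> w j = (if j < B * K then phase (cs w (j div K)) (j mod K) else 0)" for w j
  \<comment> \<open>Coarse-graining the outcome sequences by the classical decision gives one POVM
    element per message.\<close>
  define Pi where "Pi w x z = (\<Sum>y\<in>{y \<in> outputs B. dec y = w}. block_measurement K outcome B y x z)" for w x z
  define C where "C = \<lparr>photons = N\<^sub>S, num_msgs = M, num_keys = 1, phases = (\<lambda>w k. \<theta> w), decoder = (\<lambda>k. Pi)\<rparr>"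
  have C: "photons C = N\<^sub>S" "num_msgs C = M" "num_keys C = 1" "phases C w k = \<theta> w" "decoder C k = Pi" for w k
    by (simp_all add: C_def)
  have "povm ?S {1..M} Pi"
    unfolding povm_def
  proof (intro conjI ballI)
    fix w show "op_pos ?S (Pi w)"
      unfolding Pi_def by (intro op_pos_sum op_pos_block_measurement op_pos_outcome)
  next
    fix x z assume xz: "x \<in> ?S" "z \<in> ?S"
    have "(\<Sum>w\<in>{1..M}. Pi w x z) = (\<Sum>y\<in>outputs B. block_measurement K outcome B y x z)"
      unfolding Pi_def using dec by (intro sum.group finite_outputs) auto
    also have "\<dots> = op_id x z"
      unfolding outputs_def using xz outcome_complete unfolding nr by (rule block_measurement_complete[rotated 1])
    finally show "(\<Sum>w\<in>{1..M}. Pi w x z) = op_id x z" .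
  qed
  then have code: "is_code n C" using NS M by (simp add: is_code_def C)
  have tr: "has_trace ?S (block_measurement K outcome B y) (bob_state \<eta> N n C w k) (of_real (prob_seq B (cs w) y))"
    if y: "y \<in> outputs B" for w k y
  proof -
    let ?A = "\<lambda>j. bob_mode \<eta> N N\<^sub>S (\<theta> w j)"
    have "has_trace ?K (outcome (y b)) (tensor_modes2 K (\<lambda>j. ?A (b * K + j))) (of_real (Q (cs w b) (y b)))" if b: "b < B" for b
    proof -
      have "\<theta> w (b * K + j) = phase (cs w b) j" if j: "j < K" for j
      proof -
        have "b * K + j < Suc b * K" using j by simp
        also have "\<dots> \<le> B * K" using b by (intro mult_le_mono1) simp
        finally show ?thesis using j by (simp add: \<theta>_def)
      qed
      then have "tensor_modes2 K (\<lambda>j. ?A (b * K + j)) = \<rho> (cs w b)"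
        by (auto simp: fun_eq_iff \<rho>_def tensor_modes2_def)
      then show ?thesis using Q_trace[OF outputs_le[OF y b]] by simp
    qed
    then have "has_trace (fock (B * K + r) \<times> fock (B * K + r)) (block_measurement K outcome B y) (tensor_modes2 (B * K + r) ?A)
        (\<Prod>b<B. of_real (Q (cs w b) (y b)))"
      by (intro block_measurement_trace bob_mode_trace[OF \<eta> N NS])
    then show ?thesis
      by (simp add: bob_state_eq[OF \<eta> N] C nr prob_seq_def)
  qed
  have prob: "prob_estimate \<eta> N n C k w w' = (\<Sum>y\<in>{y \<in> outputs B. dec y = w'}. prob_seq B (cs w) y)" for k w w'
  proof -
    have "has_trace ?S (Pi w') (bob_state \<eta> N n C w k) (\<Sum>y\<in>{y \<in> outputs B. dec y = w'}. of_real (prob_seq B (cs w) y))"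
      unfolding Pi_def using tr finite_outputs by (intro has_trace_sum) auto
    from has_trace_op_trace[OF this] show ?thesis
      by (simp add: prob_estimate_def C flip: of_real_sum)
  qed
  have "(\<Sum>w'\<in>{1..M} - {w}. prob_estimate \<eta> N n C 1 w w') = (\<Sum>y\<in>outputs B. if dec y \<noteq> w then prob_seq B (cs w) y else 0)" for w
  proof -
    have "(\<Sum>w'\<in>{1..M} - {w}. prob_estimate \<eta> N n C 1 w w') =
        (\<Sum>w'\<in>{1..M} - {w}. \<Sum>y\<in>{y \<in> {y \<in> outputs B. dec y \<noteq> w}. dec y = w'}. prob_seq B (cs w) y)"
      unfolding prob by (intro sum.cong) auto
    also have "\<dots> = (\<Sum>y\<in>{y \<in> outputs B. dec y \<noteq> w}. prob_seq B (cs w) y)"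
      using dec finite_outputs[of B] by (intro sum.group) auto
    also have "\<dots> = (\<Sum>y\<in>outputs B. if dec y \<noteq> w then prob_seq B (cs w) y else 0)"
      using finite_outputs by (intro sum.inter_filter) auto
    finally show ?thesis .
  qed
  then have "error_prob \<eta> N n C 1 = (\<Sum>w\<in>{1..M}. \<Sum>y\<in>outputs B. if dec y \<noteq> w then prob_seq B (cs w) y else 0) / real M"
    by (simp add: error_prob_def C)
  with err code show ?thesis by (intro exI[of _ C]) (simp add: C)
qed

section \<open>Choice of parameters and the limit\<close>

section \<open>Asymptotics\<close>

lemma exp_neg_le: "0 \<le> x \<Longrightarrow> exp (- x) \<le> 1 - x + x\<^sup>2 / 2" for x :: real
proof -
  assume x: "0 \<le> x"
  have "(\<lambda>x. 1 - x + x\<^sup>2 / 2 - exp (- x)) 0 \<le> (\<lambda>x. 1 - x + x\<^sup>2 / 2 - exp (- x)) x"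
  proof (rule DERIV_nonneg_imp_nondecreasing[OF x])
    fix y :: real assume "0 \<le> y"
    have "((\<lambda>x. 1 - x + x\<^sup>2 / 2 - exp (- x)) has_real_derivative (- 1 + y + exp (- y))) (at y)"
      by (auto intro!: derivative_eq_intros)
    moreover have "0 \<le> - 1 + y + exp (- y)" using exp_ge_add_one_self[of "- y"] by simp
    ultimately show "\<exists>d. ((\<lambda>x. 1 - x + x\<^sup>2 / 2 - exp (- x)) has_real_derivative d) (at y) \<and> 0 \<le> d" by blast
  qed
  then show ?thesis by simp
qed

locale covert_setting =
  fixes \<eta> N\<^sub>B N\<^sub>T \<epsilon> \<delta> :: real
  assumes \<eta>: "0 < \<eta>" "\<eta> < 1" and N: "0 < N\<^sub>B" and NT: "N\<^sub>T = (1 - \<eta>) * N\<^sub>B"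
    and \<epsilon>: "0 < \<epsilon>" "\<epsilon> < 1" and \<delta>: "0 < \<delta>" "\<delta> < 1"
begin

definition good :: "nat \<Rightarrow> nat \<Rightarrow> bool" where
  "good n M \<longleftrightarrow> (\<exists>C. is_code n C \<and> num_keys C = 1 \<and> reliable \<eta> N\<^sub>B n \<epsilon> C \<and> covert \<eta> N\<^sub>B n \<delta> C \<and> num_msgs C = M)"

text \<open>\<open>brightness / sqrt n\<close> is the mean photon number for which the hypothesis
  \<open>bound\<close> of \<open>covert_TMSV\<close> holds with equality.\<close>

definition brightness :: real where
  "brightness = 2 * \<delta> * sqrt (\<eta> * N\<^sub>B * (\<eta> * N\<^sub>B + 1)) / (1 - \<eta>)"

text \<open>Successes per \<open>sqrt n\<close> to leading order; the final 1/2 is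
  \<open>ln A / ln n\<close> in the limit.\<close>

definition rate :: real where
  "rate = brightness * \<eta> / (N\<^sub>T + 1) / 2"

text \<open>The cap makes the maximum exist and keeps the normalised logarithm from exceeding
  \<open>rate\<close>, so that a limit exists and not only a lower limit.\<close>

definition best :: "nat \<Rightarrow> nat" where
  "best n = Max {M. good n M \<and> real M \<le> exp (rate * sqrt (real n) * ln (real n))}"

lemma brightness_pos: "0 < brightness"
  unfolding brightness_def using \<eta> N \<delta> by (intro divide_pos_pos mult_pos_pos real_sqrt_gt_zero add_pos_pos) auto

lemma goodI:
  assumes "is_code n C" "num_keys C = 1" "photons C = brightness / sqrt (real n)" "error_prob \<eta> N\<^sub>B n C 1 \<le> \<epsilon>" "1 \<le> n"
  shows "good n (num_msgs C)"
proof -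
  have "covert \<eta> N\<^sub>B n \<delta> C"
    using assms \<eta> N \<delta> brightness_pos
    by (intro covert_TMSV) (auto simp: is_code_def brightness_def)
  moreover have "reliable \<eta> N\<^sub>B n \<epsilon> C"
    using assms by (simp add: reliable_def)
  ultimately show ?thesis using assms unfolding good_def by blast
qed

text \<open>A single message is never decoded wrongly. This provides a code for every
  \<open>n\<close>, including those too small for the asymptotic construction.\<close>

lemma good_1:
  assumes "1 \<le> n"
  shows "good n 1"
proof -
  define C where "C = \<lparr>photons = brightness / sqrt (real n), num_msgs = 1, num_keys = 1, phases = (\<lambda>_ _ _. 0), decoder = (\<lambda>_ _. op_id)\<rparr>"
  have "is_code n C" using assms brightness_pos op_pos_op_id by (auto simp: is_code_def C_def povm_def)
  moreover have "error_prob \<eta> N\<^sub>B n C 1 \<le> \<epsilon>"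
  proof -
    have "{1..1} - {w} = {}" if "w \<in> {1..1}" for w :: nat using that by auto
    then have "error_prob \<eta> N\<^sub>B n C 1 = 0" by (simp add: error_prob_def C_def)
    then show ?thesis using \<epsilon> by simp
  qed
  ultimately show ?thesis using goodI[of n C] assms by (simp add: C_def)
qed

lemma rate_pos: "0 < rate"
proof -
  have "0 < N\<^sub>T" using NT \<eta> N by simp
  then show ?thesis using brightness_pos \<eta> by (simp add: rate_def)
qed

text \<open>Any rate below the target leaves a constant fraction to spend: the confusion exponent is
  then of order \<open>- sqrt n * ln n\<close>, which absorbs \<open>2 ^ B\<close> and all other
  terms of order \<open>sqrt n\<close>.\<close>

lemma eventually_good:
  assumes \<rho>: "0 < \<rho>" "\<rho> < rate"
  shows "eventually (\<lambda>n. good n (nat \<lfloor>exp (\<rho> * sqrt (real n) * ln (real n))\<rfloor>)) sequentially"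
proof -
  have NTpos: "0 < N\<^sub>T" using NT \<eta> N by simp
  \<comment> \<open>A factor \<open>1 - \<kappa>\<close> is lost four times: to the incomplete last
    block, to the powers of \<open>1 / (NS + 1)\<close>, to \<open>1 / R\<close> and to the decoding
    threshold. Here \<open>4 * \<kappa>\<close> is half of the gap
    \<open>1 - \<rho> / rate\<close>.\<close>
  define \<kappa> where "\<kappa> = (1 - \<rho> / rate) / 8"
  have "0 < \<rho> / rate" "\<rho> / rate < 1"
    using \<rho> rate_pos by simp_all
  then have \<kappa>: "0 < \<kappa>" "\<kappa> < 1" by (simp_all add: \<kappa>_def)
  have \<rho>_lt: "\<rho> < (1 - \<kappa>) ^ 4 * rate"
  proof -
    have "1 + real 4 * (- \<kappa>) \<le> (1 + (- \<kappa>)) ^ 4" using \<kappa> by (intro Bernoulli_inequality) auto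
    moreover have "\<rho> / rate < 1 - 4 * \<kappa>" using \<rho> rate_pos by (simp add: \<kappa>_def field_simps)
    ultimately have "\<rho> / rate < (1 - \<kappa>) ^ 4" by simp
    then show ?thesis using rate_pos by (simp add: divide_less_eq)
  qed
  \<comment> \<open>Keeps the loss \<open>1 / R\<close> from fluctuating group weights below
    \<kappa>.\<close>
  define R where "R = nat \<lceil>1 / \<kappa>\<rceil>"
  have R: "1 / \<kappa> \<le> real R" by (simp add: R_def real_nat_ceiling_ge)
  then have Rpos: "0 < R" using \<kappa> by (metis gr0I of_nat_0 not_less zero_less_divide_1_iff)
  have R1: "1 - \<kappa> \<le> 1 - 1 / real R" using R \<kappa> Rpos by (simp add: field_simps)
  define b where "b = brightness"
  have b: "0 < b" using brightness_pos by (simp add: b_def)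
  \<comment> \<open>Chosen so that \<open>K * NS\<close>, the mean number of signal photons in a
    block, is at most \<open>\<kappa> / 2\<close>.\<close>
  define x where "x = \<kappa> / (2 * real R * b)"
  have x: "0 < x" using \<kappa> Rpos b by (simp add: x_def)
  define c where "c = b * \<eta> / (N\<^sub>T + 1)"
  have c: "0 < c" using b \<eta> NTpos by (simp add: c_def)
  have rate2: "rate = c / 2" by (simp add: rate_def c_def b_def)
  define a where "a = (1 - \<kappa>) ^ 4 * rate - \<rho>"
  have a: "0 < a" using \<rho>_lt by (simp add: a_def)
  \<comment> \<open>Collects the terms of order \<open>sqrt n\<close> in the confusion exponent: the
    factor \<open>2 ^ B\<close> and the constant \<open>ln (x / 2)\<close> inside
    \<open>ln A\<close>.\<close>
  define g where "g = 2 / (real R * x) * ln 2 - (1 - \<kappa>) ^ 4 * c * ln (x / 2)"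
  define h where "h = \<kappa>\<^sup>2 / 2 * ((1 - \<kappa>) ^ 3 * c)"
  have h: "0 < h" using \<kappa> c by (simp add: h_def)
  define Rx where "Rx = real R * x"
  have Rx: "0 < Rx" using Rpos x by (simp add: Rx_def)
  define l where "l = ln (\<epsilon> / 2)"
  \<comment> \<open>\<open>e1\<close> makes the signal weak, \<open>e2\<close> the alphabet
    nonempty, \<open>e3\<close> the incomplete block negligible; \<open>e4\<close> and
    \<open>e5\<close> bring missed and confused codewords below \<open>\<epsilon> / 2\<close>
    each.\<close>
  have e1: "eventually (\<lambda>n. b / sqrt (real n) \<le> \<kappa> / 2) sequentially" using \<kappa> by real_asymp
  have e2: "eventually (\<lambda>n. 2 \<le> x * sqrt (real n)) sequentially" using x by real_asymp
  have e3: "eventually (\<lambda>n. Rx * sqrt (real n) \<le> \<kappa> * real n) sequentially" using \<kappa> Rx by real_asymp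
  have e4: "eventually (\<lambda>n. - h * sqrt (real n) \<le> l) sequentially" using h by real_asymp
  have e5: "eventually (\<lambda>n. sqrt (real n) * (g - a * ln (real n)) \<le> l) sequentially" using a by real_asymp
  show ?thesis
    using e1 e2 e3 e4 e5 eventually_ge_at_top[of 1]
  proof eventually_elim
    case (elim n)
    define q where "q = sqrt (real n)"
    have q: "0 < q" "q * q = real n" using elim by (auto simp: q_def)
    define A where "A = nat \<lfloor>x * q\<rfloor>"
    have A_le: "real A \<le> x * q" using x q by (simp add: A_def)
    have A_ge: "x * q / 2 \<le> real A"
    proof -
      have "x * q < real A + 1" unfolding A_def using x q by (simp add: of_nat_nat floor_le_iff)
      then show ?thesis using elim(2) by (simp add: q_def)
    qed
    have A1: "1 \<le> real A" using A_ge elim(2) by (simp add: q_def)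
    then have Apos: "0 < A" by (cases A) auto
    define K where "K = A * R"
    have Kpos: "0 < K" using Apos Rpos by (simp add: K_def)
    have K_le: "real K \<le> Rx * q" using A_le Rpos by (simp add: K_def Rx_def mult_right_mono mult.commute mult.left_commute)
    have K_ge: "Rx * q / 2 \<le> real K" using mult_left_mono[OF A_ge, of "real R"] by (simp add: K_def Rx_def mult_ac)
    define NS where "NS = b / q"
    have NS: "0 < NS" using b q by (simp add: NS_def)
    have NS1: "NS \<le> \<kappa> / 2" using elim(1) by (simp add: NS_def q_def)
    define B where "B = n div K"
    have BK: "B * K \<le> n" by (simp add: B_def)
    have BK_ge: "(1 - \<kappa>) * real n \<le> real B * real K"
    proof -
      have "n = B * K + n mod K" by (simp add: B_def)
      then have "real n = real B * real K + real (n mod K)" by (metis of_nat_add of_nat_mult)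
      moreover have "real (n mod K) \<le> real K" using Kpos by (simp add: less_imp_le)
      moreover have "real K \<le> \<kappa> * real n" using K_le elim(3) by (simp add: q_def)
      ultimately show ?thesis by (simp add: algebra_simps)
    qed
    have B_le: "real B \<le> 2 / Rx * q"
    proof -
      have "real B * (Rx * q / 2) \<le> real B * real K" using K_ge by (intro mult_left_mono) auto
      also have "\<dots> \<le> q * q" using BK q(2) by (metis of_nat_le_iff of_nat_mult)
      finally have "(real B * Rx / 2) * q \<le> q * q" by (simp add: mult_ac)
      then have "real B * Rx / 2 \<le> q" using q(1) by (rule mult_right_le_imp_le)
      then show ?thesis using Rx by (simp add: field_simps)
    qed
    define s where "s = real (A * R) * (NS * \<eta> / (N\<^sub>T + 1)) * (1 / (NS + 1)) ^ Suc (A * R) * (1 - 1 / real R)"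
    have s_ge: "(1 - \<kappa>)\<^sup>2 * (real K * (c / q)) \<le> s"
    proof -
      \<comment> \<open>Bernoulli's inequality, as \<open>Suc K * NS\<close> is at most
        \<kappa>.\<close>
      have "1 - \<kappa> \<le> (1 / (NS + 1)) ^ Suc K"
      proof -
        have "real (Suc K) * NS \<le> \<kappa>"
        proof -
          have "real (Suc K) * NS = real K * NS + NS" by (simp add: algebra_simps)
          also have "real K * NS \<le> Rx * q * NS" using K_le NS by (intro mult_right_mono) auto
          also have "Rx * q * NS = \<kappa> / 2" using q Rpos b by (simp add: Rx_def x_def NS_def)
          finally show ?thesis using NS1 by simp
        qed
        moreover have "1 + real (Suc K) * (- NS) \<le> (1 + (- NS)) ^ Suc K"
          using NS1 \<kappa> by (intro Bernoulli_inequality) auto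
        moreover have "(1 + (- NS)) ^ Suc K \<le> (1 / (NS + 1)) ^ Suc K"
        proof (rule power_mono)
          show "1 + - NS \<le> 1 / (NS + 1)" using NS by (subst pos_le_divide_eq) (auto simp: algebra_simps)
        qed (use NS1 \<kappa> in auto)
        ultimately show ?thesis by linarith
      qed
      then have "(1 - \<kappa>) * (1 - \<kappa>) \<le> (1 / (NS + 1)) ^ Suc K * (1 - 1 / real R)"
        using R1 \<kappa> NS by (intro mult_mono) auto
      then have "(real K * (c / q)) * ((1 - \<kappa>) * (1 - \<kappa>)) \<le> (real K * (c / q)) * ((1 / (NS + 1)) ^ Suc K * (1 - 1 / real R))"
        using c q by (intro mult_left_mono) auto
      also have "\<dots> = s" by (simp add: s_def K_def[symmetric] c_def NS_def mult_ac)
      finally show ?thesis by (simp add: power2_eq_square mult_ac)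
    qed
    define G where "G = real B * s"
    have G_ge: "(1 - \<kappa>) ^ 3 * c * q \<le> G"
    proof -
      have "(1 - \<kappa>) ^ 3 * c * q = (1 - \<kappa>)\<^sup>2 * (c / q) * ((1 - \<kappa>) * real n)"
        using q(1) by (simp add: q(2)[symmetric] power2_eq_square power3_eq_cube)
      also have "\<dots> \<le> (1 - \<kappa>)\<^sup>2 * (c / q) * (real B * real K)"
        using BK_ge c q by (intro mult_left_mono) auto
      also have "\<dots> = real B * ((1 - \<kappa>)\<^sup>2 * (real K * (c / q)))" by (simp add: mult_ac)
      also have "\<dots> \<le> G" unfolding G_def using s_ge by (intro mult_left_mono) auto
      finally show ?thesis .
    qed
    have G0: "0 \<le> G" using G_ge \<kappa> c q by (smt (verit) mult_nonneg_nonneg zero_le_power)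
    \<comment> \<open>\<open>G\<close> is a lower bound on the mean number of correctly received
      symbols; a threshold slightly below it is rarely missed.\<close>
    define t where "t = (1 - \<kappa>) * G"
    define M where "M = nat \<lfloor>exp (\<rho> * sqrt (real n) * ln (real n))\<rfloor>"
    have lnn: "0 \<le> ln (real n)" using elim by simp
    have M_le: "real M \<le> exp (\<rho> * q * ln (real n))" by (simp add: M_def q_def)
    have M1: "1 \<le> M"
    proof -
      have "1 \<le> exp (\<rho> * sqrt (real n) * ln (real n))" using \<rho> lnn by simp
      then show ?thesis unfolding M_def by (simp add: le_nat_iff le_floor_iff)
    qed
    obtain C where C: "is_code n C" "photons C = NS" "num_msgs C = M" "num_keys C = 1"
      "error_prob \<eta> N\<^sub>B n C 1 \<le> exp (\<kappa> * t - real B * s * (1 - exp (- \<kappa>))) + real M * (2 ^ B * real A powr (- t))"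
      using exists_code[OF \<eta> N NT NS Apos Rpos M1 BK[unfolded K_def] less_imp_le[OF \<kappa>(1)] s_def, of t] by blast
    have "exp (\<kappa> * t - real B * s * (1 - exp (- \<kappa>))) \<le> \<epsilon> / 2"
    proof -
      have "\<kappa> - \<kappa>\<^sup>2 / 2 \<le> 1 - exp (- \<kappa>)" using exp_neg_le[of \<kappa>] \<kappa> by simp
      then have "G * (\<kappa> - \<kappa>\<^sup>2 / 2) \<le> G * (1 - exp (- \<kappa>))" using G0 by (rule mult_left_mono)
      then have "\<kappa> * t - real B * s * (1 - exp (- \<kappa>)) \<le> - (\<kappa>\<^sup>2 / 2) * G"
        unfolding t_def G_def[symmetric] by (simp add: power2_eq_square algebra_simps)
      also have "\<dots> \<le> - (\<kappa>\<^sup>2 / 2) * ((1 - \<kappa>) ^ 3 * c * q)"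
        using G_ge by (intro mult_left_mono_neg) auto
      also have "\<dots> = - h * q" by (simp add: h_def)
      also have "\<dots> \<le> l" using elim(4) by (simp add: q_def)
      finally have "exp (\<kappa> * t - real B * s * (1 - exp (- \<kappa>))) \<le> exp l" by simp
      then show ?thesis using \<epsilon> by (simp add: l_def)
    qed
    moreover have "real M * (2 ^ B * real A powr (- t)) \<le> \<epsilon> / 2"
    proof -
      have lnA: "ln (x / 2) + ln (real n) / 2 \<le> ln (real A)" "0 \<le> ln (real A)"
      proof -
        have "ln (x * q / 2) \<le> ln (real A)" using A_ge A1 x q by (subst ln_le_cancel_iff) auto
        also have "ln (x * q / 2) = ln (x / 2 * q)" by simp
        also have "\<dots> = ln (x / 2) + ln q" using x q by (subst ln_mult_pos) auto
        also have "ln q = ln (real n) / 2" using elim by (simp add: q_def ln_sqrt)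
        finally show "ln (x / 2) + ln (real n) / 2 \<le> ln (real A)" .
        show "0 \<le> ln (real A)" using A1 by simp
      qed
      have t_ge: "(1 - \<kappa>) ^ 4 * c * q \<le> t"
      proof -
        have "(1 - \<kappa>) ^ 4 * c * q = (1 - \<kappa>) * ((1 - \<kappa>) ^ 3 * c * q)" by (simp add: power4_eq_xxxx power3_eq_cube)
        also have "\<dots> \<le> t" unfolding t_def using G_ge \<kappa> by (intro mult_left_mono) auto
        finally show ?thesis .
      qed
      have "(1 - \<kappa>) ^ 4 * c * q * (ln (x / 2) + ln (real n) / 2) \<le> (1 - \<kappa>) ^ 4 * c * q * ln (real A)"
        using lnA \<kappa> c q by (intro mult_left_mono) auto
      also have "\<dots> \<le> t * ln (real A)" using t_ge lnA by (intro mult_right_mono)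
      finally have tA: "(1 - \<kappa>) ^ 4 * c * q * (ln (x / 2) + ln (real n) / 2) \<le> t * ln (real A)" .
      have B2: "real B * ln 2 \<le> 2 / Rx * q * ln 2" using B_le by (intro mult_right_mono) auto
      have "real M * (2 ^ B * real A powr (- t)) \<le> exp (\<rho> * q * ln (real n)) * (2 ^ B * real A powr (- t))"
        using M_le by (intro mult_right_mono) auto
      also have "\<dots> = exp (\<rho> * q * ln (real n) + real B * ln 2 - t * ln (real A))"
        using Apos by (simp add: powr_def exp_add exp_diff exp_minus exp_of_nat_mult divide_inverse mult_ac)
      also have "\<dots> \<le> exp l"
      proof -
        have "\<rho> * q * ln (real n) + real B * ln 2 - t * ln (real A)
            \<le> \<rho> * q * ln (real n) + 2 / Rx * q * ln 2 - (1 - \<kappa>) ^ 4 * c * q * (ln (x / 2) + ln (real n) / 2)"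
          using tA B2 by linarith
        also have "\<dots> = q * (g - a * ln (real n))"
          by (simp add: g_def a_def rate2 Rx_def algebra_simps)
        also have "\<dots> \<le> l" using elim(5) by (simp add: q_def)
        finally show ?thesis by simp
      qed
      finally show ?thesis using \<epsilon> by (simp add: l_def)
    qed
    ultimately have "error_prob \<eta> N\<^sub>B n C 1 \<le> \<epsilon>" using C(5) by linarith
    then have "good n (num_msgs C)" using C elim by (intro goodI) (auto simp: NS_def q_def b_def)
    then show ?case using C(3) by (simp add: M_def)
  qed
qed

lemma best:
  assumes "1 \<le> n"
  shows "good n (best n)" "1 \<le> best n" "ln (real (best n)) \<le> rate * sqrt (real n) * ln (real n)"
    "\<And>M. good n M \<Longrightarrow> real M \<le> exp (rate * sqrt (real n) * ln (real n)) \<Longrightarrow> M \<le> best n"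
proof -
  let ?S = "{M. good n M \<and> real M \<le> exp (rate * sqrt (real n) * ln (real n))}"
  have "?S \<subseteq> {..nat \<lfloor>exp (rate * sqrt (real n) * ln (real n))\<rfloor>}"
    by (auto simp: le_nat_iff le_floor_iff)
  then have fin: "finite ?S" by (rule finite_subset) simp
  have "1 \<in> ?S" using good_1[OF assms] rate_pos assms by simp
  then have in_S: "best n \<in> ?S" unfolding best_def using fin by (intro Max_in) auto
  show "1 \<le> best n" unfolding best_def using \<open>1 \<in> ?S\<close> fin by (rule Max_ge[rotated])
  then show "ln (real (best n)) \<le> rate * sqrt (real n) * ln (real n)"
    using in_S ln_mono[of "real (best n)" "exp (rate * sqrt (real n) * ln (real n))"]
    by simp
  show "good n (best n)" using in_S by simp
  show "\<And>M. good n M \<Longrightarrow> real M \<le> exp (rate * sqrt (real n) * ln (real n)) \<Longrightarrow> M \<le> best n"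
    unfolding best_def using fin by (intro Max_ge) auto
qed

text \<open>The cap gives the upper bound. For the lower bound \<open>eventually_good\<close> is
  used within \<open>e / 2\<close> of \<open>rate\<close>; rounding \<open>M\<close> down costs at
  most a factor 2, hence \<open>ln 2 / L\<close>, which tends to 0.\<close>

lemma best_rate: "(\<lambda>n. ln (real (best n)) / (sqrt (real n) * ln (real n))) \<longlonglongrightarrow> rate"
proof (rule LIMSEQ_I)
  fix e :: real assume e: "0 < e"
  \<comment> \<open>The maximum with \<open>rate / 2\<close> keeps \<rho> positive when
    \<open>e\<close> is large.\<close>
  define \<rho> where "\<rho> = max (rate / 2) (rate - e / 2)"
  have \<rho>: "0 < \<rho>" "\<rho> < rate" "rate - e / 2 \<le> \<rho>" using rate_pos e by (auto simp: \<rho>_def)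
  have e1: "eventually (\<lambda>n. ln 2 / (sqrt (real n) * ln (real n)) < e / 2) sequentially" using e by real_asymp
  have "eventually (\<lambda>n. norm (ln (real (best n)) / (sqrt (real n) * ln (real n)) - rate) < e) sequentially"
    using eventually_good[OF \<rho>(1,2)] e1 eventually_ge_at_top[of 2]
  proof eventually_elim
    case (elim n)
    define L where "L = sqrt (real n) * ln (real n)"
    have L: "0 < L" unfolding L_def using elim by (intro mult_pos_pos) auto
    define M where "M = nat \<lfloor>exp (\<rho> * L)\<rfloor>"
    have gM: "good n M" using elim(1) by (simp add: M_def L_def mult.assoc)
    have M_le: "real M \<le> exp (\<rho> * L)" by (simp add: M_def)
    have M_ge: "exp (\<rho> * L) / 2 \<le> real M"
    proof -
      have "1 \<le> exp (\<rho> * L)" using \<rho> L by simp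
      then have "1 \<le> real M" by (simp add: M_def le_floor_iff)
      moreover have "exp (\<rho> * L) < real M + 1" unfolding M_def by (simp add: of_nat_nat) 
      ultimately show ?thesis by simp
    qed
    have n1: "1 \<le> n" using elim by simp
    have "exp (\<rho> * L) \<le> exp (rate * L)" using \<rho> L by simp
    then have "real M \<le> exp (rate * sqrt (real n) * ln (real n))" using order_trans[OF M_le] by (simp add: L_def mult.assoc)
    then have "M \<le> best n" by (rule best(4)[OF n1 gM])
    then have "exp (\<rho> * L) / 2 \<le> real (best n)" using M_ge by linarith
    then have "ln (exp (\<rho> * L) / 2) \<le> ln (real (best n))"
      using best(2)[OF n1] by (subst ln_le_cancel_iff) auto
    then have lower: "\<rho> * L - ln 2 \<le> ln (real (best n))" by (simp add: ln_div)
    have upper: "ln (real (best n)) \<le> rate * L" using best(3)[OF n1] by (simp add: L_def mult.assoc)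
    have "ln (real (best n)) / L \<le> rate" using upper L by (simp add: divide_le_eq)
    moreover have "\<rho> - ln 2 / L \<le> ln (real (best n)) / L"
      using divide_right_mono[OF lower, of L] L by (simp add: diff_divide_distrib)
    ultimately show ?case using elim(2) \<rho>(3) e unfolding L_def[symmetric] by (simp add: abs_less_iff)
  qed
  then show "\<exists>n0. \<forall>n\<ge>n0. norm (ln (real (best n)) / (sqrt (real n) * ln (real n)) - rate) < e"
    by (simp add: eventually_sequentially)
qed

end

theorem theorem3:
  fixes \<eta> N\<^sub>B N\<^sub>T \<epsilon> \<delta> :: real
  assumes "0 < \<eta>" and "\<eta> < 1"
    and "0 < N\<^sub>B" and "N\<^sub>T = (1 - \<eta>) * N\<^sub>B"
    and "0 < \<epsilon>" and "\<epsilon> < 1"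
    and "0 < \<delta>" and "\<delta> < 1"
  shows "\<exists>C :: nat \<Rightarrow> tmsv_code.
    (\<forall>n\<ge>1. is_code n (C n) \<and> num_keys (C n) = 1
        \<and> reliable \<eta> N\<^sub>B n \<epsilon> (C n) \<and> covert \<eta> N\<^sub>B n \<delta> (C n))
    \<and> (\<exists>l :: real.
          (\<lambda>n. ln (real (num_msgs (C n))) / (sqrt (real n) * ln (real n))) \<longlonglongrightarrow> l
          \<and> l \<ge> \<eta> / (1 - \<eta>)
                 * (sqrt (\<eta> / (1 - \<eta>) * N\<^sub>T * (\<eta> / (1 - \<eta>) * N\<^sub>T + 1)) / (N\<^sub>T + 1)) * \<delta>)"
proof -
  interpret covert_setting \<eta> N\<^sub>B N\<^sub>T \<epsilon> \<delta>
    using assms by unfold_locales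
  have "\<forall>n. \<exists>C. 1 \<le> n \<longrightarrow> is_code n C \<and> num_keys C = 1 \<and> reliable \<eta> N\<^sub>B n \<epsilon> C \<and> covert \<eta> N\<^sub>B n \<delta> C \<and> num_msgs C = best n"
    using best(1) unfolding good_def by blast
  then obtain C where C: "\<And>n. 1 \<le> n \<Longrightarrow> is_code n (C n) \<and> num_keys (C n) = 1 \<and> reliable \<eta> N\<^sub>B n \<epsilon> (C n)
      \<and> covert \<eta> N\<^sub>B n \<delta> (C n) \<and> num_msgs (C n) = best n"
    by metis
  have "(\<lambda>n. ln (real (num_msgs (C n))) / (sqrt (real n) * ln (real n))) \<longlonglongrightarrow> rate"
    using best_rate
    by (rule Lim_transform_eventually) (use C in \<open>auto simp: eventually_sequentially intro!: exI[of _ 1]\<close>)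
  moreover have "rate = \<eta> / (1 - \<eta>)
                 * (sqrt (\<eta> / (1 - \<eta>) * N\<^sub>T * (\<eta> / (1 - \<eta>) * N\<^sub>T + 1)) / (N\<^sub>T + 1)) * \<delta>"
  proof -
    \<comment> \<open>The stated radicand is the one of Eve's idle mean
      \<open>\<eta> * N\<^sub>B\<close>; the 2 of \<open>brightness\<close> and the 1/2 of
      \<open>rate\<close> cancel.\<close>
    have "\<eta> / (1 - \<eta>) * N\<^sub>T = \<eta> * N\<^sub>B" using assms by simp
    then show ?thesis by (simp add: rate_def brightness_def)
  qed
  ultimately show ?thesis using C by (intro exI[of _ C] conjI exI[of _ rate]) auto
qed

end
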